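(* Let $n\ge2$, $\boldsymbol\lambda\in\mathbb C^n$ with $\sum_l\lambda_l=0$, $\varsigma\in\{+,-\}$, let $\xi$ be an $n$-th root of $\varsigma1$, let $0<\vartheta<\frac12\pi$, and define $$\mathbb S'_\xi(\vartheta)=\Big\{z\in\mathbb U:\ \big|\arg z-\arg(i\overline\xi)\big|<\pi+\frac\pi n-\vartheta\Big\}.$$ Then $J(z;\boldsymbol\lambda;\xi)$ is the unique solution of the Bessel equation of index $\boldsymbol\lambda$ and sign $\varsigma$ that has the asymptotic expansion $\widehat J(z;\boldsymbol\lambda;\xi)$ on $\mathbb S'_\xi(\vartheta)$. Moreover, $J^{(j)}(z;\boldsymbol\lambda;\xi)\sim\widehat J^{(j)}(z;\boldsymbol\lambda;\xi)$ on $\mathbb S'_\xi(\vartheta)$ for every $j\ge0$, where $\widehat J^{(j)}$ is the $j$-th formal derivative.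
   Context: $\mathbb U$ is the universal cover of $\mathbb C\smallsetminus\{0\}$, with elements $z=|z|e^{i\arg z}$, $\arg z\in\mathbb R$, and $z^a=e^{a\log z}$, $\log z=\log|z|+i\arg z$. The root $\xi$ is regarded as a point of $\mathbb U$ (a choice of $\arg\xi$ is fixed), and $\arg(i\overline\xi)=\frac\pi2-\arg\xi$. Bessel equation of index $\boldsymbol\lambda$ and sign $\varsigma$ (on $\mathbb U$): $$\sum_{j=1}^nV_{n,j}(\boldsymbol\lambda)z^jw^{(j)}+\big(V_{n,0}(\boldsymbol\lambda)-\varsigma(in)^nz^n\big)w=0,\qquad V_{n,j}(\boldsymbol\lambda)=\sum_{m=0}^{n-j}A_{j,n-j-m}\,n^m\sigma_m(\boldsymbol\lambda),$$ where $\sigma_m$ is the $m$-th elementary symmetric polynomial, $A_{0,0}=1$, $A_{0,m}=0$ ($m\ge1$), $A_{j,m}=\sum_{r=1}^j\frac{(-1)^{j-r}r^{m+j}}{r!(j-r)!}$ ($j\ge1,m\ge0$). Formal solution: there is a unique sequence of symmetric polynomials $B_m(\boldsymbol\lambda;\xi)$ in $\boldsymbol\lambda$ with $B_0=1$ such that $\widehat J(z;\boldsymbol\lambda;\xi)=e^{in\xi z}z^{-\frac{n-1}2}\sum_{m\ge0}B_m(\boldsymbol\lambda;\xi)z^{-m}$ is a formal solution of this equation. Definition of $J(z;\boldsymbol\lambda;\xi)$: it is the unique solution of this equation having $\widehat J(z;\boldsymbol\lambda;\xi)$ as its asymptotic expansion on the sector $\mathbb S_\xi=\{z\in\mathbb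 U:|\arg z-\arg(i\overline\xi)|<\frac\pi n\}$ (or any open subsector of it). "$f$ has asymptotic expansion $e^{in\xi z}z^{-\frac{n-1}2}\sum_mb_mz^{-m}$ on an open sector" means that for every $M\ge 0$, $f(z)=e^{in\xi z}z^{-\frac{n-1}2}\big(\sum_{m=0}^{M-1}b_mz^{-m}+O(|z|^{-M})\big)$ as $|z|\to\infty$, uniformly on closed subsectors; this is written with $\sim$. *)

theory Defs
  imports "HOL-Complex_Analysis.Complex_Analysis"
    "HOL-Computational_Algebra.Formal_Laurent_Series"
    "HOL-Combinatorics.Permutations"
begin

text \<open>The universal cover \<open>exp : \<complex> \<rightarrow> \<complex> - {0}\<close> of the punctured plane: a point \<open>z\<close> of the cover is
  represented by its logarithm \<open>log \<bar>z\<bar> + \<i> arg z\<close>, where \<open>arg z\<close> is an arbitrary real number.\<close>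

type_synonym ucover = complex

definition U_proj :: "ucover \<Rightarrow> complex" where "U_proj z = exp z"

definition U_abs :: "ucover \<Rightarrow> real" where "U_abs z = exp (Re z)"

definition U_arg :: "ucover \<Rightarrow> real" where "U_arg z = Im z"

definition U_powr :: "ucover \<Rightarrow> complex \<Rightarrow> complex" where "U_powr z a = exp (a * z)"

text \<open>The derivative \<open>df/dz\<close> on the cover, taken in the local coordinate given by the projection:
  \<open>x \<mapsto> z + Ln (x / U_proj z)\<close> is the local section of the projection sending \<open>U_proj z\<close> to \<open>z\<close>.
  It is not the derivative with respect to the logarithm (see \<open>U_deriv_eq\<close>).\<close>

definition U_deriv :: "(ucover \<Rightarrow> complex) \<Rightarrow> ucover \<Rightarrow> complex" where
  "U_deriv f z = deriv (\<lambda>x. f (z + Ln (x / U_proj z))) (U_proj z)"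

lemma U_deriv_eq:
  assumes "f holomorphic_on UNIV"
  shows "U_deriv f z = deriv f z / U_proj z"
proof -
  have f: "(f has_field_derivative deriv f z) (at (z + Ln (exp z / exp z)))"
    using holomorphic_derivI[OF assms open_UNIV, of z] by simp
  have g: "((\<lambda>x. z + Ln (x / exp z)) has_field_derivative inverse (exp z)) (at (exp z))"
    by (auto intro!: derivative_eq_intros simp: field_simps)
  have "((\<lambda>x. f (z + Ln (x / exp z))) has_field_derivative deriv f z * inverse (exp z)) (at (exp z))"
    using DERIV_chain2[OF f g] .
  then show ?thesis
    unfolding U_deriv_def U_proj_def by (simp add: DERIV_imp_deriv field_simps)
qed

text \<open>Vectors in \<open>\<complex>\<^sup>n\<close> are functions on \<open>nat\<close>, of which only the values at \<open>1, \<dots>, n\<close> matter.\<close>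

definition elem_sym :: "nat \<Rightarrow> nat \<Rightarrow> (nat \<Rightarrow> complex) \<Rightarrow> complex" where
  "elem_sym n m lam = (\<Sum>S | S \<subseteq> {1..n} \<and> card S = m. \<Prod>l\<in>S. lam l)"

definition bessel_A :: "nat \<Rightarrow> nat \<Rightarrow> complex" where
  "bessel_A j m =
    (if j = 0 then (if m = 0 then 1 else 0)
     else (\<Sum>r=1..j. (-1) ^ (j - r) * of_nat r ^ (m + j) / (fact r * fact (j - r))))"

definition bessel_V :: "nat \<Rightarrow> nat \<Rightarrow> (nat \<Rightarrow> complex) \<Rightarrow> complex" where
  "bessel_V n j lam =
    (\<Sum>m=0..n - j. bessel_A j (n - j - m) * of_nat n ^ m * elem_sym n m lam)"

text \<open>Solutions live on the whole cover. Holomorphy there is holomorphy in the logarithm, since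
  the projection is locally biholomorphic.\<close>

definition bessel_solution ::
  "nat \<Rightarrow> complex \<Rightarrow> (nat \<Rightarrow> complex) \<Rightarrow> (ucover \<Rightarrow> complex) \<Rightarrow> bool" where
  "bessel_solution n s lam w \<longleftrightarrow>
    w holomorphic_on UNIV \<and>
    (\<forall>z. (\<Sum>j=1..n. bessel_V n j lam * U_proj z ^ j * (U_deriv ^^ j) w z)
         + (bessel_V n 0 lam - s * (\<i> * of_nat n) ^ n * U_proj z ^ n) * w z = 0)"

text \<open>A formal power series \<open>b\<close> in \<open>X = 1/z\<close> stands for the formal expression
  \<open>e\<^bsup>in\<xi>z\<^esup> z\<^bsup>-(n-1)/2\<^esup> (\<Sum>m. b\<^sub>m z\<^bsup>-m\<^esup>)\<close>.
  Formal differentiation of that expression acts on \<open>b\<close> as follows, because \<open>d/dz = - X\<^sup>2 d/dX\<close>.\<close>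

definition formal_deriv :: "nat \<Rightarrow> ucover \<Rightarrow> complex fps \<Rightarrow> complex fps" where
  "formal_deriv n xi b =
    fps_const (\<i> * of_nat n * U_proj xi) * b
    + fps_const (- (of_nat n - 1) / 2) * fps_X * b
    - fps_X ^ 2 * fps_deriv b"

text \<open>Multiplication by \<open>z\<close> is multiplication by \<open>1/X\<close>, which takes place among Laurent series in \<open>X\<close>.\<close>

definition formal_solution ::
  "nat \<Rightarrow> complex \<Rightarrow> (nat \<Rightarrow> complex) \<Rightarrow> ucover \<Rightarrow> complex fps \<Rightarrow> bool" where
  "formal_solution n s lam xi b \<longleftrightarrow>
    (\<Sum>j=1..n. fls_const (bessel_V n j lam) * fls_X_inv ^ j
        * fps_to_fls ((formal_deriv n xi ^^ j) b))
    + (fls_const (bessel_V n 0 lam) - fls_const (s * (\<i> * of_nat n) ^ n) * fls_X_inv ^ n)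
        * fps_to_fls b = 0"

inductive_set poly_funs :: "nat \<Rightarrow> ((nat \<Rightarrow> complex) \<Rightarrow> complex) set" for n :: nat where
  const: "(\<lambda>_. c) \<in> poly_funs n"
| var: "l \<in> {1..n} \<Longrightarrow> (\<lambda>lam. lam l) \<in> poly_funs n"
| add: "p \<in> poly_funs n \<Longrightarrow> q \<in> poly_funs n \<Longrightarrow> (\<lambda>lam. p lam + q lam) \<in> poly_funs n"
| mult: "p \<in> poly_funs n \<Longrightarrow> q \<in> poly_funs n \<Longrightarrow> (\<lambda>lam. p lam * q lam) \<in> poly_funs n"

definition symmetric_poly_funs :: "nat \<Rightarrow> ((nat \<Rightarrow> complex) \<Rightarrow> complex) set" where
  "symmetric_poly_funs n =
    {p \<in> poly_funs n. \<forall>\<pi> lam. \<pi> permutes {1..n} \<longrightarrow> p (lam \<circ> \<pi>) = p lam}"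

text \<open>The coefficients \<open>B\<^sub>m\<close> are symmetric polynomials on the hyperplane \<open>\<Sum>\<^sub>l \<lambda>\<^sub>l = 0\<close>, to which the index
  is confined. On all of \<open>\<complex>\<^sup>n\<close> they are determined only up to multiples of \<open>\<Sum>\<^sub>l \<lambda>\<^sub>l\<close>; the value at
  an index in the hyperplane is unambiguous.\<close>

definition bessel_coeff_family ::
  "nat \<Rightarrow> complex \<Rightarrow> ucover \<Rightarrow> (nat \<Rightarrow> (nat \<Rightarrow> complex) \<Rightarrow> complex) \<Rightarrow> bool" where
  "bessel_coeff_family n s xi B \<longleftrightarrow>
    (\<forall>m. B m \<in> symmetric_poly_funs n) \<and>
    (\<forall>lam. (\<Sum>l=1..n. lam l) = 0 \<longrightarrow>
       B 0 lam = 1 \<and> formal_solution n s lam xi (Abs_fps (\<lambda>m. B m lam)))"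

definition bessel_B ::
  "nat \<Rightarrow> complex \<Rightarrow> ucover \<Rightarrow> nat \<Rightarrow> (nat \<Rightarrow> complex) \<Rightarrow> complex" where
  "bessel_B n s xi m lam = (THE c. \<exists>B. bessel_coeff_family n s xi B \<and> c = B m lam)"

definition formal_J :: "nat \<Rightarrow> complex \<Rightarrow> (nat \<Rightarrow> complex) \<Rightarrow> ucover \<Rightarrow> complex fps" where
  "formal_J n s lam xi = Abs_fps (\<lambda>m. bessel_B n s xi m lam)"

definition has_expansion_on ::
  "nat \<Rightarrow> ucover \<Rightarrow> (ucover \<Rightarrow> complex) \<Rightarrow> complex fps \<Rightarrow> ucover set \<Rightarrow> bool" where
  "has_expansion_on n xi f b S \<longleftrightarrow>
    (\<forall>M::nat. \<forall>\<alpha> \<beta>. {z. \<alpha> \<le> U_arg z \<and> U_arg z \<le> \<beta>} \<subseteq> S \<longrightarrow>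
      (\<exists>E C R. \<forall>z. \<alpha> \<le> U_arg z \<and> U_arg z \<le> \<beta> \<and> U_abs z \<ge> R \<longrightarrow>
         f z = exp (\<i> * of_nat n * U_proj xi * U_proj z) * U_powr z (- (of_nat n - 1) / 2)
               * ((\<Sum>m<M. fps_nth b m * U_powr z (- of_nat m)) + E z) \<and>
         norm (E z) \<le> C * U_abs z powr (- real M)))"

text \<open>The open sector with half-opening \<open>h\<close> around the direction \<open>arg (\<i> \<xi>\<^sup>*) = \<pi>/2 - arg \<xi>\<close>,
  where \<open>\<xi>\<^sup>*\<close> denotes the complex conjugate.\<close>

definition sector_at :: "ucover \<Rightarrow> real \<Rightarrow> ucover set" where
  "sector_at xi h = {z. \<bar>U_arg z - (pi / 2 - U_arg xi)\<bar> < h}"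

definition bessel_J ::
  "nat \<Rightarrow> complex \<Rightarrow> (nat \<Rightarrow> complex) \<Rightarrow> ucover \<Rightarrow> ucover \<Rightarrow> complex" where
  "bessel_J n s lam xi =
    (THE w. bessel_solution n s lam w \<and>
       has_expansion_on n xi w (formal_J n s lam xi) (sector_at xi (pi / real n)))"

end

theory Submission
  imports Defs
begin

text \<open>Write \<open>\<mu>\<^sub>k = i n \<xi> e\<^bsup>2\<pi>ik/n\<^esup>\<close>. The combinations \<open>g\<^sub>k = 1/n \<Sum>\<^sub>j \<mu>\<^sub>k\<^bsup>-j\<^esup> w\<^bsup>(j)\<^esup>\<close> diagonalise the leading part of the
  equation: \<open>g\<^sub>k' = \<mu>\<^sub>k g\<^sub>k + O(1/|z|)\<close>. Along a ray with direction \<open>d\<close> such that \<open>Re (\<mu>\<^sub>k d) \<ge> Re (\<mu>\<^sub>0 d)\<close> for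
  all \<open>k\<close>, that is, with \<open>|arg d - arg (i \<xi>\<^sup>*)| \<le> \<pi>/n\<close>, the energy \<open>\<Sum>\<^sub>k |g\<^sub>k e\<^bsup>-\<mu>\<^sub>0z\<^esup>|\<^sup>2\<close> therefore decreases at most
  polynomially in the outward direction, so it is controlled at a point by its values near infinity.
  For solutions this gives uniqueness. For the difference between a solution and a truncation of the
  formal solution it shows that the solutions which agree with a truncation at the points \<open>N\<close> of the
  axis \<open>arg z = arg (i \<xi>\<^sup>*)\<close> converge as \<open>N \<rightarrow> \<infinity>\<close>, to a solution with the right expansion on the axis.
  Segments from a point of the strip \<open>|arg z - arg (i \<xi>\<^sup>*)| < \<pi>\<close> to far points of the axis carry the
  expansion over to that strip, and rays in the two extreme directions \<open>d\<close> carry it from there to the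
  whole sector. Derivatives are handled by Cauchy's estimate.\<close>

section \<open>The formal solution\<close>

text \<open>The inward estimate loses a fixed power of |z|, governed by the size of the coefficients
  and by how close the path comes to the origin. The loss is harmless because the formal series can
  be truncated at any order: an expansion is proved with more terms than wanted, and the surplus
  terms are then dropped. Two limits fix the width of the sector. The direction of a path may
  deviate from the axis by at most pi/n, beyond which some other exponential becomes smaller than
  the chosen one; and a point may lie at an angle of almost pi from the direction of the path,
  beyond which the path would run into the origin. The intermediate strip is needed because at
  deviation pi/n the direction cannot be perturbed: a path of that fixed direction need not reach
  the axis but only approaches its own direction, where the expansion must be known beforehand.
  Since pi/n is at most pi/2, the strip contains that direction. On the formal side, the exponent
  -(n-1)/2 and the vanishing sum of the lam l make a constant cancel in the recursion; this leaves
  the leading coefficient free and determines all others.\<close>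

lemma fps_power_nth_Suc_0_of_one:
  fixes g :: "'a :: comm_ring_1 fps"
  assumes "fps_nth g 0 = 1"
  shows "fps_nth (g ^ j) (Suc 0) = of_nat j * fps_nth g (Suc 0)"
proof (induction j)
  case (Suc j)
  then show ?case using assms by (simp add: fps_mult_nth_1 fps_power_zeroth algebra_simps)
qed simp

text \<open>\<open>bessel_A j m\<close> is the Stirling number of the second kind S(m+j, j), and
  (e^x - 1)^j / j! is the exponential generating function of these numbers. The term r = 0 of the
  binomial expansion, absent from the definition, vanishes because \<open>m + j > 0\<close>.\<close>

lemma bessel_A_eq_exp_coeff:
  assumes "j \<ge> 1"
  shows "bessel_A j m = fact (m + j) / fact j * fps_nth ((fps_exp 1 - 1) ^ j) (m + j)"
proof -
  have "(fps_exp 1 - 1 :: complex fps) ^ j = (\<Sum>r\<le>j. of_nat (j choose r) * fps_exp 1 ^ r * (-1) ^ (j - r))"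
    using binomial_ring[of "fps_exp (1::complex)" "-1" j] by simp
  also have "\<dots> = (\<Sum>r\<le>j. fps_const (of_nat (j choose r) * (-1) ^ (j - r)) * fps_exp (of_nat r))"
    by (intro sum.cong refl) (simp add: fps_exp_power_mult fps_of_nat[symmetric] fps_const_mult[symmetric]
      fps_const_power[symmetric] fps_const_neg[symmetric] del: fps_const_mult fps_const_power fps_const_neg)
  finally have "fps_nth ((fps_exp 1 - 1 :: complex fps) ^ j) (m + j)
      = (\<Sum>r\<le>j. of_nat (j choose r) * (-1) ^ (j - r) * (of_nat r ^ (m + j) / fact (m + j)))"
    by (simp add: fps_sum_nth)
  also have "\<dots> = (\<Sum>r=1..j. of_nat (j choose r) * (-1) ^ (j - r) * (of_nat r ^ (m + j) / fact (m + j)))"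
    using assms by (intro sum.mono_neutral_right) (auto simp: not_le)
  finally show ?thesis
    using assms unfolding bessel_A_def
    by (auto simp: sum_distrib_left binomial_fact intro!: sum.cong)
qed

text \<open>Both values come from e^x - 1 = x g(x) with g = 1 + x/2 + ..., so that the two lowest
  coefficients of g^j suffice.\<close>

lemma bessel_A_0: "bessel_A j 0 = 1"
  and bessel_A_1: "bessel_A j 1 = of_nat j * (of_nat j + 1) / 2"
proof -
  define g :: "complex fps" where "g = fps_shift 1 (fps_exp 1)"
  have g: "(fps_exp 1 - 1 :: complex fps) = fps_X * g"
    unfolding g_def by (rule fps_ext) (auto simp: fps_X_mult_nth)
  have g0: "fps_nth g 0 = 1" and g1: "fps_nth g (Suc 0) = 1 / 2"
    by (simp_all add: g_def)
  have nth: "fps_nth ((fps_exp 1 - 1 :: complex fps) ^ j) (m + j) = fps_nth (g ^ j) m" for m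
    unfolding g power_mult_distrib by (simp add: fps_X_power_mult_nth)
  show "bessel_A j 0 = 1"
  proof (cases "j = 0")
    case False
    then show ?thesis using bessel_A_eq_exp_coeff[of j 0] nth[of 0] g0 by (simp add: fps_power_zeroth)
  qed (simp add: bessel_A_def)
  show "bessel_A j 1 = of_nat j * (of_nat j + 1) / 2"
  proof (cases "j = 0")
    case False
    then have "bessel_A j 1 = fact (Suc j) / fact j * (of_nat j / 2)"
      using bessel_A_eq_exp_coeff[of j 1] nth[of 1] g1 fps_power_nth_Suc_0_of_one[OF g0, of j] by simp
    then show ?thesis by (simp add: add_ac)
  qed (simp add: bessel_A_def)
qed

lemma elem_sym_0: "elem_sym n 0 lam = 1"
proof -
  have "{S. S \<subseteq> {1..n} \<and> card S = 0} = {{}}"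
    using finite_subset[of _ "{1..n}"] by auto
  then show ?thesis by (simp add: elem_sym_def)
qed

lemma elem_sym_1: "elem_sym n 1 lam = (\<Sum>l=1..n. lam l)"
proof -
  have "{S. S \<subseteq> {1..n} \<and> card S = 1} = (\<lambda>l. {l}) ` {1..n}"
    by (auto simp: card_1_singleton_iff)
  then show ?thesis by (simp add: elem_sym_def sum.reindex)
qed

lemma bessel_V_top: "bessel_V n n lam = 1"
  by (simp add: bessel_V_def bessel_A_0 elem_sym_0)

text \<open>Here the condition on the sum of the lam l acts: the contribution of the first
  elementary symmetric polynomial disappears and \<open>bessel_A (n - 1) 1\<close> remains, which
  matches the exponent -(n-1)/2 of the formal solution.\<close>

lemma bessel_V_subtop:
  assumes "n \<ge> 1" "(\<Sum>l=1..n. lam l) = 0"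
  shows "bessel_V n (n - 1) lam = of_nat n * (of_nat n - 1) / 2"
proof -
  have "bessel_V n (n - 1) lam = (\<Sum>m\<in>{0,1}. bessel_A (n - 1) (1 - m) * of_nat n ^ m * elem_sym n m lam)"
    using assms(1) unfolding bessel_V_def by (intro sum.cong) auto
  also have "\<dots> = bessel_A (n - 1) 1"
    using elem_sym_1[of n lam] assms(2) by (simp add: elem_sym_0)
  finally show ?thesis using assms(1) unfolding bessel_A_1 by (simp add: of_nat_diff)
qed

section \<open>Symmetric polynomial functions\<close>

lemma symmetric_poly_funs_const: "(\<lambda>_. c) \<in> symmetric_poly_funs n"
  by (auto simp: symmetric_poly_funs_def poly_funs.const)

lemma symmetric_poly_funs_add:
  "p \<in> symmetric_poly_funs n \<Longrightarrow> q \<in> symmetric_poly_funs n \<Longrightarrow>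
    (\<lambda>lam. p lam + q lam) \<in> symmetric_poly_funs n"
  by (auto simp: symmetric_poly_funs_def poly_funs.add)

lemma symmetric_poly_funs_mult:
  "p \<in> symmetric_poly_funs n \<Longrightarrow> q \<in> symmetric_poly_funs n \<Longrightarrow>
    (\<lambda>lam. p lam * q lam) \<in> symmetric_poly_funs n"
  by (auto simp: symmetric_poly_funs_def poly_funs.mult)

lemma symmetric_poly_funs_cmult:
  "p \<in> symmetric_poly_funs n \<Longrightarrow> (\<lambda>lam. c * p lam) \<in> symmetric_poly_funs n"
  using symmetric_poly_funs_mult[OF symmetric_poly_funs_const] .

lemma symmetric_poly_funs_diff:
  "p \<in> symmetric_poly_funs n \<Longrightarrow> q \<in> symmetric_poly_funs n \<Longrightarrow>
    (\<lambda>lam. p lam - q lam) \<in> symmetric_poly_funs n"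
  using symmetric_poly_funs_add[of p n "\<lambda>lam. (-1) * q lam"] symmetric_poly_funs_cmult[of q n "-1"] by simp

lemma symmetric_poly_funs_sum:
  assumes "finite A" "\<And>i. i \<in> A \<Longrightarrow> (\<lambda>lam. p i lam) \<in> symmetric_poly_funs n"
  shows "(\<lambda>lam. \<Sum>i\<in>A. p i lam) \<in> symmetric_poly_funs n"
  using assms
  by (induction A rule: finite_induct) (auto intro: symmetric_poly_funs_const symmetric_poly_funs_add)

lemma symmetric_poly_funs_if:
  "p \<in> symmetric_poly_funs n \<Longrightarrow> q \<in> symmetric_poly_funs n \<Longrightarrow>
    (\<lambda>lam. if P then p lam else q lam) \<in> symmetric_poly_funs n"
  by (cases P) auto

lemma poly_funs_sum:
  assumes "finite A" "\<And>i. i \<in> A \<Longrightarrow> (\<lambda>lam. p i lam) \<in> poly_funs n"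
  shows "(\<lambda>lam. \<Sum>i\<in>A. p i lam) \<in> poly_funs n"
  using assms by (induction A rule: finite_induct) (auto intro: poly_funs.const poly_funs.add)

lemma poly_funs_prod:
  assumes "finite A" "\<And>i. i \<in> A \<Longrightarrow> (\<lambda>lam. p i lam) \<in> poly_funs n"
  shows "(\<lambda>lam. \<Prod>i\<in>A. p i lam) \<in> poly_funs n"
  using assms by (induction A rule: finite_induct) (auto intro: poly_funs.const poly_funs.mult)

text \<open>A permutation of the variables permutes the m-element subsets over which the sum
  runs.\<close>

lemma elem_sym_symmetric_poly: "elem_sym n m \<in> symmetric_poly_funs n"
proof -
  have "(\<lambda>lam. \<Sum>S | S \<subseteq> {1..n} \<and> card S = m. \<Prod>l\<in>S. lam l) \<in> poly_funs n"
    by (intro poly_funs_sum poly_funs_prod poly_funs.var) (auto intro: finite_subset)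
  moreover have "elem_sym n m (lam \<circ> \<pi>) = elem_sym n m lam" if pi: "\<pi> permutes {1..n}" for \<pi> lam
  proof -
    have inj: "inj \<pi>" using pi by (rule permutes_inj)
    let ?F = "{S. S \<subseteq> {1..n} \<and> card S = m}"
    have sub: "\<pi> ` S \<in> ?F" if "S \<in> ?F" for S
      using that permutes_image[OF pi] card_image[OF inj_on_subset[OF inj, of S]] by auto
    have injF: "inj_on (\<lambda>S. \<pi> ` S) ?F"
      by (simp add: inj_on_def inj_image_eq_iff[OF inj])
    have "(\<lambda>S. \<pi> ` S) ` ?F = ?F"
    proof (rule endo_inj_surj[OF _ _ injF])
      show "finite ?F" by simp
      show "(\<lambda>S. \<pi> ` S) ` ?F \<subseteq> ?F" using sub by (intro image_subsetI)
    qed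
    with injF have "bij_betw (\<lambda>S. \<pi> ` S) ?F ?F"
      by (simp add: bij_betw_def)
    from sum.reindex_bij_betw[OF this, of "\<lambda>S. \<Prod>l\<in>S. lam l"]
    show ?thesis
      unfolding elem_sym_def
      by (simp add: prod.reindex[OF inj_on_subset[OF inj]] o_def)
  qed
  ultimately show ?thesis
    unfolding symmetric_poly_funs_def elem_sym_def[abs_def] by auto
qed

lemma bessel_V_symmetric_poly: "bessel_V n j \<in> symmetric_poly_funs n"
  unfolding bessel_V_def[abs_def]
  by (intro symmetric_poly_funs_sum symmetric_poly_funs_cmult elem_sym_symmetric_poly) auto

section \<open>The equation as an operator on power series in X = 1/z\<close>

definition formal_op :: "nat \<Rightarrow> (nat \<Rightarrow> complex) \<Rightarrow> ucover \<Rightarrow> complex fps \<Rightarrow> complex fps" where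
  "formal_op n lam xi b =
    (\<Sum>j\<le>n. fps_const (bessel_V n j lam) * fps_X ^ (n - j) * (formal_deriv n xi ^^ j) b)
    - fps_const ((\<i> * of_nat n * U_proj xi) ^ n) * b"

lemma fps_to_fls_sum: "fps_to_fls (\<Sum>i\<in>A. f i) = (\<Sum>i\<in>A. fps_to_fls (f i))"
  by (induction A rule: infinite_finite_induct) auto

text \<open>Multiplying the equation by X^n, that is, dividing it by z^n, clears all negative powers
  of X, so that the Laurent series can be left behind. As xi^n is the sign s, the constant s (in)^n
  becomes the n-th power of i n xi.\<close>

lemma formal_solution_iff:
  assumes "U_proj xi ^ n = s"
  shows "formal_solution n s lam xi b \<longleftrightarrow> formal_op n lam xi b = 0"
proof -
  let ?f = "\<lambda>j. fps_to_fls ((formal_deriv n xi ^^ j) b)"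
  have X: "fls_X_inv ^ n * fls_X ^ (n - j) = (fls_X_inv ^ j :: complex fls)" if "j \<le> n" for j
  proof -
    have "fls_X_inv ^ n = (fls_X_inv ^ j * fls_X_inv ^ (n - j) :: complex fls)"
      using that by (simp flip: power_add)
    moreover have "(fls_X_inv :: complex fls) * fls_X = 1"
      unfolding fls_inverse_X[symmetric] by (rule left_inverse) simp
    then have "fls_X_inv ^ (n - j) * fls_X ^ (n - j) = (1 :: complex fls)"
      by (simp only: power_mult_distrib[symmetric] power_one)
    ultimately show ?thesis by (simp add: mult.assoc)
  qed
  have K: "s * (\<i> * of_nat n) ^ n = (\<i> * of_nat n * U_proj xi) ^ n"
    using assms by (simp add: power_mult_distrib)
  have "fls_X_inv ^ n * fps_to_fls (formal_op n lam xi b)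
     = (\<Sum>j\<le>n. fls_const (bessel_V n j lam) * (fls_X_inv ^ n * fls_X ^ (n - j)) * ?f j)
       - fls_X_inv ^ n * fls_const ((\<i> * of_nat n * U_proj xi) ^ n) * fps_to_fls b"
    by (simp add: formal_op_def fps_to_fls_sum fls_times_fps_to_fls fps_to_fls_power
        sum_distrib_left right_diff_distrib mult.left_commute mult.assoc)
  also have "\<dots> = (\<Sum>j\<le>n. fls_const (bessel_V n j lam) * fls_X_inv ^ j * ?f j)
       - fls_X_inv ^ n * fls_const ((\<i> * of_nat n * U_proj xi) ^ n) * fps_to_fls b"
    by (intro arg_cong2[where f = minus] sum.cong refl) (simp add: X)
  also have "(\<Sum>j\<le>n. fls_const (bessel_V n j lam) * fls_X_inv ^ j * ?f j)
      = fls_const (bessel_V n 0 lam) * fps_to_fls b + (\<Sum>j=1..n. fls_const (bessel_V n j lam) * fls_X_inv ^ j * ?f j)"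
    by (simp add: atMost_atLeast0 sum.atLeast_Suc_atMost)
  finally have "fls_X_inv ^ n * fps_to_fls (formal_op n lam xi b) =
      (\<Sum>j=1..n. fls_const (bessel_V n j lam) * fls_X_inv ^ j * ?f j)
    + (fls_const (bessel_V n 0 lam) - fls_const (s * (\<i> * of_nat n) ^ n) * fls_X_inv ^ n) * fps_to_fls b"
    unfolding K by (simp add: algebra_simps)
  then have "formal_solution n s lam xi b \<longleftrightarrow> fls_X_inv ^ n * fps_to_fls (formal_op n lam xi b) = 0"
    unfolding formal_solution_def by simp
  then show ?thesis by (simp add: fps_to_fls_eq_0_iff)
qed

lemma formal_deriv_nth:
  "fps_nth (formal_deriv n xi b) m = \<i> * of_nat n * U_proj xi * fps_nth b m
     - (if m = 0 then 0 else ((of_nat n - 1) / 2 + of_nat (m - 1)) * fps_nth b (m - 1))"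
proof (cases m)
  case 0
  then show ?thesis by (simp add: formal_deriv_def power2_eq_square)
next
  case (Suc k)
  have "fps_nth (fps_X ^ 2 * fps_deriv b) m = of_nat k * fps_nth b k"
    by (cases k) (auto simp: Suc fps_X_power_mult_nth)
  moreover have "fps_nth (fps_const (- (of_nat n - 1) / 2) * fps_X * b) m = - (of_nat n - 1) / 2 * fps_nth b k"
    by (simp add: Suc mult.assoc)
  ultimately show ?thesis
    by (simp add: formal_deriv_def Suc algebra_simps add_divide_distrib diff_divide_distrib)
qed

lemma formal_deriv_add: "formal_deriv n xi (b + c) = formal_deriv n xi b + formal_deriv n xi c"
  by (simp add: formal_deriv_def algebra_simps)

lemma formal_deriv_funpow_add:
  "(formal_deriv n xi ^^ j) (b + c) = (formal_deriv n xi ^^ j) b + (formal_deriv n xi ^^ j) c"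
  by (induction j) (auto simp: formal_deriv_add)

lemma formal_op_add: "formal_op n lam xi (b + c) = formal_op n lam xi b + formal_op n lam xi c"
  by (simp add: formal_op_def formal_deriv_funpow_add algebra_simps sum.distrib)

text \<open>Each differentiation hits either the exponential, which gives a factor mu, or the power
  of z, which raises the order in 1/z by one. Order k sees only the first choice; order k+1 sees in
  addition the j ways of making the second choice once.\<close>

lemma formal_deriv_funpow_low:
  fixes b :: "complex fps" and xi :: ucover and n k j :: nat
  assumes "\<And>i. i < k \<Longrightarrow> fps_nth b i = 0"
  defines "mu \<equiv> \<i> * of_nat n * U_proj xi"
  shows "(\<forall>i<k. fps_nth ((formal_deriv n xi ^^ j) b) i = 0) \<and>
    fps_nth ((formal_deriv n xi ^^ j) b) k = mu ^ j * fps_nth b k \<and>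
    fps_nth ((formal_deriv n xi ^^ j) b) (Suc k) = mu ^ j * fps_nth b (Suc k)
      - of_nat j * mu ^ (j - 1) * ((of_nat n - 1) / 2 + of_nat k) * fps_nth b k"
proof (induction j)
  case 0
  show ?case using assms by simp
next
  case (Suc j)
  define a :: complex where "a = (of_nat n - 1) / 2"
  have rec_0: "fps_nth (formal_deriv n xi c) 0 = mu * fps_nth c 0"
    and rec: "fps_nth (formal_deriv n xi c) (Suc m) = mu * fps_nth c (Suc m) - (a + of_nat m) * fps_nth c m" for c m
    by (simp_all add: formal_deriv_nth mu_def a_def)
  \<comment> \<open>This holds for j = 0 as well, where \<open>j - 1\<close> is truncated to 0,
    because of the factor j.\<close>
  have e: "of_nat j * mu ^ (j - 1) * mu = of_nat j * mu ^ j" by (cases j) auto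
  let ?c = "(formal_deriv n xi ^^ j) b"
  have IH: "fps_nth ?c i = 0" if "i < k" for i using Suc that by blast
  have IHk: "fps_nth ?c k = mu ^ j * fps_nth b k" using Suc by blast
  have IHS: "fps_nth ?c (Suc k) = mu ^ j * fps_nth b (Suc k) - of_nat j * mu ^ (j - 1) * (a + of_nat k) * fps_nth b k"
    using Suc unfolding a_def by blast
  have "fps_nth (formal_deriv n xi ?c) i = 0" if "i < k" for i
    using that IH by (cases i) (auto simp: rec_0 rec)
  moreover have "fps_nth (formal_deriv n xi ?c) k = mu ^ Suc j * fps_nth b k"
    using IH IHk by (cases k) (auto simp: rec_0 rec)
  moreover have "fps_nth (formal_deriv n xi ?c) (Suc k) = mu ^ Suc j * fps_nth b (Suc k)
      - (of_nat j * mu ^ (j - 1) * mu) * (a + of_nat k) * fps_nth b k - mu ^ j * (a + of_nat k) * fps_nth b k"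
    unfolding rec IHS IHk by (simp add: algebra_simps)
  then have "fps_nth (formal_deriv n xi ?c) (Suc k) = mu ^ Suc j * fps_nth b (Suc k)
      - of_nat (Suc j) * mu ^ (Suc j - 1) * (a + of_nat k) * fps_nth b k"
    unfolding e by (simp add: algebra_simps)
  ultimately show ?case unfolding a_def by simp
qed

text \<open>The terms with mu^n, from the top derivative and from the last summand, cancel. At order
  k+1 the top derivative leaves -n mu^(n-1) ((n-1)/2 + k) b_k and the next one n mu^(n-1) (n-1)/2
  b_k; the exponent of z is such that only the part with k survives. Hence b_0 is free, and every
  later coefficient can be solved for.\<close>

lemma formal_op_low:
  fixes b :: "complex fps" and xi :: ucover and n k i :: nat
  assumes "n \<ge> 1" "(\<Sum>l=1..n. lam l) = 0" and b: "\<And>i. i < k \<Longrightarrow> fps_nth b i = 0"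
  defines "mu \<equiv> \<i> * of_nat n * U_proj xi"
  shows "i \<le> k \<Longrightarrow> fps_nth (formal_op n lam xi b) i = 0"
    and "fps_nth (formal_op n lam xi b) (Suc k) = - of_nat n * of_nat k * mu ^ (n - 1) * fps_nth b k"
proof -
  note low = formal_deriv_funpow_low[where k = k and b = b and n = n and xi = xi, OF b, folded mu_def]
  let ?d = "\<lambda>j. (formal_deriv n xi ^^ j) b"
  have low0: "fps_nth (?d j) i = 0" if "i < k" for i j using low[of j] that by blast
  have lowk: "fps_nth (?d j) k = mu ^ j * fps_nth b k" for j using low[of j] by blast
  have lowS: "fps_nth (?d j) (Suc k) = mu ^ j * fps_nth b (Suc k)
      - of_nat j * mu ^ (j - 1) * ((of_nat n - 1) / 2 + of_nat k) * fps_nth b k" for j using low[of j] by blast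
  define T where "T j i = fps_nth (fps_const (bessel_V n j lam) * fps_X ^ (n - j) * ?d j) i" for j i
  have t: "T j i = (if i < n - j then 0 else bessel_V n j lam * fps_nth (?d j) (i - (n - j)))" for i j
    by (simp add: T_def mult.assoc fps_X_power_mult_nth)
  have "{..n} = insert n (insert (n - 1) {..<n - 1})" "n \<noteq> n - 1" using assms(1) by auto
  then have "(\<Sum>j\<le>n. T j i) = (\<Sum>j<n - 1. T j i) + T (n - 1) i + T n i" for i
    using assms(1) by (simp add: add_ac)
  then have op: "fps_nth (formal_op n lam xi b) i
    = (\<Sum>j<n - 1. T j i) + T (n - 1) i + T n i - mu ^ n * fps_nth b i" for i
    by (simp add: formal_op_def mu_def fps_sum_nth flip: T_def)
  \<comment> \<open>For j < n - 1 the factor X^(n-j) has exponent at least 2, so these terms begin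
    at order k+2.\<close>
  have zero: "(\<Sum>j<n - 1. T j i) = 0" if "i \<le> Suc k" for i
  proof (intro sum.neutral ballI)
    fix j assume "j \<in> {..<n - 1}"
    then show "T j i = 0" using that unfolding t by (auto intro!: low0)
  qed
  have n1: "n - (n - 1) = 1" using assms(1) by simp
  show "fps_nth (formal_op n lam xi b) i = 0" if i: "i \<le> k"
  proof -
    have "T (n - 1) i = 0"
      using i unfolding t n1 by (auto intro!: low0)
    moreover have "T n i = mu ^ n * fps_nth b i"
      using i low0[of i n] lowk[of n] b[of i] unfolding t bessel_V_top by (cases "i = k") auto
    ultimately show ?thesis using zero[of i] i unfolding op by simp
  qed
  have t1: "T (n - 1) (Suc k) = of_nat n * (of_nat n - 1) / 2 * (mu ^ (n - 1) * fps_nth b k)"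
    unfolding t n1 bessel_V_subtop[OF assms(1,2)] by (simp add: lowk)
  have t2: "T n (Suc k) = mu ^ n * fps_nth b (Suc k)
      - of_nat n * mu ^ (n - 1) * ((of_nat n - 1) / 2 + of_nat k) * fps_nth b k"
    unfolding t bessel_V_top by (simp add: lowS)
  show "fps_nth (formal_op n lam xi b) (Suc k) = - of_nat n * of_nat k * mu ^ (n - 1) * fps_nth b k"
    unfolding op t1 t2 zero[OF order.refl] by (simp add: algebra_simps add_divide_distrib diff_divide_distrib)
qed

text \<open>At order m+1 the equation is linear in the m-th coefficient, with factor -n m mu^(n-1),
  and otherwise involves only earlier coefficients; the recursion solves it.\<close>

fun coeff_rec :: "nat \<Rightarrow> ucover \<Rightarrow> nat \<Rightarrow> (nat \<Rightarrow> complex) \<Rightarrow> complex" where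
  "coeff_rec n xi m lam = (if m = 0 then 1 else
     fps_nth (formal_op n lam xi (Abs_fps (\<lambda>i. if i < m then coeff_rec n xi i lam else 0))) (Suc m)
       / (of_nat n * of_nat m * (\<i> * of_nat n * U_proj xi) ^ (n - 1)))"

declare coeff_rec.simps [simp del]

lemma formal_op_coeff_split:
  assumes "n \<ge> 1" "(\<Sum>l=1..n. lam l) = 0"
  shows "fps_nth (formal_op n lam xi b) (Suc m) = fps_nth (formal_op n lam xi (fps_cutoff m b)) (Suc m)
    - of_nat n * of_nat m * (\<i> * of_nat n * U_proj xi) ^ (n - 1) * fps_nth b m"
proof -
  have "formal_op n lam xi b = formal_op n lam xi (fps_cutoff m b) + formal_op n lam xi (b - fps_cutoff m b)"
    by (simp flip: formal_op_add)
  moreover have "fps_nth (formal_op n lam xi (b - fps_cutoff m b)) (Suc m) =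
      - of_nat n * of_nat m * (\<i> * of_nat n * U_proj xi) ^ (n - 1) * fps_nth (b - fps_cutoff m b) m"
    by (rule formal_op_low(2)[OF assms]) auto
  ultimately show ?thesis by simp
qed

lemma formal_op_coeff_rec:
  assumes "n \<ge> 1" "(\<Sum>l=1..n. lam l) = 0" 
  shows "formal_op n lam xi (Abs_fps (\<lambda>m. coeff_rec n xi m lam)) = 0" (is "formal_op n lam xi ?b = 0")
proof (rule fps_ext)
  fix i
  have nz: "U_proj xi \<noteq> 0" by (simp add: U_proj_def)
  show "fps_nth (formal_op n lam xi ?b) i = fps_nth 0 i"
  proof (cases i)
    case 0
    then show ?thesis using formal_op_low(1)[OF assms, of 0 ?b 0] by simp
  next
    case (Suc m)
    show ?thesis
    \<comment> \<open>At order 1 nothing is left to solve: the factor k in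
      \<open>formal_op_low\<close> is 0.\<close>
    proof (cases "m = 0")
      case True
      then show ?thesis using formal_op_low(2)[OF assms, of 0 ?b] by (simp add: Suc)
    next
      case False
      define D where "D = of_nat n * of_nat m * (\<i> * of_nat n * U_proj xi) ^ (n - 1)"
      have "D \<noteq> 0" using False assms(1) nz by (simp add: D_def)
      have "fps_cutoff m ?b = Abs_fps (\<lambda>i. if i < m then coeff_rec n xi i lam else 0)"
        by (rule fps_ext) simp
      then have "coeff_rec n xi m lam = fps_nth (formal_op n lam xi (fps_cutoff m ?b)) (Suc m) / D"
        using False by (subst coeff_rec.simps) (simp add: D_def)
      then show ?thesis
        using \<open>D \<noteq> 0\<close> formal_op_coeff_split[OF assms, of xi ?b m] nz by (simp add: Suc D_def)
    qed
  qed
qed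

lemma formal_op_unique:
  assumes "n \<ge> 1" "(\<Sum>l=1..n. lam l) = 0" 
    and "formal_op n lam xi b = 0" "formal_op n lam xi c = 0" "fps_nth b 0 = fps_nth c 0"
  shows "b = c"
proof (rule fps_ext)
  fix m
  have nz: "U_proj xi \<noteq> 0" by (simp add: U_proj_def)
  show "fps_nth b m = fps_nth c m"
  proof (induction m rule: less_induct)
    case (less m)
    show ?case
    proof (cases "m = 0")
      case False
      have "fps_cutoff m b = fps_cutoff m c" using less by (intro fps_ext) auto
      then show ?thesis
        using formal_op_coeff_split[OF assms(1,2), of xi b m] formal_op_coeff_split[OF assms(1,2), of xi c m]
          assms False nz by simp
    qed (use assms in simp)
  qed
qed

lemma formal_op_nth_symmetric_poly:
  assumes "\<And>i. (\<lambda>lam. c lam i) \<in> symmetric_poly_funs n"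
  shows "(\<lambda>lam. fps_nth (formal_op n lam xi (Abs_fps (c lam))) k) \<in> symmetric_poly_funs n"
proof -
  have fd: "(\<lambda>lam. fps_nth ((formal_deriv n xi ^^ j) (Abs_fps (c lam))) i) \<in> symmetric_poly_funs n" for i j
  proof (induction j arbitrary: i)
    case 0
    then show ?case using assms by simp
  next
    case (Suc j)
    show ?case
      by (simp add: formal_deriv_nth)
        (intro symmetric_poly_funs_if symmetric_poly_funs_const symmetric_poly_funs_diff symmetric_poly_funs_cmult Suc)
  qed
  show ?thesis
    by (simp add: formal_op_def fps_sum_nth mult.assoc fps_X_power_mult_nth)
      (intro symmetric_poly_funs_diff symmetric_poly_funs_sum symmetric_poly_funs_cmult
        symmetric_poly_funs_mult symmetric_poly_funs_if symmetric_poly_funs_const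
        bessel_V_symmetric_poly fd assms; simp)
qed

lemma coeff_rec_symmetric_poly: "coeff_rec n xi m \<in> symmetric_poly_funs n"
proof (induction m rule: less_induct)
  case (less m)
  show ?case
  proof (cases "m = 0")
    case True
    then have "coeff_rec n xi m = (\<lambda>_. 1)" by (auto simp: coeff_rec.simps)
    then show ?thesis by (simp add: symmetric_poly_funs_const)
  next
    case False
    have eq: "coeff_rec n xi m = (\<lambda>lam. inverse (of_nat n * of_nat m * (\<i> * of_nat n * U_proj xi) ^ (n - 1)) *
       fps_nth (formal_op n lam xi (Abs_fps (\<lambda>i. if i < m then coeff_rec n xi i lam else 0))) (Suc m))"
      using False by (auto simp: coeff_rec.simps[of n xi m] divide_simps)
    show ?thesis unfolding eq
    proof (intro symmetric_poly_funs_cmult formal_op_nth_symmetric_poly)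
      fix i show "(\<lambda>lam. if i < m then coeff_rec n xi i lam else 0) \<in> symmetric_poly_funs n"
        using less[of i] symmetric_poly_funs_const by (cases "i < m") auto
    qed
  qed
qed

lemma bessel_coeff_family_coeff_rec:
  assumes "n \<ge> 1" "U_proj xi ^ n = s"
  shows "bessel_coeff_family n s xi (coeff_rec n xi)"
  unfolding bessel_coeff_family_def formal_solution_iff[OF assms(2)]
  using assms coeff_rec_symmetric_poly formal_op_coeff_rec by (auto simp: coeff_rec.simps[of n xi 0])

text \<open>The definite description is legitimate although families may differ off the hyperplane:
  at an index in the hyperplane the values of any family form a formal solution with leading
  coefficient 1, and there is only one.\<close>

lemma bessel_B_eq_coeff_rec:
  assumes "n \<ge> 1" "(\<Sum>l=1..n. lam l) = 0" "U_proj xi ^ n = s"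
  shows "bessel_B n s xi m lam = coeff_rec n xi m lam"
  unfolding bessel_B_def
proof (rule the_equality)
  show "\<exists>B. bessel_coeff_family n s xi B \<and> coeff_rec n xi m lam = B m lam"
    using bessel_coeff_family_coeff_rec[OF assms(1,3)] by blast
next
  fix c assume "\<exists>B. bessel_coeff_family n s xi B \<and> c = B m lam"
  then obtain B where B: "bessel_coeff_family n s xi B" "c = B m lam" by blast
  then have "formal_op n lam xi (Abs_fps (\<lambda>m. B m lam)) = 0" "B 0 lam = 1"
    using assms(2) unfolding bessel_coeff_family_def formal_solution_iff[OF assms(3)] by auto
  then have "Abs_fps (\<lambda>m. B m lam) = Abs_fps (\<lambda>m. coeff_rec n xi m lam)"
    using formal_op_unique[OF assms(1,2)] formal_op_coeff_rec[OF assms(1,2)]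
    by (auto simp: coeff_rec.simps[of n xi 0])
  then show "c = coeff_rec n xi m lam"
    using B(2) by (metis fps_nth_Abs_fps)
qed

lemma formal_op_formal_J:
  assumes "n \<ge> 1" "(\<Sum>l=1..n. lam l) = 0" "U_proj xi ^ n = s"
  shows "formal_op n lam xi (formal_J n s lam xi) = 0"
  using formal_op_coeff_rec[OF assms(1,2)]
  by (simp add: formal_J_def bessel_B_eq_coeff_rec[OF assms])

section \<open>Entire solutions with prescribed initial data\<close>

lemma U_deriv_holomorphic_eq:
  assumes "f holomorphic_on UNIV"
  shows "U_deriv f = (\<lambda>z. deriv f z * exp (- z))"
  using U_deriv_eq[OF assms] by (auto simp: U_proj_def exp_minus field_simps)

lemma U_derivI:
  assumes "\<And>z. (f has_field_derivative f' z) (at z)"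
  shows "U_deriv f = (\<lambda>z. f' z * exp (- z))"
proof -
  have "f holomorphic_on UNIV"
    using assms by (auto simp: holomorphic_on_open)
  then show ?thesis
    using DERIV_imp_deriv[OF assms] by (simp add: U_deriv_holomorphic_eq)
qed

lemma has_field_derivative_U_deriv:
  assumes "f holomorphic_on UNIV"
  shows "(f has_field_derivative U_deriv f z * exp z) (at z)"
  using holomorphic_derivI[OF assms open_UNIV, of z] 
  by (simp add: U_deriv_holomorphic_eq[OF assms] mult.assoc flip: exp_add)

lemma holomorphic_U_deriv:
  "f holomorphic_on UNIV \<Longrightarrow> U_deriv f holomorphic_on UNIV"
  by (auto simp: U_deriv_holomorphic_eq intro!: holomorphic_intros)

lemma holomorphic_U_deriv_funpow:
  "f holomorphic_on UNIV \<Longrightarrow> (U_deriv ^^ j) f holomorphic_on UNIV"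
  by (induction j) (auto intro: holomorphic_U_deriv)

lemma U_deriv_diff:
  assumes "f holomorphic_on UNIV" "g holomorphic_on UNIV"
  shows "U_deriv (\<lambda>z. f z - g z) = (\<lambda>z. U_deriv f z - U_deriv g z)"
  by (subst U_derivI[where f' = "\<lambda>z. U_deriv f z * exp z - U_deriv g z * exp z"])
    (auto intro!: derivative_eq_intros has_field_derivative_U_deriv assms simp: exp_minus field_simps)

lemma U_deriv_funpow_diff:
  assumes "f holomorphic_on UNIV" "g holomorphic_on UNIV"
  shows "(U_deriv ^^ j) (\<lambda>z. f z - g z) = (\<lambda>z. (U_deriv ^^ j) f z - (U_deriv ^^ j) g z)"
  by (induction j) (auto simp: U_deriv_diff holomorphic_U_deriv_funpow assms)

text \<open>The equation divided by z^n, the analytic counterpart of \<open>formal_op\<close>. In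
  this form the coefficients \<open>bessel_V n j lam * exp (- z) ^ (n - j)\<close> with j < n tend
  to 0 at infinity.\<close>

definition bessel_op :: "nat \<Rightarrow> (nat \<Rightarrow> complex) \<Rightarrow> ucover \<Rightarrow> (ucover \<Rightarrow> complex) \<Rightarrow> ucover \<Rightarrow> complex" where
  "bessel_op n lam xi f z =
    (\<Sum>j\<le>n. bessel_V n j lam * exp (- z) ^ (n - j) * (U_deriv ^^ j) f z)
    - (\<i> * of_nat n * U_proj xi) ^ n * f z"

lemma bessel_solution_iff:
  assumes "U_proj xi ^ n = s"
  shows "bessel_solution n s lam w \<longleftrightarrow> w holomorphic_on UNIV \<and> (\<forall>z. bessel_op n lam xi w z = 0)"
proof -
  have K: "(\<i> * of_nat n * U_proj xi) ^ n = s * (\<i> * of_nat n) ^ n"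
    using assms by (simp add: power_mult_distrib)
  have X: "exp z ^ n * exp (- z) ^ (n - j) = exp z ^ j" if "j \<le> n" for z :: complex and j
    using that by (simp add: exp_of_nat_mult[symmetric] exp_add[symmetric] of_nat_diff algebra_simps)
  have "(\<Sum>j=1..n. bessel_V n j lam * U_proj z ^ j * (U_deriv ^^ j) w z)
         + (bessel_V n 0 lam - s * (\<i> * of_nat n) ^ n * U_proj z ^ n) * w z
      = exp z ^ n * bessel_op n lam xi w z" for z
  proof -
    have "exp z ^ n * bessel_op n lam xi w z =
        (\<Sum>j\<le>n. bessel_V n j lam * (exp z ^ n * exp (- z) ^ (n - j)) * (U_deriv ^^ j) w z)
          - s * (\<i> * of_nat n) ^ n * exp z ^ n * w z"
      by (simp add: bessel_op_def power_mult_distrib assms algebra_simps sum_distrib_left)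
    also have "\<dots> = (\<Sum>j\<le>n. bessel_V n j lam * exp z ^ j * (U_deriv ^^ j) w z)
          - s * (\<i> * of_nat n) ^ n * exp z ^ n * w z"
      by (intro arg_cong2[where f = minus] sum.cong refl) (simp add: X)
    finally show ?thesis
      by (simp add: U_proj_def atMost_atLeast0 sum.atLeast_Suc_atMost algebra_simps)
  qed
  then show ?thesis
    unfolding bessel_solution_def by simp
qed

lemma bessel_op_diff:
  assumes "f holomorphic_on UNIV" "g holomorphic_on UNIV"
  shows "bessel_op n lam xi (\<lambda>z. f z - g z) z = bessel_op n lam xi f z - bessel_op n lam xi g z"
  by (simp add: bessel_op_def U_deriv_funpow_diff[OF assms] algebra_simps sum_subtractf)

text \<open>In the logarithmic coordinate the functions \<open>y\<^sub>j = z\<^sup>j w\<^bsup>(j)\<^esup>\<close> satisfy \<open>y\<^sub>j' = j y\<^sub>j + y\<^bsub>j+1\<^esub>\<close>, and the equation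
  expresses \<open>y\<^sub>n\<close> with constant coefficients except for one term \<open>K e\<^bsup>nz\<^esup> y\<^sub>0\<close>. These are the Taylor
  coefficients of the solution.\<close>

fun series_coeff :: "nat \<Rightarrow> (nat \<Rightarrow> complex) \<Rightarrow> complex \<Rightarrow> (nat \<Rightarrow> complex) \<Rightarrow> nat \<Rightarrow> nat \<Rightarrow> complex" where
  "series_coeff n V K a 0 j = a j"
| "series_coeff n V K a (Suc k) j = (of_nat j * series_coeff n V K a k j +
     (if Suc j < n then series_coeff n V K a k (Suc j)
      else K * (\<Sum>i\<le>k. of_nat n ^ i / fact i * series_coeff n V K a (k - i) 0)
           - (\<Sum>l<n. V l * series_coeff n V K a k l))) / of_nat (Suc k)"

text \<open>One step of the recursion multiplies the weighted size by at most
  \<open>R * (L + H) / (k + 1)\<close>: L collects the constant coefficients, H the convolution with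
  the Taylor series of exp (n z). From the index k0 on this quotient is at most 1, so the maximum
  over the indices up to k0 bounds everything.\<close>

lemma series_coeff_bound:
  assumes n: "n \<ge> 1" and R: "R > 0"
  shows "\<exists>C. \<forall>k. \<forall>j<n. norm (series_coeff n V K a k j) * R ^ k \<le> C"
proof -
  define L where "L = real n + 1 + (\<Sum>l<n. norm (V l))"
  define H where "H = norm K * exp (real n * R)"
  obtain k0 :: nat where k0: "real k0 \<ge> R * (L + H)" using real_arch_simple by blast
  let ?c = "series_coeff n V K a"
  define C where "C = Max ((\<lambda>(k, j). norm (?c k j) * R ^ k) ` ({..k0} \<times> {..<n}))"
  have "norm (?c k j) * R ^ k \<le> C" if "j < n" for k j
    using that
  proof (induction k arbitrary: j rule: less_induct)
    case (less k)
    show ?case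
    proof (cases "k \<le> k0")
      case True
      then show ?thesis unfolding C_def using less.prems
        by (intro Max_ge) (auto intro!: image_eqI[of _ _ "(k, j)"])
    next
      case False
      then obtain m where m: "k = Suc m" by (cases k) auto
      have IH: "norm (?c i j) * R ^ i \<le> C" if "i \<le> m" "j < n" for i j
        using less.IH that m by auto
      have C0: "C \<ge> 0" using IH[of 0 0] n by (auto intro: order_trans[rotated])
      have L0: "L \<ge> 0" unfolding L_def by (intro add_nonneg_nonneg sum_nonneg) auto
      have H0: "H \<ge> 0" unfolding H_def by simp
      have S1: "norm (of_nat j * ?c m j) * R ^ m \<le> real n * C"
        using IH[of m j] less.prems R C0 mult_mono[of "real j" "real n" "norm (?c m j) * R ^ m" C]
        by (simp add: norm_mult mult.assoc)
      have S2: "norm (\<Sum>l<n. V l * ?c m l) * R ^ m \<le> (\<Sum>l<n. norm (V l)) * C"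
      proof -
        have "norm (\<Sum>l<n. V l * ?c m l) * R ^ m \<le> (\<Sum>l<n. norm (V l * ?c m l)) * R ^ m"
          using R by (intro mult_right_mono norm_sum) auto
        also have "\<dots> = (\<Sum>l<n. norm (V l) * (norm (?c m l) * R ^ m))"
          by (simp add: sum_distrib_right norm_mult mult.assoc)
        also have "\<dots> \<le> (\<Sum>l<n. norm (V l) * C)"
          using IH by (intro sum_mono mult_left_mono) auto
        finally show ?thesis by (simp add: sum_distrib_right)
      qed
      have S3: "norm (K * (\<Sum>i\<le>m. of_nat n ^ i / fact i * ?c (m - i) 0)) * R ^ m \<le> H * C"
      proof -
        have "norm (\<Sum>i\<le>m. of_nat n ^ i / fact i * ?c (m - i) 0) * R ^ m
            \<le> (\<Sum>i\<le>m. norm (of_nat n ^ i / fact i * ?c (m - i) 0)) * R ^ m"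
          using R by (intro mult_right_mono norm_sum) auto
        also have "\<dots> = (\<Sum>i\<le>m. (real n * R) ^ i / fact i * (norm (?c (m - i) 0) * R ^ (m - i)))"
          unfolding sum_distrib_right
        proof (intro sum.cong refl)
          fix i assume "i \<in> {..m}"
          then have "R ^ m = R ^ i * R ^ (m - i)" by (simp flip: power_add)
          then show "norm (of_nat n ^ i / fact i * ?c (m - i) 0) * R ^ m
              = (real n * R) ^ i / fact i * (norm (?c (m - i) 0) * R ^ (m - i))"
            by (simp add: norm_mult norm_divide norm_power power_mult_distrib)
        qed
        also have "\<dots> \<le> (\<Sum>i\<le>m. (real n * R) ^ i / fact i * C)"
          using IH R n by (intro sum_mono mult_left_mono) auto
        also have "\<dots> = (\<Sum>i\<le>m. (real n * R) ^ i / fact i) * C"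
          by (simp add: sum_distrib_right)
        also have "\<dots> \<le> exp (real n * R) * C"
        proof (intro mult_right_mono C0)
          have "(\<Sum>i\<in>{..m}. (real n * R) ^ i /\<^sub>R fact i) \<le> (\<Sum>i. (real n * R) ^ i /\<^sub>R fact i)"
            using R by (intro sum_le_suminf summable_exp_generic) auto
          then show "(\<Sum>i\<le>m. (real n * R) ^ i / fact i) \<le> exp (real n * R)"
            by (simp add: exp_def field_simps)
        qed
        finally show ?thesis
          using mult_left_mono[of _ _ "norm K"] by (fastforce simp: H_def norm_mult mult.assoc)
      qed
      have S4: "norm (?c m (Suc j)) * R ^ m \<le> 1 * C" if "Suc j < n" using IH that by simp
      have C1: "0 \<le> (\<Sum>l<n. norm (V l)) * C" "0 \<le> H * C" using C0 H0 by (auto intro!: mult_nonneg_nonneg sum_nonneg)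
      let ?X = "if Suc j < n then ?c m (Suc j)
        else K * (\<Sum>i\<le>m. of_nat n ^ i / fact i * ?c (m - i) 0) - (\<Sum>l<n. V l * ?c m l)"
      have "norm ?X * R ^ m \<le> 1 * C + H * C + (\<Sum>l<n. norm (V l)) * C"
      proof (cases "Suc j < n")
        case True
        then show ?thesis using S4 C1 by simp
      next
        case False
        have "norm ?X * R ^ m \<le> (norm (K * (\<Sum>i\<le>m. of_nat n ^ i / fact i * ?c (m - i) 0)) + norm (\<Sum>l<n. V l * ?c m l)) * R ^ m"
          using False R by (simp add: norm_triangle_ineq4)
        then show ?thesis using S2 S3 C0 by (simp add: distrib_right)
      qed
      then have "norm (of_nat j * ?c m j + ?X) * R ^ m \<le> (L + H) * C"
        using S1 R mult_right_mono[OF norm_triangle_ineq[of "of_nat j * ?c m j" ?X], of "R ^ m"]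
        by (simp add: L_def distrib_right)
      then have "norm (of_nat j * ?c m j + ?X) * R ^ m * R \<le> (L + H) * C * R"
        using R by (intro mult_right_mono) auto
      also have "\<dots> = R * (L + H) * C" by simp
      also have "\<dots> \<le> real (Suc m) * C"
        using k0 False m C0 by (intro mult_right_mono) auto
      finally have "norm (of_nat j * ?c m j + ?X) * R ^ k / real (Suc m) \<le> C"
        unfolding m by (subst pos_divide_le_eq) (auto simp: algebra_simps)
      moreover have "norm (?c k j) = norm (of_nat j * ?c m j + ?X) / real (Suc m)"
        unfolding m series_coeff.simps norm_divide norm_of_nat ..
      ultimately show ?thesis by simp
    qed
  qed
  then show ?thesis by blast
qed

lemma series_coeff_conv_radius:
  assumes "n \<ge> 1" "j < n"
  shows "fps_conv_radius (Abs_fps (\<lambda>k. series_coeff n V K a k j)) = \<infinity>"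
proof -
  have "conv_radius (\<lambda>k. series_coeff n V K a k j) \<ge> \<infinity>"
  proof (rule conv_radius_geI_ex')
    fix r :: real assume r: "0 < r"
    \<comment> \<open>Twice the radius is used in order to compare with a geometric series of ratio
      1/2.\<close>
    obtain C where C: "\<And>k. norm (series_coeff n V K a k j) * (2 * r) ^ k \<le> C"
      using series_coeff_bound[OF assms(1), of "2 * r" V K a] r assms(2) by auto
    show "summable (\<lambda>k. series_coeff n V K a k j * of_real r ^ k)"
    proof (rule summable_comparison_test')
      show "summable (\<lambda>k. C * (1 / 2) ^ k)" by (intro summable_mult summable_geometric) auto
      show "norm (series_coeff n V K a k j * of_real r ^ k) \<le> C * (1 / 2) ^ k" for k
        using C[of k] r by (simp add: norm_mult norm_power power_mult_distrib field_simps)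
    qed
  qed
  then show ?thesis by (simp add: fps_conv_radius_def)
qed

lemma fps_conv_radius_sum_infty:
  assumes "finite A" "\<And>i. i \<in> A \<Longrightarrow> fps_conv_radius (f i) = \<infinity>"
  shows "fps_conv_radius (\<Sum>i\<in>A. f i) = \<infinity>"
  using assms
proof (induction A rule: finite_induct)
  case (insert x F)
  then show ?case using fps_conv_radius_add[of "f x" "\<Sum>i\<in>F. f i"] by simp
qed simp

lemma eval_fps_sum_infty:
  fixes f :: "'i \<Rightarrow> complex fps"
  assumes "finite A" "\<And>i. i \<in> A \<Longrightarrow> fps_conv_radius (f i) = \<infinity>"
  shows "eval_fps (\<Sum>i\<in>A. f i) z = (\<Sum>i\<in>A. eval_fps (f i) z)"
  using assms
proof (induction A rule: finite_induct)
  case (insert x F)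
  then show ?case by (simp add: eval_fps_add fps_conv_radius_sum_infty)
qed simp

lemma entire_system_solution:
  fixes n :: nat and V a :: "nat \<Rightarrow> complex" and K z0 :: complex
  assumes n: "n \<ge> 1"
  shows "\<exists>y. \<forall>j<n. y j z0 = a j \<and> (\<forall>z. (y j has_field_derivative (of_nat j * y j z +
       (if Suc j < n then y (Suc j) z else K * exp (of_nat n * z) * y 0 z - (\<Sum>l<n. V l * y l z)))) (at z))"
proof -
  \<comment> \<open>The series are centred at z0, so the factor exp (n z) contributes the constant
    exp (n z0).\<close>
  define K' where "K' = K * exp (of_nat n * z0)"
  define Y where "Y = (\<lambda>j. Abs_fps (\<lambda>k. series_coeff n V K' a k j))"
  have conv: "fps_conv_radius (Y j) = \<infinity>" if "j < n" for j
    unfolding Y_def using series_coeff_conv_radius[OF n that] .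
  have conv_mult: "fps_conv_radius (f * g) = \<infinity>" if "fps_conv_radius f = \<infinity>" "fps_conv_radius g = \<infinity>"
    for f g :: "complex fps"
    using fps_conv_radius_mult[of f g] that by simp
  have conv_diff: "fps_conv_radius (f - g) = \<infinity>" if "fps_conv_radius f = \<infinity>" "fps_conv_radius g = \<infinity>"
    for f g :: "complex fps"
    using fps_conv_radius_diff[of f g] that by simp
  define G where "G = (\<lambda>j. fps_const (of_nat j) * Y j + (if Suc j < n then Y (Suc j) else
        fps_const K' * (fps_exp (of_nat n) * Y 0) - (\<Sum>l<n. fps_const (V l) * Y l)))"
  have deriv: "fps_deriv (Y j) = G j" for j
  proof (rule fps_ext)
    fix k
    have "fps_nth (fps_exp (of_nat n) * Y 0) k = (\<Sum>i\<le>k. of_nat n ^ i / fact i * series_coeff n V K' a (k - i) 0)"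
      by (simp add: fps_mult_nth Y_def atLeast0AtMost)
    then show "fps_nth (fps_deriv (Y j)) k = fps_nth (G j) k"
      by (simp add: Y_def G_def fps_sum_nth del: of_nat_Suc)
  qed
  have eval: "eval_fps (G j) t = of_nat j * eval_fps (Y j) t + (if Suc j < n then eval_fps (Y (Suc j)) t else
        K' * (exp (of_nat n * t) * eval_fps (Y 0) t) - (\<Sum>l<n. V l * eval_fps (Y l) t))" if "j < n" for j t
  proof (cases "Suc j < n")
    case True
    then show ?thesis using that unfolding G_def by (simp add: eval_fps_add eval_fps_mult conv conv_mult)
  next
    case False
    have *: "fps_conv_radius (fps_const (V l) * Y l) = \<infinity>" if "l \<in> {..<n}" for l
      using that by (intro conv_mult conv) auto
    have **: "fps_conv_radius (fps_exp (of_nat n) * Y 0) = \<infinity>"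
      using n by (intro conv_mult conv) auto
    have ***: "fps_conv_radius (fps_const K' * (fps_exp (of_nat n) * Y 0)) = \<infinity>"
      by (intro conv_mult **) auto
    have S: "fps_conv_radius (\<Sum>l<n. fps_const (V l) * Y l) = \<infinity>"
      by (intro fps_conv_radius_sum_infty *) auto
    have "eval_fps (\<Sum>l<n. fps_const (V l) * Y l) t = (\<Sum>l<n. V l * eval_fps (Y l) t)"
      by (subst eval_fps_sum_infty) (use * in \<open>auto simp: eval_fps_mult conv\<close>)
    moreover have "eval_fps (fps_const K' * (fps_exp (of_nat n) * Y 0)) t = K' * (exp (of_nat n * t) * eval_fps (Y 0) t)"
      using n ** by (simp add: eval_fps_mult conv)
    moreover have "eval_fps (fps_const (of_nat j) * Y j) t = of_nat j * eval_fps (Y j) t"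
      using that by (simp add: eval_fps_mult conv)
    ultimately show ?thesis
      using False by (simp add: G_def eval_fps_add eval_fps_diff conv conv_mult conv_diff S *** that)
  qed
  show ?thesis
  proof (rule exI[of _ "\<lambda>j z. eval_fps (Y j) (z - z0)"], intro allI impI conjI)
    show "eval_fps (Y j) (z0 - z0) = a j" for j
      by (simp add: eval_fps_at_0 Y_def)
    fix j z assume j: "j < n"
    have "(eval_fps (Y j) has_field_derivative eval_fps (fps_deriv (Y j)) (z - z0)) (at (z - z0))"
      by (rule has_field_derivative_eval_fps) (simp add: conv[OF j])
    then have der: "((\<lambda>z. eval_fps (Y j) (z - z0)) has_field_derivative eval_fps (G j) (z - z0) * 1) (at z)"
      unfolding deriv by (rule DERIV_chain2) (auto intro!: derivative_eq_intros)
    have K': "K' * (exp (of_nat n * (z - z0)) * E) = K * exp (of_nat n * z) * E" for E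
      by (simp add: K'_def algebra_simps exp_diff)
    show "((\<lambda>z. eval_fps (Y j) (z - z0)) has_field_derivative (of_nat j * eval_fps (Y j) (z - z0) +
       (if Suc j < n then eval_fps (Y (Suc j)) (z - z0) else K * exp (of_nat n * z) * eval_fps (Y 0) (z - z0)
          - (\<Sum>l<n. V l * eval_fps (Y l) (z - z0))))) (at z)"
      using der unfolding eval[OF j] K' by simp
  qed
qed

lemma bessel_op_initial_value:
  assumes n: "n \<ge> 1"
  obtains w where "w holomorphic_on UNIV" "\<And>z. bessel_op n lam xi w z = 0"
    "\<And>j. j < n \<Longrightarrow> (U_deriv ^^ j) w z0 = a j"
proof -
  define K where "K = (\<i> * of_nat n * U_proj xi) ^ n"
  define V where "V = (\<lambda>j. bessel_V n j lam)"
  obtain y where init: "\<And>j. j < n \<Longrightarrow> y j z0 = exp (of_nat j * z0) * a j"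
    and deriv: "\<And>j z. j < n \<Longrightarrow> (y j has_field_derivative (of_nat j * y j z +
       (if Suc j < n then y (Suc j) z else K * exp (of_nat n * z) * y 0 z - (\<Sum>l<n. V l * y l z)))) (at z)"
    using entire_system_solution[OF n, of z0 "\<lambda>j. exp (of_nat j * z0) * a j" K V] by blast
  \<comment> \<open>For j = n this is the value that the equation prescribes for the missing
    function y_n.\<close>
  define Y where "Y = (\<lambda>j z. if j < n then y j z else K * exp (of_nat n * z) * y 0 z - (\<Sum>l<n. V l * y l z))"
  have D: "(U_deriv ^^ j) (y 0) = (\<lambda>z. exp (- (of_nat j * z)) * Y j z)" if "j \<le> n" for j
    using that
  proof (induction j)
    case 0
    then show ?case using n by (simp add: Y_def)
  next
    case (Suc j)
    have "((\<lambda>z. exp (- (of_nat j * z)) * y j z) has_field_derivative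
        exp (- (of_nat j * z)) * Y (Suc j) z) (at z)" for z
      using Suc.prems
      by (auto intro!: derivative_eq_intros deriv simp: Y_def algebra_simps)
    then have "U_deriv (\<lambda>z. exp (- (of_nat j * z)) * y j z)
        = (\<lambda>z. exp (- (of_nat j * z)) * Y (Suc j) z * exp (- z))"
      by (rule U_derivI)
    moreover have "(U_deriv ^^ j) (y 0) = (\<lambda>z. exp (- (of_nat j * z)) * y j z)"
      using Suc by (simp add: Y_def)
    ultimately show ?case
      by (simp add: ring_distribs exp_add exp_diff exp_minus field_simps)
  qed
  show ?thesis
  proof (rule that[of "y 0"])
    show "y 0 holomorphic_on UNIV"
      using deriv[of 0] n by (auto simp: holomorphic_on_open)
    show "(U_deriv ^^ j) (y 0) z0 = a j" if "j < n" for j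
      using D[of j] init[OF that] that by (simp add: Y_def flip: exp_add mult.assoc)
    fix z
    have X: "exp (- z) ^ (n - l) * exp (- (of_nat l * z)) = exp (- (of_nat n * z :: complex))" if "l \<le> n" for l
      using that by (simp add: of_nat_diff algebra_simps flip: exp_of_nat_mult exp_add)
    have "(\<Sum>j\<le>n. V j * exp (- z) ^ (n - j) * (U_deriv ^^ j) (y 0) z)
        = (\<Sum>j\<le>n. V j * exp (- (of_nat n * z)) * Y j z)"
      by (intro sum.cong refl) (simp add: D mult.assoc flip: X)
    also have "\<dots> = exp (- (of_nat n * z)) * (Y n z + (\<Sum>l<n. V l * y l z))"
      by (simp add: lessThan_Suc_atMost[symmetric] V_def bessel_V_top sum_distrib_left Y_def algebra_simps)
    also have "\<dots> = K * y 0 z * (exp (- (of_nat n * z)) * exp (of_nat n * z))"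
      by (simp add: Y_def)
    also have "\<dots> = K * y 0 z"
      by (simp flip: exp_add)
    finally show "bessel_op n lam xi (y 0) z = 0"
      by (simp add: bessel_op_def V_def K_def)
  qed
qed

section \<open>Energy along rays\<close>

text \<open>The lift to the cover, starting at z, of the straight line \<open>exp z + t * d\<close>.
  The principal logarithm follows the lift correctly as long as the segment misses the origin, by
  \<open>ray_avoids_cut\<close>.\<close>

definition ray :: "ucover \<Rightarrow> complex \<Rightarrow> complex \<Rightarrow> ucover" where
  "ray z d t = z + Ln (1 + t * d * exp (- z))"

lemma exp_ray:
  assumes "1 + t * d * exp (- z) \<noteq> 0"
  shows "exp (ray z d t) = exp z + t * d"
  using assms by (simp add: ray_def exp_add exp_minus field_simps)

lemma ray_0 [simp]: "ray z d 0 = z"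
  by (simp add: ray_def)

text \<open>\<open>U_deriv\<close> differentiates in the coordinate of the plane, where the lifted
  line has the constant velocity d.\<close>

lemma has_vector_derivative_ray:
  assumes f: "f holomorphic_on UNIV" and t: "1 + of_real t * d * exp (- z) \<notin> \<real>\<^sub>\<le>\<^sub>0"
  shows "((\<lambda>t. f (ray z d (of_real t))) has_vector_derivative U_deriv f (ray z d (of_real t)) * d) (at t)"
proof -
  let ?u = "1 + of_real t * d * exp (- z)"
  have nz: "?u \<noteq> 0" using t by auto
  have "((\<lambda>x. Ln (1 + x * d * exp (- z))) has_field_derivative inverse ?u * (d * exp (- z))) (at (of_real t))"
    by (rule DERIV_chain2[where f = Ln and g = "\<lambda>x. 1 + x * d * exp (- z)", OF has_field_derivative_Ln[OF t]])
      (auto intro!: derivative_eq_intros)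
  from DERIV_add[OF DERIV_const[of z] this] have "(ray z d has_field_derivative inverse ?u * (d * exp (- z))) (at (of_real t))"
    unfolding ray_def[abs_def] by simp
  then have "((\<lambda>t. f (ray z d t)) has_field_derivative
      U_deriv f (ray z d (of_real t)) * exp (ray z d (of_real t)) * (inverse ?u * (d * exp (- z)))) (at (of_real t))"
    by (intro DERIV_chain2[where f = f and g = "ray z d"] has_field_derivative_U_deriv f)
  moreover have "exp (ray z d (of_real t)) * (inverse ?u * (d * exp (- z))) = d"
  proof -
    have "exp (ray z d (of_real t)) = exp z * ?u"
      unfolding exp_ray[OF nz] by (simp add: algebra_simps flip: exp_add)
    then have "exp (ray z d (of_real t)) * (inverse ?u * (d * exp (- z))) = (?u * inverse ?u) * (exp z * exp (- z)) * d"
      by (simp only: mult_ac)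
    also have "\<dots> = d" using nz by (simp flip: exp_add)
    finally show ?thesis .
  qed
  ultimately have "((\<lambda>t. f (ray z d t)) has_field_derivative U_deriv f (ray z d (of_real t)) * d) (at (of_real t))"
    by (metis mult.assoc)
  then show ?thesis by (rule has_vector_derivative_real_field)
qed

text \<open>With r = |z0|, the law of cosines bounds the left side below by r^2 + t^2 - 2crt, which
  is the sum of (1-c)/2 (r+t)^2 and (1+c)/2 (r-t)^2.\<close>

lemma norm_ray_ge:
  fixes z0 d :: complex and c t :: real
  assumes d: "norm d = 1" and c: "- 1 \<le> c" and Re: "Re (cnj z0 * d) \<ge> - c * norm z0" and t: "t \<ge> 0"
  shows "norm (z0 + of_real t * d) ^ 2 \<ge> (1 - c) / 2 * (norm z0 + t) ^ 2"
proof -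
  have d2: "(Re d)\<^sup>2 + (Im d)\<^sup>2 = 1" using d cmod_power2[of d] by simp
  have "norm (z0 + of_real t * d) ^ 2 = norm z0 ^ 2 + t ^ 2 * ((Re d)\<^sup>2 + (Im d)\<^sup>2) + 2 * t * Re (cnj z0 * d)"
    unfolding cmod_power2 by (simp add: power2_eq_square algebra_simps)
  also have "\<dots> = norm z0 ^ 2 + t ^ 2 + 2 * t * Re (cnj z0 * d)" by (simp add: d2)
  finally have 1: "norm (z0 + of_real t * d) ^ 2 = norm z0 ^ 2 + t ^ 2 + 2 * t * Re (cnj z0 * d)" .
  have 2: "2 * t * Re (cnj z0 * d) \<ge> 2 * t * (- c * norm z0)"
    using Re t by (intro mult_left_mono) auto
  have 3: "norm z0 ^ 2 + t ^ 2 + 2 * t * (- c * norm z0) =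
      (1 - c) / 2 * (norm z0 + t) ^ 2 + (1 + c) / 2 * (norm z0 - t) ^ 2"
    by (simp add: power2_eq_square field_simps)
  moreover have "0 \<le> (1 + c) / 2 * (norm z0 - t) ^ 2" using c by (intro mult_nonneg_nonneg) auto
  ultimately show ?thesis using 1 2 3 by linarith
qed

text \<open>If the segment met the cut, it would pass through the origin before.\<close>

lemma ray_avoids_cut:
  fixes z d :: complex and t :: real
  assumes "\<And>t'. 0 \<le> t' \<Longrightarrow> t' \<le> t \<Longrightarrow> exp z + of_real t' * d \<noteq> 0" "0 \<le> t"
  shows "1 + of_real t * d * exp (- z) \<notin> \<real>\<^sub>\<le>\<^sub>0"
proof
  assume "1 + of_real t * d * exp (- z) \<in> \<real>\<^sub>\<le>\<^sub>0"
  then obtain x where x: "x \<le> 0" "1 + of_real t * d * exp (- z) = of_real x"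
    by (auto elim: nonpos_Reals_cases)
  then have t0: "t > 0" using assms(2) by (cases "t = 0") (use x in \<open>auto simp: eq_commute[of 1]\<close>)
  define t' where "t' = t / (1 - x)"
  have "t * x \<le> 0" using t0 x(1) by (simp add: mult_nonneg_nonpos)
  then have t': "0 \<le> t'" "t' \<le> t" using t0 x(1) by (auto simp: t'_def divide_le_eq algebra_simps)
  have "of_real t * (d * exp (- z)) = of_real (x - 1)" using x by (simp add: algebra_simps)
  then have "of_real t' * (d * exp (- z)) = of_real ((x - 1) / (1 - x))"
    using x(1) by (simp add: t'_def)
  also have "(x - 1) / (1 - x) = - 1" using x(1) by (simp add: field_simps)
  finally have e: "of_real t' * (d * exp (- z)) = - 1" by simp
  have "of_real t' * d = of_real t' * (d * exp (- z)) * exp z"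
    by (simp add: mult.assoc flip: exp_add)
  then have "exp z + of_real t' * d = 0" unfolding e by simp
  with assms(1)[OF t'] show False by simp
qed

text \<open>The integrating factor \<open>(r + t) ^ A\<close> removes the loss term. What remains of
  the derivative is at least -B (r+t)^(A-M), integrable up to infinity because M >= A + 2;
  subtracting B (r+t)^(-(M-A-1)) therefore gives a nondecreasing function. The error term in the
  conclusion does not depend on T.\<close>

lemma backward_gronwall:
  fixes q q' :: "real \<Rightarrow> real" and r B T :: real and A M :: nat
  assumes r: "r > 0" and T: "T \<ge> 0" and M: "M \<ge> A + 2" and B: "B \<ge> 0"
    and deriv: "\<And>t. 0 \<le> t \<Longrightarrow> t \<le> T \<Longrightarrow> (q has_real_derivative q' t) (at t)"
    and ineq: "\<And>t. 0 \<le> t \<Longrightarrow> t \<le> T \<Longrightarrow> q' t \<ge> - real A * q t / (r + t) - B / (r + t) ^ M"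
  shows "q 0 * r ^ A \<le> q T * (r + T) ^ A + B / r ^ (M - A - 1)"
proof -
  define m where "m = M - A - 2"
  have M_eq: "M = A + m + 2" "M - A - 1 = Suc m" using M by (auto simp: m_def)
  define G where "G t = q t * (r + t) ^ A - B * inverse (r + t) ^ Suc m" for t
  have "G 0 \<le> G T"
  proof (rule DERIV_nonneg_imp_nondecreasing[OF T])
    fix t assume t: "0 \<le> t" "t \<le> T"
    define R where "R = r + t"
    have R: "R > 0" using r t by (simp add: R_def)
    let ?D = "q' t * R ^ A + q t * (real A * R ^ (A - 1)) + B * (real (Suc m) * inverse R ^ (m + 2))"
    have 1: "((\<lambda>t. inverse (r + t)) has_real_derivative - (inverse R ^ 2)) (at t)"
      using R by (auto intro!: derivative_eq_intros simp: R_def power2_eq_square)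
    have 2: "((\<lambda>t. (r + t) ^ A) has_real_derivative real A * R ^ (A - 1)) (at t)"
      by (auto intro!: derivative_eq_intros simp: R_def)
    have "(G has_real_derivative q' t * (r + t) ^ A + real A * R ^ (A - 1) * q t
        - B * (real (Suc m) * (- (inverse R ^ 2) * inverse (r + t) ^ (Suc m - Suc 0)))) (at t)"
      unfolding G_def by (intro DERIV_diff DERIV_cmult DERIV_mult deriv[OF t] 2 DERIV_power[OF 1])
    then have "(G has_real_derivative ?D) (at t)"
      by (rule DERIV_cong) (simp add: R_def power2_eq_square algebra_simps)
    moreover have "?D \<ge> 0"
    proof -
      have "q' t * R ^ A \<ge> (- real A * q t / R - B / R ^ M) * R ^ A"
        using ineq[OF t] R by (intro mult_right_mono) (auto simp: R_def)
      moreover have "(- real A * q t / R) * R ^ A = - (q t * (real A * R ^ (A - 1)))"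
        using R by (cases A) (auto simp: field_simps)
      moreover have "B / R ^ M * R ^ A = B * inverse R ^ (m + 2)"
        using R by (simp add: M_eq power_add field_simps)
      moreover have "B * inverse R ^ (m + 2) \<le> B * (real (Suc m) * inverse R ^ (m + 2))"
        using B R by (intro mult_left_mono) (auto simp: algebra_simps)
      ultimately show ?thesis by (simp add: left_diff_distrib)
    qed
    ultimately show "\<exists>y. (G has_real_derivative y) (at t) \<and> 0 \<le> y" by blast
  qed
  moreover have "B * inverse (r + T) ^ Suc m \<ge> 0" using B r T by (intro mult_nonneg_nonneg) auto
  ultimately show ?thesis unfolding G_def M_eq(2) by (simp add: field_simps power_inverse)
qed

text \<open>This crude exponential bound serves for continuous dependence over segments of fixed
  length.\<close>

lemma forward_gronwall:
  fixes q q' :: "real \<Rightarrow> real" and T C :: real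
  assumes T: "T \<ge> 0"
    and deriv: "\<And>t. 0 \<le> t \<Longrightarrow> t \<le> T \<Longrightarrow> (q has_real_derivative q' t) (at t)"
    and ineq: "\<And>t. 0 \<le> t \<Longrightarrow> t \<le> T \<Longrightarrow> q' t \<le> C * q t"
  shows "q T \<le> q 0 * exp (C * T)"
proof -
  define G where "G t = - (q t * exp (- C * t))" for t
  have "G 0 \<le> G T"
  proof (rule DERIV_nonneg_imp_nondecreasing[OF T])
    fix t assume t: "0 \<le> t" "t \<le> T"
    have "(G has_real_derivative (C * q t - q' t) * exp (- C * t)) (at t)"
      unfolding G_def by (auto intro!: derivative_eq_intros deriv[OF t] simp: algebra_simps)
    then show "\<exists>y. (G has_real_derivative y) (at t) \<and> 0 \<le> y"
      using ineq[OF t] by (intro exI conjI) auto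
  qed
  then have "q T * exp (- C * T) \<le> q 0" by (simp add: G_def)
  then show ?thesis by (simp add: exp_minus field_simps)
qed

lemma sum_lessThan_last:
  fixes g :: "nat \<Rightarrow> 'a :: comm_monoid_add"
  shows "n > 0 \<Longrightarrow> sum g {..<n} = sum g {..<n - 1} + g (n - 1)"
  by (cases n) auto

lemma sum_lessThan_first:
  fixes g :: "nat \<Rightarrow> 'a :: comm_monoid_add"
  shows "n > 0 \<Longrightarrow> sum g {..<n} = g 0 + (\<Sum>j<n - 1. g (Suc j))"
  by (cases n) (auto simp: sum.lessThan_Suc_shift simp del: sum.lessThan_Suc)

section \<open>Modes, the diagonalised system and its energy\<close>

locale bessel_data =
  fixes n :: nat and lam :: "nat \<Rightarrow> complex" and s :: complex and xi :: ucover
  assumes n: "n \<ge> 2" and sum_lam: "(\<Sum>l=1..n. lam l) = 0"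
    and s: "s \<in> {1, -1}" and root: "U_proj xi ^ n = s"
begin

definition mu :: complex where "mu = \<i> * of_nat n * U_proj xi"

definition mus :: "nat \<Rightarrow> complex" where
  "mus k = mu * exp (2 * of_real pi * \<i> * of_nat k / of_nat n)"

definition mode :: "nat \<Rightarrow> (ucover \<Rightarrow> complex) \<Rightarrow> ucover \<Rightarrow> complex" where
  "mode k f z = (\<Sum>j<n. inverse (mus k) ^ j * (U_deriv ^^ j) f z) / of_nat n"

definition energy :: "(ucover \<Rightarrow> complex) \<Rightarrow> ucover \<Rightarrow> real" where
  "energy f z = (\<Sum>k<n. norm (mode k f z * exp (- mu * exp z)) ^ 2)"

text \<open>This bounds the coefficients of the lower-order terms; the weights n^j are the norms of
  \<open>mus k ^ j\<close>, which appear when derivatives are expressed in modes.\<close>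

definition lower_sum :: real where
  "lower_sum = (\<Sum>j<n. norm (bessel_V n j lam) * real n ^ j)"

lemma norm_U_proj_xi: "norm (U_proj xi) = 1"
proof -
  have "norm (U_proj xi) ^ n = 1 ^ n" using root s by (auto simp flip: norm_power)
  then show ?thesis using n by (subst (asm) power_eq_iff_eq_base) auto
qed

lemma norm_mu: "norm mu = n" by (simp add: mu_def norm_mult norm_U_proj_xi)

lemma norm_mus: "norm (mus k) = n"
  by (simp add: mus_def norm_mult norm_mu norm_exp_eq_Re)

lemma mus_nonzero: "mus k \<noteq> 0" and mu_nonzero: "mu \<noteq> 0"
  using norm_mus[of k] norm_mu n by auto

lemma mus_power: "mus k ^ n = mu ^ n"
  using complex_root_unity[of n k] n by (simp add: mus_def power_mult_distrib)

text \<open>For j different from l the sum is geometric in an n-th root of unity other than 1. It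
  makes \<open>mode\<close> a discrete Fourier transform, inverted by
  \<open>deriv_eq_sum_mode\<close>.\<close>

lemma mus_orthogonal:
  assumes "j < n" "l < n"
  shows "(\<Sum>k<n. mus k ^ j * inverse (mus k) ^ l) = (if j = l then of_nat n else 0)"
proof (cases "j = l")
  case True
  then show ?thesis by (simp add: mus_nonzero flip: power_mult_distrib)
next
  case False
  define w :: "nat \<Rightarrow> complex" where "w j = exp (2 * of_real pi * \<i> * of_nat j / of_nat n)" for j
  define \<rho> where "\<rho> = w j * inverse (w l)"
  have w_nz: "w i \<noteq> 0" for i by (simp add: w_def)
  have "w j \<noteq> w l"
    using complex_root_unity_eq[of n j l] assms False n by (simp add: w_def)
  then have "\<rho> \<noteq> 1"
    using w_nz by (simp add: \<rho>_def field_simps)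
  have "w i ^ n = 1" for i
    using complex_root_unity[of n i] n by (simp add: w_def)
  then have "\<rho> ^ n = 1"
    by (simp add: \<rho>_def power_mult_distrib power_inverse)
  have w: "w k ^ i = w i ^ k" for i k
    by (simp add: w_def mult_ac flip: exp_of_nat_mult)
  have "mus k = mu * w k" for k by (simp add: mus_def w_def)
  then have "mus k ^ j * inverse (mus k) ^ l = mu ^ j * inverse mu ^ l * \<rho> ^ k" for k
    by (simp add: \<rho>_def power_mult_distrib power_inverse w[of k] mult_ac)
  then have "(\<Sum>k<n. mus k ^ j * inverse (mus k) ^ l) = mu ^ j * inverse mu ^ l * (\<Sum>k<n. \<rho> ^ k)"
    by (simp add: sum_distrib_left)
  also have "(\<Sum>k<n. \<rho> ^ k) = 0"
    using \<open>\<rho> \<noteq> 1\<close> \<open>\<rho> ^ n = 1\<close> by (simp add: geometric_sum)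
  finally show ?thesis using False by simp
qed

lemma deriv_eq_sum_mode:
  assumes "j < n"
  shows "(U_deriv ^^ j) f z = (\<Sum>k<n. mus k ^ j * mode k f z)"
proof -
  have "(\<Sum>k<n. mus k ^ j * mode k f z)
      = (\<Sum>k<n. \<Sum>l<n. mus k ^ j * inverse (mus k) ^ l * (U_deriv ^^ l) f z / of_nat n)"
    by (simp add: mode_def sum_distrib_left sum_divide_distrib mult.assoc)
  also have "\<dots> = (\<Sum>l<n. \<Sum>k<n. mus k ^ j * inverse (mus k) ^ l * (U_deriv ^^ l) f z / of_nat n)"
    by (rule sum.swap)
  also have "\<dots> = (\<Sum>l<n. (\<Sum>k<n. mus k ^ j * inverse (mus k) ^ l) * (U_deriv ^^ l) f z / of_nat n)"
    by (simp add: sum_distrib_right sum_divide_distrib)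
  also have "\<dots> = (\<Sum>l<n. if l = j then (U_deriv ^^ j) f z else 0)"
    using assms n by (intro sum.cong refl) (auto simp: mus_orthogonal)
  finally show ?thesis using assms by simp
qed

lemma holomorphic_mode: "f holomorphic_on UNIV \<Longrightarrow> mode k f holomorphic_on UNIV"
  unfolding mode_def[abs_def] using n by (intro holomorphic_intros holomorphic_U_deriv_funpow) auto

text \<open>The bracket equals f^(n) - mu^n f, the amount by which f fails the equation with
  constant coefficients. It is written through \<open>bessel_op\<close> to separate the residual of
  f from the lower-order terms.\<close>

definition mode_error :: "nat \<Rightarrow> (ucover \<Rightarrow> complex) \<Rightarrow> ucover \<Rightarrow> complex" where
  "mode_error k f z = inverse (mus k) ^ (n - 1) / of_nat n *
     (bessel_op n lam xi f z - (\<Sum>j<n. bessel_V n j lam * exp (- z) ^ (n - j) * (U_deriv ^^ j) f z))"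

text \<open>Differentiation shifts the sum in \<open>mode\<close> by one index. The shifted sum is
  \<open>mus k\<close> times the mode except at the two ends, where f is exchanged for its n-th
  derivative; \<open>mus k ^ n = mu ^ n\<close> combines both ends into
  \<open>mode_error\<close>.\<close>

lemma U_deriv_mode:
  assumes f: "f holomorphic_on UNIV"
  shows "U_deriv (mode k f) z = mus k * mode k f z + mode_error k f z"
proof -
  let ?D = "\<lambda>j. (U_deriv ^^ j) f z"
  have "(mode k f has_field_derivative (\<Sum>j<n. inverse (mus k) ^ j * ((U_deriv ^^ Suc j) f z * exp z)) / of_nat n) (at z)" for z
    unfolding mode_def[abs_def] using n
    by (auto intro!: derivative_eq_intros has_field_derivative_U_deriv[OF holomorphic_U_deriv_funpow[OF f]] sum.cong)
  then have "U_deriv (mode k f) = (\<lambda>z. (\<Sum>j<n. inverse (mus k) ^ j * ((U_deriv ^^ Suc j) f z * exp z)) / of_nat n * exp (- z))"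
    by (rule U_derivI)
  then have D: "U_deriv (mode k f) z = (\<Sum>j<n. inverse (mus k) ^ j * ?D (Suc j)) / of_nat n"
    by (simp add: mult.assoc[symmetric] sum_distrib_right[symmetric] exp_minus)
  have n0: "n > 0" using n by simp
  have mus_inv: "mus k * inverse (mus k) ^ Suc j = inverse (mus k) ^ j" for j
    by (simp add: mus_nonzero)
  have 1: "(\<Sum>j<n. inverse (mus k) ^ j * ?D (Suc j)) =
      (\<Sum>j<n - 1. inverse (mus k) ^ j * ?D (Suc j)) + inverse (mus k) ^ (n - 1) * ?D n"
    using sum_lessThan_last[OF n0, of "\<lambda>j. inverse (mus k) ^ j * ?D (Suc j)"] n0 by simp
  have "mus k * (\<Sum>j<n. inverse (mus k) ^ j * ?D j)
      = mus k * ?D 0 + (\<Sum>j<n - 1. (mus k * inverse (mus k) ^ Suc j) * ?D (Suc j))"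
    unfolding sum_lessThan_first[OF n0] by (simp add: distrib_left sum_distrib_left mult.assoc)
  then have 2: "mus k * (\<Sum>j<n. inverse (mus k) ^ j * ?D j) = mus k * ?D 0 + (\<Sum>j<n - 1. inverse (mus k) ^ j * ?D (Suc j))"
    unfolding mus_inv .
  have "inverse (mus k) ^ (n - 1) * (mus k ^ (n - 1) * mus k) = mus k"
    by (simp add: mus_nonzero power_inverse)
  then have 3: "inverse (mus k) ^ (n - 1) * mu ^ n = mus k"
    unfolding power_minus_mult[OF n0] mus_power .
  have 4: "bessel_op n lam xi f z - (\<Sum>j<n. bessel_V n j lam * exp (- z) ^ (n - j) * ?D j) = ?D n - mu ^ n * ?D 0"
    by (simp add: bessel_op_def lessThan_Suc_atMost[symmetric] bessel_V_top mu_def)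
  have "mode_error k f z = (inverse (mus k) ^ (n - 1) * ?D n - (inverse (mus k) ^ (n - 1) * mu ^ n) * ?D 0) / of_nat n"
    unfolding mode_error_def 4 by (simp add: algebra_simps diff_divide_distrib)
  then have 5: "mode_error k f z = (inverse (mus k) ^ (n - 1) * ?D n - mus k * ?D 0) / of_nat n"
    unfolding 3 .
  have "mus k * mode k f z = mus k * (\<Sum>j<n. inverse (mus k) ^ j * ?D j) / of_nat n"
    by (simp add: mode_def)
  then show ?thesis
    unfolding D 1 2 5 by (simp add: diff_divide_distrib add_divide_distrib)
qed

lemma sum_norm_mode_le:
  "(\<Sum>k<n. norm (mode k f z * exp (- mu * exp z))) ^ 2 \<le> real n * energy f z"
  using sum_squared_le_sum_of_squares[of "\<lambda>k. norm (mode k f z * exp (- mu * exp z))" "{..<n}"]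
  by (simp add: energy_def mult.commute)

lemma energy_nonneg: "energy f z \<ge> 0"
  by (simp add: energy_def sum_nonneg)

lemma norm_deriv_le_sum_mode:
  assumes "j < n"
  shows "norm ((U_deriv ^^ j) f z * exp (- mu * exp z)) \<le>
    real n ^ j * (\<Sum>k<n. norm (mode k f z * exp (- mu * exp z)))"
proof -
  have "norm ((U_deriv ^^ j) f z * exp (- mu * exp z))
      = norm (\<Sum>k<n. mus k ^ j * (mode k f z * exp (- mu * exp z)))"
    unfolding deriv_eq_sum_mode[OF assms] by (simp add: sum_distrib_right mult.assoc)
  also have "\<dots> \<le> (\<Sum>k<n. norm (mus k ^ j * (mode k f z * exp (- mu * exp z))))"
    by (rule norm_sum)
  also have "\<dots> = real n ^ j * (\<Sum>k<n. norm (mode k f z * exp (- mu * exp z)))"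
    unfolding sum_distrib_left by (intro sum.cong refl) (simp add: norm_mult norm_power norm_mus mult.assoc)
  finally show ?thesis .
qed

text \<open>Where |z| >= 1, each factor |z|^(j-n) with j < n is at most 1/|z|, so the lower-order
  terms come with one factor 1/|z|. The prefactor in \<open>mode_error\<close> has norm n^(-n) <=
  1.\<close>

lemma norm_mode_error_le:
  assumes "norm (exp (- z)) \<le> 1"
  shows "norm (mode_error k f z * exp (- mu * exp z)) \<le>
    norm (bessel_op n lam xi f z * exp (- mu * exp z)) +
    lower_sum * norm (exp (- z)) * (\<Sum>k<n. norm (mode k f z * exp (- mu * exp z)))"
    (is "_ \<le> ?R + _ * ?x * ?S")
proof -
  let ?e = "exp (- mu * exp z)"
  have "norm (bessel_V n j lam * exp (- z) ^ (n - j) * (U_deriv ^^ j) f z * ?e)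
      \<le> norm (bessel_V n j lam) * real n ^ j * (?x * ?S)" if "j < n" for j
  proof -
    have "norm (exp (- z)) ^ (n - j) \<le> ?x ^ 1"
      using that assms by (intro power_decreasing) auto
    then have "norm (exp (- z)) ^ (n - j) * norm ((U_deriv ^^ j) f z * ?e) \<le> ?x * (real n ^ j * ?S)"
      using norm_deriv_le_sum_mode[OF that, of f z] by (intro mult_mono) auto
    then show ?thesis
      using mult_left_mono[of _ _ "norm (bessel_V n j lam)"] 
      by (fastforce simp: norm_mult norm_power mult_ac)
  qed
  then have "norm (\<Sum>j<n. bessel_V n j lam * exp (- z) ^ (n - j) * (U_deriv ^^ j) f z * ?e) \<le>
      (\<Sum>j<n. norm (bessel_V n j lam) * real n ^ j * (?x * ?S))"
    by (intro sum_norm_le) auto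
  then have *: "norm ((\<Sum>j<n. bessel_V n j lam * exp (- z) ^ (n - j) * (U_deriv ^^ j) f z) * ?e) \<le> lower_sum * ?x * ?S"
    by (simp add: lower_sum_def sum_distrib_right mult.assoc)
  have "1 \<le> real n ^ (n - 1) * real n"
    using n by (simp flip: power_Suc2)
  then have c: "norm (inverse (mus k) ^ (n - 1) / of_nat n) \<le> 1"
    using n by (simp add: norm_divide norm_power norm_inverse norm_mult norm_mus power_inverse field_simps)
  have "norm (mode_error k f z * ?e) = norm (inverse (mus k) ^ (n - 1) / of_nat n) *
      norm (bessel_op n lam xi f z * ?e - (\<Sum>j<n. bessel_V n j lam * exp (- z) ^ (n - j) * (U_deriv ^^ j) f z) * ?e)"
    unfolding mode_error_def by (simp only: norm_mult[symmetric] left_diff_distrib mult.assoc)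
  also have "\<dots> \<le> 1 * (?R + lower_sum * ?x * ?S)"
    using c * norm_triangle_ineq4[of "bessel_op n lam xi f z * ?e"
      "(\<Sum>j<n. bessel_V n j lam * exp (- z) ^ (n - j) * (U_deriv ^^ j) f z) * ?e"]
    by (intro mult_mono) auto
  finally show ?thesis by simp
qed

definition growth_rate :: "complex \<Rightarrow> ucover \<Rightarrow> (ucover \<Rightarrow> complex) \<Rightarrow> real" where
  "growth_rate d z f = (\<Sum>k<n. 2 * ((mode k f z * exp (- mu * exp z)) \<bullet>
     (((mus k - mu) * (mode k f z * exp (- mu * exp z)) + mode_error k f z * exp (- mu * exp z)) * d)))"

text \<open>The factor exp (- mu * exp z) shifts the eigenvalues from \<open>mus k\<close> to
  \<open>mus k - mu\<close>; this is why the real parts of these differences decide about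
  growth.\<close>

lemma energy_ray_deriv:
  assumes f: "f holomorphic_on UNIV" and t: "1 + of_real t * d * exp (- z) \<notin> \<real>\<^sub>\<le>\<^sub>0"
  shows "((\<lambda>t. energy f (ray z d (of_real t))) has_real_derivative growth_rate d (ray z d (of_real t)) f) (at t)"
proof -
  let ?H = "\<lambda>k z. mode k f z * exp (- mu * exp z)"
  have "((\<lambda>t. norm (?H k (ray z d (of_real t))) ^ 2) has_real_derivative
     2 * (?H k (ray z d (of_real t)) \<bullet>
       (((mus k - mu) * ?H k (ray z d (of_real t)) + mode_error k f (ray z d (of_real t)) * exp (- mu * exp (ray z d (of_real t)))) * d)))
     (at t)" for k
  proof -
    have holo: "?H k holomorphic_on UNIV" by (intro holomorphic_intros holomorphic_mode f)
    have "(?H k has_field_derivative U_deriv (mode k f) z * exp z * exp (- mu * exp z)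
        + mode k f z * (exp (- mu * exp z) * (- mu * exp z))) (at z)" for z
      by (auto intro!: derivative_eq_intros has_field_derivative_U_deriv holomorphic_mode f)
    from U_derivI[OF this] have "U_deriv (?H k) z = (mus k - mu) * ?H k z + mode_error k f z * exp (- mu * exp z)" for z
      unfolding U_deriv_mode[OF f] by (simp add: exp_minus field_simps)
    then have "((\<lambda>t. ?H k (ray z d (of_real t))) has_vector_derivative
       ((mus k - mu) * ?H k (ray z d (of_real t)) + mode_error k f (ray z d (of_real t)) * exp (- mu * exp (ray z d (of_real t)))) * d) (at t)"
      using has_vector_derivative_ray[OF holo t] by simp
    from bounded_bilinear.has_vector_derivative[OF bounded_bilinear_inner this this]
    show ?thesis
      by (simp add: has_real_derivative_iff_has_vector_derivative inner_commute power2_norm_eq_inner)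
  qed
  then show ?thesis
    unfolding energy_def growth_rate_def by (intro DERIV_sum)
qed

text \<open>The diagonal part of the system produces the subtracted sum. Cauchy-Schwarz bounds the
  contribution of \<open>mode_error\<close> in each mode, and once more the square of the sum of the
  norms by n times the energy.\<close>

lemma growth_rate_estimate:
  fixes f :: "ucover \<Rightarrow> complex" and z :: ucover and d :: complex
  assumes "norm (exp (- z)) \<le> 1" and d: "norm d = 1"
  defines "q \<equiv> energy f z" and "x \<equiv> norm (exp (- z))"
    and "R \<equiv> norm (bessel_op n lam xi f z * exp (- mu * exp z))"
  shows "\<bar>growth_rate d z f - (\<Sum>k<n. 2 * Re ((mus k - mu) * d) * norm (mode k f z * exp (- mu * exp z)) ^ 2)\<bar>
    \<le> 2 * (\<Sum>k<n. norm (mode k f z * exp (- mu * exp z))) * R + 2 * lower_sum * real n * x * q"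
proof -
  define H where "H k = mode k f z * exp (- mu * exp z)" for k
  define E where "E k = mode_error k f z * exp (- mu * exp z)" for k
  define S where "S = (\<Sum>k<n. norm (H k))"
  have S0: "S \<ge> 0" by (simp add: S_def sum_nonneg)
  have ls: "lower_sum \<ge> 0" unfolding lower_sum_def by (intro sum_nonneg) auto
  have E: "norm (E k) \<le> R + lower_sum * x * S" for k
    using norm_mode_error_le[OF assms(1), of k f] by (simp add: E_def R_def x_def S_def H_def)
  have inner: "H k \<bullet> (((mus k - mu) * H k + E k) * d) = Re ((mus k - mu) * d) * norm (H k) ^ 2 + H k \<bullet> (E k * d)" for k
    unfolding cmod_power2 by (simp add: inner_complex_def power2_eq_square algebra_simps)
  have "growth_rate d z f - (\<Sum>k<n. 2 * Re ((mus k - mu) * d) * norm (H k) ^ 2) = (\<Sum>k<n. 2 * (H k \<bullet> (E k * d)))"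
    unfolding growth_rate_def H_def[symmetric] E_def[symmetric] inner
    by (simp add: sum_subtractf[symmetric] algebra_simps)
  also have "\<bar>\<dots>\<bar> \<le> (\<Sum>k<n. 2 * (norm (H k) * (R + lower_sum * x * S)))"
  proof (rule order_trans[OF sum_abs], rule sum_mono)
    fix k
    have "\<bar>H k \<bullet> (E k * d)\<bar> \<le> norm (H k) * norm (E k * d)" by (rule Cauchy_Schwarz_ineq2)
    also have "\<dots> \<le> norm (H k) * (R + lower_sum * x * S)"
      using E[of k] d by (intro mult_left_mono) (auto simp: norm_mult)
    finally show "\<bar>2 * (H k \<bullet> (E k * d))\<bar> \<le> 2 * (norm (H k) * (R + lower_sum * x * S))" by simp
  qed
  also have "\<dots> = 2 * S * R + 2 * lower_sum * x * S ^ 2"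
    unfolding S_def sum_distrib_left[symmetric] sum_distrib_right[symmetric]
    by (simp add: algebra_simps power2_eq_square)
  also have "\<dots> \<le> 2 * S * R + 2 * lower_sum * x * (real n * q)"
    using sum_norm_mode_le[of f z] ls by (intro add_left_mono mult_left_mono) (auto simp: S_def H_def q_def x_def)
  finally show ?thesis by (simp add: S_def H_def mult_ac)
qed

end

section \<open>Uniqueness and existence on the axis\<close>

context bessel_data
begin

lemma filterlim_add_const_at_top: "filterlim (\<lambda>x :: real. x + c) at_top at_top"
  using filterlim_tendsto_add_at_top[OF tendsto_const[of c] filterlim_ident] by (simp add: add.commute)

section \<open>The a priori estimate along admissible rays\<close>

lemma lower_sum_nonneg: "lower_sum \<ge> 0"
  unfolding lower_sum_def by (intro sum_nonneg) auto

text \<open>The square root of the constant in \<open>norm_ray_ge\<close>; for c = cos delta with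
  delta between 0 and pi it is sin (delta / 2).\<close>

definition aperture :: "real \<Rightarrow> real" where "aperture c = sqrt ((1 - c) / 2)"

text \<open>The power of |z| lost by the energy on the way inward. The summand 1 comes from
  absorbing the residual in \<open>growth_rate_lower\<close>, the division by the aperture from
  comparing |z + t d| with |z| + t. Rounding up makes the exponent a natural number.\<close>

definition rate :: "real \<Rightarrow> nat" where
  "rate c = nat \<lceil>(2 * lower_sum + 1) * real n / aperture c\<rceil>"

text \<open>For c = cos delta the second condition says that the direction makes an angle of at most
  pi - delta with the starting point, so the path avoids the origin. The last condition keeps the
  path outside the unit disc, where the estimates for \<open>norm (exp (- z)) \<le> 1\<close>
  hold.\<close>

definition admissible :: "real \<Rightarrow> ucover \<Rightarrow> complex \<Rightarrow> bool" where
  "admissible c z d \<longleftrightarrow> norm d = 1 \<and> Re (cnj (exp z) * d) \<ge> - c * norm (exp z)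
     \<and> aperture c * norm (exp z) \<ge> 1"

text \<open>Directions in which exp (mu z) is, up to ties, the smallest of the n
  exponentials.\<close>

definition dominated :: "complex \<Rightarrow> bool" where
  "dominated d \<longleftrightarrow> (\<forall>k<n. Re ((mus k - mu) * d) \<ge> 0)"

lemma aperture_pos: "c < 1 \<Longrightarrow> aperture c > 0"
  by (simp add: aperture_def)

lemma admissible_ray:
  assumes "admissible c z d" "0 \<le> c" "c < 1" "0 \<le> t"
  shows "norm (exp z + of_real t * d) \<ge> aperture c * (norm (exp z) + t)"
    and "norm (exp z + of_real t * d) \<ge> 1"
    and "exp (ray z d (of_real t)) = exp z + of_real t * d"
    and "1 + of_real t * d * exp (- z) \<notin> \<real>\<^sub>\<le>\<^sub>0"
proof -
  have lower: "norm (exp z + of_real t * d) \<ge> aperture c * (norm (exp z) + t)" if "t \<ge> 0" for t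
  proof (rule power2_le_imp_le)
    show "(aperture c * (norm (exp z) + t)) ^ 2 \<le> norm (exp z + of_real t * d) ^ 2"
      using norm_ray_ge[of d c "exp z" t] assms that
      by (simp add: aperture_def power_mult_distrib admissible_def)
  qed simp
  show "norm (exp z + of_real t * d) \<ge> aperture c * (norm (exp z) + t)"
    using lower assms(4) .
  have ge1: "norm (exp z + of_real t * d) \<ge> 1" if "t \<ge> 0" for t
  proof -
    have "1 \<le> aperture c * norm (exp z)" using assms(1) by (simp add: admissible_def)
    also have "\<dots> \<le> aperture c * (norm (exp z) + t)"
      using that aperture_pos[OF assms(3)] by (intro mult_left_mono) auto
    also have "\<dots> \<le> norm (exp z + of_real t * d)" using lower that .
    finally show ?thesis .
  qed
  show "norm (exp z + of_real t * d) \<ge> 1" using ge1 assms(4) .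
  show cut: "1 + of_real t * d * exp (- z) \<notin> \<real>\<^sub>\<le>\<^sub>0"
    using ge1 assms(4) by (intro ray_avoids_cut) force+
  then show "exp (ray z d (of_real t)) = exp z + of_real t * d"
    by (intro exp_ray) auto
qed

text \<open>In a dominated direction the diagonal part is nonnegative and is dropped. The cross term
  is split as \<open>2 * S * R \<le> S ^ 2 * x + R ^ 2 / x\<close>; the weight x = 1/|z| gives its
  first half the same order as the loss from the lower-order terms.\<close>

lemma growth_rate_lower:
  fixes f :: "ucover \<Rightarrow> complex" and z :: ucover and d :: complex
  assumes x: "norm (exp (- z)) \<le> 1" and d: "norm d = 1" "dominated d"
  shows "growth_rate d z f \<ge> - ((2 * lower_sum + 1) * real n) * norm (exp (- z)) * energy f z
    - norm (bessel_op n lam xi f z * exp (- mu * exp z)) ^ 2 / norm (exp (- z))"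
proof -
  define S where "S = (\<Sum>k<n. norm (mode k f z * exp (- mu * exp z)))"
  define R where "R = norm (bessel_op n lam xi f z * exp (- mu * exp z))"
  define x where "x = norm (exp (- z))"
  define P where "P = (\<Sum>k<n. 2 * Re ((mus k - mu) * d) * norm (mode k f z * exp (- mu * exp z)) ^ 2)"
  have x0: "x > 0" by (simp add: x_def)
  have "P \<ge> 0"
    unfolding P_def using d(2) by (intro sum_nonneg mult_nonneg_nonneg) (auto simp: dominated_def)
  moreover have "\<bar>growth_rate d z f - P\<bar> \<le> 2 * S * R + 2 * lower_sum * real n * x * energy f z"
    using growth_rate_estimate[OF assms(1,2), of f] by (simp add: S_def R_def x_def P_def)
  moreover have "2 * S * R \<le> S ^ 2 * x + R ^ 2 / x"
  proof -
    have "0 \<le> (S * x - R) ^ 2 / x" using x0 by simp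
    also have "\<dots> = S ^ 2 * x + R ^ 2 / x - 2 * S * R"
      using x0 by (simp add: power2_eq_square field_simps)
    finally show ?thesis by simp
  qed
  moreover have "S ^ 2 * x \<le> real n * energy f z * x"
    using sum_norm_mode_le[of f z] x0 by (intro mult_right_mono) (auto simp: S_def)
  ultimately show ?thesis
    unfolding R_def[symmetric] x_def[symmetric] by (simp add: algebra_simps)
qed

lemma growth_rate_upper:
  fixes f :: "ucover \<Rightarrow> complex" and z :: ucover and d :: complex
  assumes x: "norm (exp (- z)) \<le> 1" and d: "norm d = 1" and op: "bessel_op n lam xi f z = 0"
  shows "growth_rate d z f \<le> (4 * real n + 2 * lower_sum * real n) * energy f z"
proof -
  define H where "H k = norm (mode k f z * exp (- mu * exp z)) ^ 2" for k
  have "(\<Sum>k<n. 2 * Re ((mus k - mu) * d) * H k) \<le> (\<Sum>k<n. 4 * real n * H k)"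
  proof (rule sum_mono)
    fix k
    have "Re ((mus k - mu) * d) \<le> norm (mus k - mu)"
      using complex_Re_le_cmod[of "(mus k - mu) * d"] d by (simp add: norm_mult)
    also have "\<dots> \<le> 2 * real n" using norm_triangle_ineq4[of "mus k" mu] by (simp add: norm_mus norm_mu)
    finally show "2 * Re ((mus k - mu) * d) * H k \<le> 4 * real n * H k"
      by (intro mult_right_mono) (auto simp: H_def)
  qed
  also have "\<dots> = 4 * real n * energy f z"
    by (simp add: energy_def H_def sum_distrib_left)
  finally have 1: "(\<Sum>k<n. 2 * Re ((mus k - mu) * d) * H k) \<le> 4 * real n * energy f z" .
  have "lower_sum * real n * energy f z * norm (exp (- z)) \<le> lower_sum * real n * energy f z * 1"
    using x lower_sum_nonneg energy_nonneg by (intro mult_left_mono) auto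
  then have 2: "2 * lower_sum * real n * norm (exp (- z)) * energy f z \<le> 2 * lower_sum * real n * energy f z"
    by (simp add: mult_ac)
  show ?thesis
    using growth_rate_estimate[OF x d, of f] 1 2 op by (simp add: H_def algebra_simps abs_le_iff)
qed

text \<open>The aperture turns the bound in 1/|z + t d| into one in 1/(r + t), the form required by
  \<open>backward_gronwall\<close>. The last summand is independent of T, so T may later tend to
  infinity.\<close>

lemma energy_apriori:
  fixes f :: "ucover \<Rightarrow> complex" and z :: ucover and d :: complex and T c C :: real and M :: nat
  assumes f: "f holomorphic_on UNIV"
    and op: "\<And>z. norm (exp (- z)) \<le> 1 \<Longrightarrow>
      norm (bessel_op n lam xi f z * exp (- mu * exp z)) \<le> C * norm (exp (- z)) ^ M"
    and M: "M \<ge> rate c + 2" and c: "0 \<le> c" "c < 1" and T: "T \<ge> 0"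
    and d: "admissible c z d" "dominated d"
  shows "energy f z * norm (exp z) ^ rate c \<le>
    energy f (ray z d (of_real T)) * (norm (exp z) + T) ^ rate c
    + C\<^sup>2 / aperture c ^ M / norm (exp z) ^ (M - rate c - 1)"
proof -
  define r where "r = norm (exp z)"
  define q where "q t = energy f (ray z d (of_real t))" for t
  have r: "r > 0" by (simp add: r_def)
  note ap = aperture_pos[OF c(2)]
  have "q 0 * r ^ rate c \<le> q T * (r + T) ^ rate c + C\<^sup>2 / aperture c ^ M / r ^ (M - rate c - 1)"
  proof (rule backward_gronwall[where q' = "\<lambda>t. growth_rate d (ray z d (of_real t)) f", OF r T M])
    show "C\<^sup>2 / aperture c ^ M \<ge> 0" using ap by simp
    fix t assume t: "0 \<le> t" "t \<le> T"
    note ray = admissible_ray[OF d(1) c t(1)]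
    show "(q has_real_derivative growth_rate d (ray z d (of_real t)) f) (at t)"
      unfolding q_def by (rule energy_ray_deriv[OF f ray(4)])
    let ?z = "ray z d (of_real t)"
    define x where "x = norm (exp (- ?z))"
    have x_eq: "x = 1 / norm (exp z + of_real t * d)"
      unfolding x_def exp_minus ray(3) by (simp add: norm_inverse divide_inverse)
    have x: "0 < x" "x \<le> 1" using ray(2) unfolding x_eq by (auto simp: divide_le_eq)
    have apr: "aperture c * (r + t) > 0" using ap r t by simp
    have x_le: "x \<le> 1 / (aperture c * (r + t))"
    proof -
      have "norm (exp z + of_real t * d) > 0" using ray(2) by linarith
      from mult_pos_pos[OF this apr] show ?thesis
        unfolding x_eq by (rule divide_left_mono[OF ray(1)[folded r_def], rotated]) simp
    qed
    have "(2 * lower_sum + 1) * real n / aperture c \<le> real (rate c)"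
      unfolding rate_def by linarith
    then have "(2 * lower_sum + 1) * real n / aperture c / (r + t) \<le> real (rate c) / (r + t)"
      using r t by (intro divide_right_mono) auto
    moreover have "(2 * lower_sum + 1) * real n * x \<le> (2 * lower_sum + 1) * real n * (1 / (aperture c * (r + t)))"
      using x_le lower_sum_nonneg by (intro mult_left_mono) auto
    ultimately have "(2 * lower_sum + 1) * real n * x \<le> real (rate c) / (r + t)"
      by (simp add: mult.assoc)
    then have 1: "(2 * lower_sum + 1) * real n * x * q t \<le> real (rate c) / (r + t) * q t"
      using energy_nonneg by (intro mult_right_mono) (auto simp: q_def)
    have "norm (bessel_op n lam xi f ?z * exp (- mu * exp ?z)) ^ 2 \<le> (C * x ^ M) ^ 2"
      using op[of ?z] x by (intro power_mono) (auto simp: x_def)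
    then have "norm (bessel_op n lam xi f ?z * exp (- mu * exp ?z)) ^ 2 / x \<le> (C * x ^ M) ^ 2 / x"
      using x by (intro divide_right_mono) auto
    also have "\<dots> = C\<^sup>2 * (x ^ M * x ^ (M - 1))"
      using x M by (cases M) (auto simp: power_mult_distrib power2_eq_square)
    \<comment> \<open>The residual enters squared and divided by x; of the resulting power 2M - 1
      only M is kept, since truncations of every order are available.\<close>
    also have "\<dots> \<le> C\<^sup>2 * (x ^ M * 1)"
      using x by (intro mult_left_mono power_le_one) auto
    also have "\<dots> \<le> C\<^sup>2 * (1 / (aperture c * (r + t))) ^ M"
      using x_le x by (simp only: mult_1_right) (intro mult_left_mono power_mono, auto)
    also have "\<dots> = C\<^sup>2 / aperture c ^ M / (r + t) ^ M"
      by (simp add: power_mult_distrib power_divide)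
    finally have 2: "norm (bessel_op n lam xi f ?z * exp (- mu * exp ?z)) ^ 2 / x \<le> C\<^sup>2 / aperture c ^ M / (r + t) ^ M" .
    have "norm d = 1" using d(1) by (simp add: admissible_def)
    from growth_rate_lower[OF x(2)[unfolded x_def] this d(2), of f] 1 2
    show "- real (rate c) * q t / (r + t) - C\<^sup>2 / aperture c ^ M / (r + t) ^ M \<le> growth_rate d ?z f"
      by (simp add: x_def[symmetric] q_def del: norm_exp_eq_Re)
  qed
  then show ?thesis by (simp add: q_def r_def)
qed

lemma energy_forward:
  fixes f :: "ucover \<Rightarrow> complex" and z :: ucover and d :: complex and T c :: real
  assumes f: "f holomorphic_on UNIV" and op: "\<And>z. bessel_op n lam xi f z = 0"
    and c: "0 \<le> c" "c < 1" and T: "T \<ge> 0" and d: "admissible c z d"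
  shows "energy f (ray z d (of_real T)) \<le> energy f z * exp ((4 * real n + 2 * lower_sum * real n) * T)"
proof -
  have "energy f (ray z d (of_real T)) \<le> energy f (ray z d (of_real 0)) * exp ((4 * real n + 2 * lower_sum * real n) * T)"
  proof (rule forward_gronwall[where q' = "\<lambda>t. growth_rate d (ray z d (of_real t)) f", OF T])
    fix t assume t: "0 \<le> t" "t \<le> T"
    note ray = admissible_ray[OF d c t(1)]
    show "((\<lambda>t. energy f (ray z d (of_real t))) has_real_derivative growth_rate d (ray z d (of_real t)) f) (at t)"
      by (rule energy_ray_deriv[OF f ray(4)])
    have "norm (exp (- ray z d (of_real t))) \<le> 1"
      using ray(2) unfolding exp_minus ray(3) by (simp add: norm_inverse inverse_le_1_iff)
    then show "growth_rate d (ray z d (of_real t)) f \<le> (4 * real n + 2 * lower_sum * real n) * energy f (ray z d (of_real t))"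
      using d op by (intro growth_rate_upper) (auto simp: admissible_def)
  qed
  then show ?thesis by simp
qed

lemma mode_diff:
  assumes "f holomorphic_on UNIV" "g holomorphic_on UNIV"
  shows "mode k (\<lambda>z. f z - g z) z = mode k f z - mode k g z"
  by (simp add: mode_def U_deriv_funpow_diff[OF assms] right_diff_distrib sum_subtractf diff_divide_distrib)

lemma energy_diff:
  assumes "f holomorphic_on UNIV" "g holomorphic_on UNIV"
  shows "energy (\<lambda>z. f z - g z) z \<le> 2 * energy f z + 2 * energy g z"
proof -
  have "norm (a - b) ^ 2 \<le> 2 * norm a ^ 2 + 2 * norm b ^ 2" for a b :: complex
  proof -
    have "norm (a - b) ^ 2 + norm (a + b) ^ 2 = 2 * norm a ^ 2 + 2 * norm b ^ 2"
      unfolding cmod_power2 by (simp add: power2_eq_square algebra_simps)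
    moreover have "norm (a + b) ^ 2 \<ge> 0" by simp
    ultimately show ?thesis by linarith
  qed
  then have "energy (\<lambda>z. f z - g z) z \<le> (\<Sum>k<n. 2 * norm (mode k f z * exp (- mu * exp z)) ^ 2
      + 2 * norm (mode k g z * exp (- mu * exp z)) ^ 2)"
    unfolding energy_def mode_diff[OF assms] left_diff_distrib by (intro sum_mono) auto
  then show ?thesis
    by (simp add: energy_def sum.distrib sum_distrib_left)
qed

lemma energy_cong:
  assumes "\<And>j. j < n \<Longrightarrow> (U_deriv ^^ j) f z = (U_deriv ^^ j) g z"
  shows "energy f z = energy g z"
  using assms by (simp add: energy_def mode_def)

lemma norm_deriv_le_energy:
  assumes "j < n"
  shows "norm ((U_deriv ^^ j) f z * exp (- mu * exp z)) \<le> real n ^ j * sqrt (real n * energy f z)"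
  using norm_deriv_le_sum_mode[OF assms, of f z] real_le_rsqrt[OF sum_norm_mode_le[of f z]]
  by (smt (verit) mult_left_mono of_nat_0_le_iff zero_le_power)

section \<open>The axis, along which exp (mu z) decays fastest\<close>

definition alpha :: real where "alpha = pi / 2 - U_arg xi"

definition pt :: "real \<Rightarrow> ucover" where "pt r = Complex (ln r) alpha"

lemma exp_pt: "r > 0 \<Longrightarrow> exp (pt r) = of_real r * cis alpha"
  by (simp add: pt_def exp_eq_polar exp_of_real[symmetric])

lemma norm_exp_pt: "r > 0 \<Longrightarrow> norm (exp (pt r)) = r"
  by (simp add: exp_pt norm_mult)

lemma mu_cis_alpha: "mu * cis alpha = - of_nat n"
proof -
  have "Re xi = 0" using norm_U_proj_xi by (simp add: U_proj_def)
  then have "mu = of_nat n * cis (pi / 2 + Im xi)"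
    by (simp add: mu_def U_proj_def exp_eq_polar flip: cis_mult)
  then have "mu * cis alpha = of_nat n * cis (pi / 2 + Im xi + alpha)"
    by (simp only: mult.assoc cis_mult)
  then show ?thesis by (simp add: alpha_def U_arg_def)
qed

lemma Re_mus_diff_cis:
  "Re ((mus k - mu) * cis (alpha + \<phi>)) = 2 * real n * sin (\<phi> + pi * real k / real n) * sin (pi * real k / real n)"
proof -
  define w where "w = 2 * pi * real k / real n"
  have "exp (2 * of_real pi * \<i> * of_nat k / of_nat n) = cis w"
    by (simp add: w_def cis_conv_exp mult_ac)
  then have "(mus k - mu) * cis (alpha + \<phi>) = mu * cis alpha * (cis w - 1) * cis \<phi>"
    by (simp add: mus_def algebra_simps flip: cis_mult)
  also have "\<dots> = of_nat n * (cis \<phi> - cis (\<phi> + w))"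
    unfolding mu_cis_alpha by (simp add: algebra_simps flip: cis_mult)
  finally have "Re ((mus k - mu) * cis (alpha + \<phi>)) = real n * (cos \<phi> - cos (\<phi> + w))" by simp
  also have "cos \<phi> - cos (\<phi> + w) = 2 * sin (\<phi> + w / 2) * sin (w / 2)"
    unfolding cos_diff_cos by (simp add: field_simps)
  finally show ?thesis by (simp add: w_def)
qed

text \<open>By \<open>Re_mus_diff_cis\<close> the sign is decided by sin (phi + pi k / n). For all k
  with 0 < k < n this angle stays between 0 and pi exactly when |phi| <= pi/n, which is the origin
  of the term pi/n in the opening of the sector.\<close>

lemma dominated_cis:
  assumes "\<bar>\<phi>\<bar> \<le> pi / real n"
  shows "dominated (cis (alpha + \<phi>))"
  unfolding dominated_def
proof (intro allI impI)
  fix k assume k: "k < n"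
  show "0 \<le> Re ((mus k - mu) * cis (alpha + \<phi>))"
  proof (cases "k = 0")
    case False
    have "pi * real k / real n \<ge> pi / real n" using False n by (simp add: divide_right_mono)
    moreover have "pi * (real k + 1) / real n \<le> pi * real n / real n"
      using k by (intro divide_right_mono mult_left_mono) auto
    then have "pi * real k / real n + pi / real n \<le> pi" using n by (simp add: distrib_left add_divide_distrib)
    ultimately have "0 \<le> sin (\<phi> + pi * real k / real n)" "0 \<le> sin (pi * real k / real n)"
      using assms by (auto intro!: sin_ge_zero simp: abs_le_iff)
    then show ?thesis unfolding Re_mus_diff_cis by simp
  next
    case True
    show ?thesis unfolding Re_mus_diff_cis True by simp
  qed
qed

lemma Re_mus_diff_pos:
  assumes "k < n" "k \<noteq> 0"
  shows "Re ((mus k - mu) * cis alpha) > 0"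
proof -
  have "pi * real k / real n < pi" "pi * real k / real n > 0" using assms by (auto simp: field_simps)
  then have "sin (pi * real k / real n) > 0" by (intro sin_gt_zero)
  then show ?thesis using Re_mus_diff_cis[of k 0] n by simp
qed

lemma ray_pt:
  assumes "r > 0" "t \<ge> 0"
  shows "ray (pt r) (cis alpha) (of_real t) = pt (r + t)"
proof -
  have "of_real t * cis alpha * exp (- pt r) = of_real (t / r)"
    using assms by (simp add: exp_minus exp_pt divide_inverse cis_mult)
  then have "ray (pt r) (cis alpha) (of_real t) = pt r + Ln (of_real (1 + t / r))"
    by (simp add: ray_def)
  also have "Ln (of_real (1 + t / r)) = of_real (ln (1 + t / r))"
    using assms by (intro Ln_of_real) (simp add: add_pos_nonneg)
  also have "1 + t / r = (r + t) / r" using assms by (simp add: field_simps)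
  also have "ln ((r + t) / r) = ln (r + t) - ln r" using assms by (simp add: ln_div)
  finally show ?thesis by (simp add: pt_def complex_eq_iff)
qed

text \<open>On the axis the direction is that of the point itself, so c = 0 is allowed; and r >= 2
  exceeds 1 / aperture 0, the square root of 2.\<close>

lemma admissible_pt:
  assumes "r \<ge> 2"
  shows "admissible 0 (pt r) (cis alpha)"
proof -
  have "Re (cnj (exp (pt r)) * cis alpha) = r * ((cos alpha)\<^sup>2 + (sin alpha)\<^sup>2)"
    using assms by (simp add: exp_pt power2_eq_square algebra_simps)
  moreover have "sqrt (1 / 2) * r \<ge> 1"
  proof -
    have "1 / 2 \<le> sqrt (1 / 2)" by (rule real_le_rsqrt) (simp add: power2_eq_square)
    from mult_mono[OF this assms] show ?thesis by simp
  qed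
  ultimately show ?thesis
    using assms unfolding admissible_def norm_exp_pt[of r, OF less_le_trans[OF zero_less_numeral assms]]
    by (simp add: aperture_def)
qed

lemma dominated_alpha: "dominated (cis alpha)"
  using dominated_cis[of 0] by simp

text \<open>A solution has residual 0, so the a priori estimate applies with C = 0, and M is set to
  the least value that it admits.\<close>

lemma energy_pt_homogeneous:
  assumes "f holomorphic_on UNIV" "\<And>z. bessel_op n lam xi f z = 0" "2 \<le> r" "r \<le> r'"
  shows "energy f (pt r) * r ^ rate 0 \<le> energy f (pt r') * r' ^ rate 0"
  using energy_apriori[of f 0 "rate 0 + 2" 0 "r' - r" "pt r" "cis alpha"] assms
    admissible_pt[of r] dominated_alpha ray_pt[of r "r' - r"] norm_exp_pt[of r] by simp

lemma energy_zero_imp_zero: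
  assumes "energy f z = 0"
  shows "f z = 0"
  using norm_deriv_le_energy[of 0 f z] assms n by simp

text \<open>Going inward the energy loses at most the power \<open>rate 0\<close>, so decay by one
  power more at infinity forces it, and with it f, to vanish on the axis from r = 2 on. The identity
  theorem does the rest.\<close>

lemma solution_zero:
  assumes f: "f holomorphic_on UNIV" "\<And>z. bessel_op n lam xi f z = 0"
    and C: "\<And>r. r \<ge> R \<Longrightarrow> energy f (pt r) \<le> C / r ^ (rate 0 + 1)"
  shows "f z = 0"
proof -
  have zero: "f (pt r) = 0" if r: "r \<ge> 2" for r
  proof -
    have "energy f (pt r) * r ^ rate 0 \<le> 0"
    proof (rule tendsto_lowerbound[of "\<lambda>r'. C / r'"])
      show "((\<lambda>r'. C / r') \<longlongrightarrow> 0) at_top"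
        by (intro tendsto_divide_0[OF tendsto_const] filterlim_at_top_imp_at_infinity filterlim_ident)
      have "\<forall>\<^sub>F r' in at_top. max R (max r 1) \<le> r'" by (rule eventually_ge_at_top)
      then show "\<forall>\<^sub>F r' in at_top. energy f (pt r) * r ^ rate 0 \<le> C / r'"
      proof eventually_elim
        case (elim r')
        have "energy f (pt r) * r ^ rate 0 \<le> energy f (pt r') * r' ^ rate 0"
          using elim r by (intro energy_pt_homogeneous f) auto
        also have "\<dots> \<le> C / r' ^ (rate 0 + 1) * r' ^ rate 0"
          using elim by (intro mult_right_mono C) auto
        also have "\<dots> = C / r'" using elim by simp
        finally show ?case .
      qed
    qed simp
    moreover have "r ^ rate 0 > 0" using r by simp
    ultimately have "energy f (pt r) = 0"
      using energy_nonneg[of f "pt r"] by (simp add: mult_le_0_iff)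
    then show ?thesis by (rule energy_zero_imp_zero)
  qed
  \<comment> \<open>This is the point r = 3, in the interior of the half-line r >= 2; the points
    \<open>3 * exp (e / 2)\<close> of the half-line approach it.\<close>
  have "Complex (ln 3) alpha islimpt (pt ` {2..})"
  proof (rule islimptI)
    fix T assume T: "Complex (ln 3) alpha \<in> T" "open T"
    then obtain e where e: "e > 0" "ball (Complex (ln 3) alpha) e \<subseteq> T" by (auto simp: open_contains_ball)
    define r where "r = 3 * exp (e / 2)"
    have "pt r = Complex (ln 3 + e / 2) alpha" by (simp add: pt_def r_def ln_mult)
    moreover have "dist (Complex (ln 3) alpha) (Complex (ln 3 + e / 2) alpha) = e / 2"
      using e by (simp add: dist_norm cmod_def)
    ultimately have "pt r \<in> T \<and> pt r \<noteq> Complex (ln 3) alpha" using e by auto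
    moreover have "1 \<le> exp (e / 2)" using e by simp
    then have "r \<ge> 2" unfolding r_def by linarith
    then have "pt r \<in> pt ` {2..}" by blast
    ultimately show "\<exists>y\<in>pt ` {2..}. y \<in> T \<and> y \<noteq> Complex (ln 3) alpha" by blast
  qed
  from analytic_continuation[OF f(1) open_UNIV connected_UNIV _ _ this, of z] zero
  show ?thesis by auto
qed

text \<open>Since \<open>W N - U\<close> has energy 0 at the point where the initial values agree,
  the inward estimate for it involves only the residual of U and is uniform in N. The differences of
  the \<open>W N\<close> are exact solutions, so convergence needs to be shown only for the initial
  values at one fixed point.\<close>

lemma solution_exists:
  assumes U: "U holomorphic_on UNIV"
    and op: "\<And>z. norm (exp (- z)) \<le> 1 \<Longrightarrow>
      norm (bessel_op n lam xi U z * exp (- mu * exp z)) \<le> C * norm (exp (- z)) ^ M"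
    and M: "M \<ge> rate 0 + 2"
  obtains J where "J holomorphic_on UNIV" "\<And>z. bessel_op n lam xi J z = 0"
    "\<And>r. r \<ge> 2 \<Longrightarrow> energy (\<lambda>z. J z - U z) (pt r) \<le> 2 * (C\<^sup>2 / aperture 0 ^ M) / r ^ (M - 1)"
proof -
  define B where "B = C\<^sup>2 / aperture 0 ^ M"
  have B0: "B \<ge> 0" using aperture_pos[of 0] by (simp add: B_def)
  define \<rho> where "\<rho> N = real N + 2" for N :: nat
  have "\<exists>w. w holomorphic_on UNIV \<and> (\<forall>z. bessel_op n lam xi w z = 0) \<and>
      (\<forall>j<n. (U_deriv ^^ j) w (pt (\<rho> N)) = (U_deriv ^^ j) U (pt (\<rho> N)))" for N
    using bessel_op_initial_value[of n lam xi "pt (\<rho> N)" "\<lambda>j. (U_deriv ^^ j) U (pt (\<rho> N))"] n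
    by (metis One_nat_def Suc_1 Suc_leD)
  then obtain W where W: "\<And>N. W N holomorphic_on UNIV" "\<And>N z. bessel_op n lam xi (W N) z = 0"
    and Wdata: "\<And>N j. j < n \<Longrightarrow> (U_deriv ^^ j) (W N) (pt (\<rho> N)) = (U_deriv ^^ j) U (pt (\<rho> N))"
    by metis
  have EN: "energy (\<lambda>z. W N z - U z) (pt r) \<le> B / r ^ (M - 1)" if r: "2 \<le> r" "r \<le> \<rho> N" for N r
  proof -
    have "energy (\<lambda>z. W N z - U z) (pt (\<rho> N)) = 0"
      unfolding energy_def by (intro sum.neutral ballI) (simp add: mode_diff W U, simp add: mode_def Wdata)
    moreover have "norm (bessel_op n lam xi (\<lambda>z. W N z - U z) z * exp (- mu * exp z)) \<le> C * norm (exp (- z)) ^ M"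
      if "norm (exp (- z)) \<le> 1" for z
      using op[OF that] by (simp add: bessel_op_diff W U)
    ultimately have "energy (\<lambda>z. W N z - U z) (pt r) * r ^ rate 0 \<le> B / r ^ (M - rate 0 - 1)"
      using energy_apriori[of "\<lambda>z. W N z - U z" C M 0 "\<rho> N - r" "pt r" "cis alpha"] r M W U
        admissible_pt[of r] dominated_alpha ray_pt[of r "\<rho> N - r"] norm_exp_pt[of r]
      by (auto simp: B_def intro!: holomorphic_intros)
    moreover have "r ^ (M - 1) = r ^ rate 0 * r ^ (M - rate 0 - 1)"
      using M by (simp flip: power_add)
    ultimately show ?thesis using r by (simp add: field_simps)
  qed
  \<comment> \<open>At the point where \<open>W N\<close> agrees with U the difference may be
    replaced by \<open>W N' - U\<close>, which \<open>EN\<close> estimates; the homogeneous estimate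
    then carries the bound inward to \<open>pt 2\<close>.\<close>
  have diff: "energy (\<lambda>z. W N' z - W N z) (pt 2) \<le> B / \<rho> N" if N: "N \<le> N'" for N N'
  proof -
    have \<rho>: "\<rho> N \<ge> 2" "\<rho> N \<le> \<rho> N'" using N by (auto simp: \<rho>_def)
    have "energy (\<lambda>z. W N' z - W N z) (pt 2) * 1 \<le> energy (\<lambda>z. W N' z - W N z) (pt 2) * 2 ^ rate 0"
      by (intro mult_left_mono energy_nonneg) auto
    also have "\<dots> \<le> energy (\<lambda>z. W N' z - W N z) (pt (\<rho> N)) * \<rho> N ^ rate 0"
      using \<rho> W by (intro energy_pt_homogeneous) (auto simp: bessel_op_diff intro!: holomorphic_intros)
    also have "energy (\<lambda>z. W N' z - W N z) (pt (\<rho> N)) = energy (\<lambda>z. W N' z - U z) (pt (\<rho> N))"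
      by (intro energy_cong) (simp add: U_deriv_funpow_diff W U Wdata)
    also have "\<dots> * \<rho> N ^ rate 0 \<le> B / \<rho> N ^ (M - 1) * \<rho> N ^ rate 0"
      using \<rho> by (intro mult_right_mono EN) auto
    also have "\<dots> = B / \<rho> N ^ (M - 1 - rate 0)"
    proof -
      have "\<rho> N ^ (M - 1) = \<rho> N ^ (M - 1 - rate 0) * \<rho> N ^ rate 0" using M by (simp flip: power_add)
      then show ?thesis using \<rho> by simp
    qed
    also have "\<dots> \<le> B / \<rho> N ^ 1"
      using \<rho> M B0 by (intro divide_left_mono power_increasing) auto
    finally show ?thesis by simp
  qed
  have "Cauchy (\<lambda>N. (U_deriv ^^ j) (W N) (pt 2))" if j: "j < n" for j
  proof -
    define G where "G = norm (exp (- mu * exp (pt 2)))"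
    have G: "G > 0" by (simp add: G_def)
    define K where "K = real n ^ j * sqrt (real n * B) / G"
    have bound: "norm ((U_deriv ^^ j) (W N') (pt 2) - (U_deriv ^^ j) (W N) (pt 2)) \<le> K / sqrt (\<rho> N)" if "N \<le> N'" for N N'
    proof -
      have "norm ((U_deriv ^^ j) (\<lambda>z. W N' z - W N z) (pt 2) * exp (- mu * exp (pt 2)))
          \<le> real n ^ j * sqrt (real n * energy (\<lambda>z. W N' z - W N z) (pt 2))"
        by (rule norm_deriv_le_energy[OF j])
      also have "\<dots> \<le> real n ^ j * sqrt (real n * (B / \<rho> N))"
        using diff[OF that] by (intro mult_left_mono real_sqrt_le_mono) auto
      finally have "norm ((U_deriv ^^ j) (W N') (pt 2) - (U_deriv ^^ j) (W N) (pt 2)) * G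
          \<le> real n ^ j * sqrt (real n * (B / \<rho> N))"
        unfolding U_deriv_funpow_diff[OF W(1) W(1)] norm_mult G_def .
      then have "norm ((U_deriv ^^ j) (W N') (pt 2) - (U_deriv ^^ j) (W N) (pt 2))
          \<le> real n ^ j * sqrt (real n * (B / \<rho> N)) / G"
        using G by (simp add: pos_le_divide_eq)
      also have "\<dots> = K / sqrt (\<rho> N)"
        by (simp add: K_def real_sqrt_mult real_sqrt_divide)
      finally show ?thesis .
    qed
    have lim: "(\<lambda>N. K / sqrt (\<rho> N)) \<longlonglongrightarrow> 0"
      unfolding \<rho>_def
      by (intro tendsto_divide_0[OF tendsto_const] filterlim_at_top_imp_at_infinity
          filterlim_compose[OF sqrt_at_top] filterlim_compose[OF _ filterlim_real_sequentially]
          filterlim_add_const_at_top)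
    show ?thesis
    proof (rule CauchyI')
      fix e :: real assume "e > 0"
      with order_tendstoD(2)[OF lim] obtain N0 where N0: "\<And>N. N \<ge> N0 \<Longrightarrow> K / sqrt (\<rho> N) < e"
        by (auto simp: eventually_sequentially)
      have "dist ((U_deriv ^^ j) (W N) (pt 2)) ((U_deriv ^^ j) (W N') (pt 2)) < e" if "N \<ge> N0" "N < N'" for N N'
        using bound[of N N'] N0[of N] that by (simp add: dist_norm norm_minus_commute)
      then show "\<exists>N0. \<forall>N\<ge>N0. \<forall>N'>N. dist ((U_deriv ^^ j) (W N) (pt 2)) ((U_deriv ^^ j) (W N') (pt 2)) < e"
        by blast
    qed
  qed
  then have "\<forall>j<n. \<exists>a. (\<lambda>N. (U_deriv ^^ j) (W N) (pt 2)) \<longlonglongrightarrow> a"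
    by (auto simp: Cauchy_convergent_iff convergent_def)
  then obtain a where a: "\<And>j. j < n \<Longrightarrow> (\<lambda>N. (U_deriv ^^ j) (W N) (pt 2)) \<longlonglongrightarrow> a j" by metis
  obtain J where J: "J holomorphic_on UNIV" "\<And>z. bessel_op n lam xi J z = 0"
    and Jdata: "\<And>j. j < n \<Longrightarrow> (U_deriv ^^ j) J (pt 2) = a j"
    using bessel_op_initial_value[of n lam xi "pt 2" a] n by (metis One_nat_def Suc_1 Suc_leD)
  have lim2: "(\<lambda>N. energy (\<lambda>z. W N z - J z) (pt 2)) \<longlonglongrightarrow> 0"
  proof -
    have "(\<lambda>N. mode k (W N) (pt 2)) \<longlonglongrightarrow> mode k J (pt 2)" for k
      unfolding mode_def using n by (intro tendsto_intros) (auto simp: Jdata a)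
    then have "(\<lambda>N. mode k (\<lambda>z. W N z - J z) (pt 2)) \<longlonglongrightarrow> 0" for k
      unfolding mode_diff[OF W(1) J(1)] by (intro LIM_zero)
    then have "(\<lambda>N. energy (\<lambda>z. W N z - J z) (pt 2)) \<longlonglongrightarrow> (\<Sum>k<n. norm (0 * exp (- mu * exp (pt 2))) ^ 2)"
      unfolding energy_def by (intro tendsto_intros)
    then show ?thesis by simp
  qed
  show ?thesis
  proof (rule that[OF J])
    fix r :: real assume r: "r \<ge> 2"
    define D where "D = exp ((4 * real n + 2 * lower_sum * real n) * (r - 2))"
    \<comment> \<open>Convergence of the initial values at \<open>pt 2\<close> spreads to the fixed
      distance r by \<open>energy_forward\<close>, whose factor D does not depend on N.\<close>
    have "(\<lambda>N. energy (\<lambda>z. W N z - J z) (pt r)) \<longlonglongrightarrow> 0"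
    proof (rule tendsto_sandwich[OF _ _ tendsto_const])
      show "(\<lambda>N. energy (\<lambda>z. W N z - J z) (pt 2) * D) \<longlonglongrightarrow> 0"
        using tendsto_mult_right[OF lim2, of D] by simp
      show "\<forall>\<^sub>F N in sequentially. energy (\<lambda>z. W N z - J z) (pt r) \<le> energy (\<lambda>z. W N z - J z) (pt 2) * D"
      proof (intro always_eventually allI)
        fix N
        show "energy (\<lambda>z. W N z - J z) (pt r) \<le> energy (\<lambda>z. W N z - J z) (pt 2) * D"
          using energy_forward[of "\<lambda>z. W N z - J z" 0 "r - 2" "pt 2" "cis alpha"] r
            admissible_pt[of 2] ray_pt[of 2 "r - 2"] W J
          by (auto simp: D_def bessel_op_diff intro!: holomorphic_intros)
      qed
    qed (auto simp: energy_nonneg)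
    then have "(\<lambda>N. 2 * (B / r ^ (M - 1)) + 2 * energy (\<lambda>z. W N z - J z) (pt r)) \<longlonglongrightarrow> 2 * (B / r ^ (M - 1)) + 2 * 0"
      by (intro tendsto_intros)
    moreover have "\<exists>N0. \<forall>N\<ge>N0. energy (\<lambda>z. J z - U z) (pt r) \<le> 2 * (B / r ^ (M - 1)) + 2 * energy (\<lambda>z. W N z - J z) (pt r)"
    proof (intro exI allI impI)
      fix N assume "N \<ge> nat \<lceil>r\<rceil>"
      then have "r \<le> \<rho> N" by (simp add: \<rho>_def)
      have "energy (\<lambda>z. J z - U z) (pt r) = energy (\<lambda>z. (W N z - U z) - (W N z - J z)) (pt r)" by simp
      also have "\<dots> \<le> 2 * energy (\<lambda>z. W N z - U z) (pt r) + 2 * energy (\<lambda>z. W N z - J z) (pt r)"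
        using W J U by (intro energy_diff holomorphic_intros)
      finally show "energy (\<lambda>z. J z - U z) (pt r) \<le> 2 * (B / r ^ (M - 1)) + 2 * energy (\<lambda>z. W N z - J z) (pt r)"
        using EN[OF r \<open>r \<le> \<rho> N\<close>] by linarith
    qed
    ultimately have "energy (\<lambda>z. J z - U z) (pt r) \<le> 2 * (B / r ^ (M - 1)) + 2 * 0"
      by (rule LIMSEQ_le_const)
    then show "energy (\<lambda>z. J z - U z) (pt r) \<le> 2 * (C\<^sup>2 / aperture 0 ^ M) / r ^ (M - 1)"
      by (simp add: B_def)
  qed
qed

end

section \<open>Truncations of the formal solution\<close>

lemma norm_poly_le_low_order:
  fixes p :: "complex poly"
  assumes "\<And>i. i < K \<Longrightarrow> coeff p i = 0"
  obtains C where "C \<ge> 0" "\<And>X. norm X \<le> 1 \<Longrightarrow> norm (poly p X) \<le> C * norm X ^ K"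
proof (rule that[of "\<Sum>i\<le>degree p. norm (coeff p i)"])
  fix X :: complex assume X: "norm X \<le> 1"
  have "norm (poly p X) \<le> (\<Sum>i\<le>degree p. norm (coeff p i * X ^ i))"
    unfolding poly_altdef by (rule norm_sum)
  also have "\<dots> \<le> (\<Sum>i\<le>degree p. norm (coeff p i) * norm X ^ K)"
  proof (rule sum_mono)
    fix i
    show "norm (coeff p i * X ^ i) \<le> norm (coeff p i) * norm X ^ K"
    proof (cases "i < K")
      case False
      then have "norm X ^ i \<le> norm X ^ K" using X by (intro power_decreasing) auto
      then show ?thesis by (simp add: norm_mult norm_power mult_left_mono)
    qed (simp add: assms)
  qed
  finally show "norm (poly p X) \<le> (\<Sum>i\<le>degree p. norm (coeff p i)) * norm X ^ K"
    by (simp add: sum_distrib_right)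
qed (simp add: sum_nonneg)

declare norm_exp_eq_Re [simp del]

context bessel_data
begin

section \<open>Polynomials in 1/z times the prefactor\<close>

definition pref :: "ucover \<Rightarrow> complex" where
  "pref z = exp (mu * exp z) * exp (- ((of_nat n - 1) / 2) * z)"

lemma pref_nonzero [simp]: "pref z \<noteq> 0"
  by (simp add: pref_def)

lemma holomorphic_pref: "pref holomorphic_on S"
  unfolding pref_def[abs_def] by (intro holomorphic_intros)

lemma norm_pref: "norm (pref z) = norm (exp (mu * exp z)) * exp (- (real n - 1) / 2 * Re z)"
proof -
  have "norm (exp (- ((of_nat n - 1) / 2) * z)) = exp (- (real n - 1) / 2 * Re z)"
    unfolding norm_exp_eq_Re by (rule arg_cong[where f = exp]) (simp add: field_simps)
  then show ?thesis by (simp only: pref_def norm_mult)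
qed

lemma norm_exp_neg_le_1_iff: "norm (exp (- z)) \<le> 1 \<longleftrightarrow> Re z \<ge> 0"
  by (simp add: norm_exp_eq_Re)

lemma norm_pref_le:
  assumes "norm (exp (- z)) \<le> 1"
  shows "norm (pref z * exp (- mu * exp z)) \<le> 1"
proof -
  have "pref z * exp (- mu * exp z) = exp (- ((of_nat n - 1) / 2) * z)"
    by (simp add: pref_def exp_minus)
  moreover have "0 \<le> (real n - 1) * Re z"
    using assms n by (intro mult_nonneg_nonneg) (auto simp: norm_exp_neg_le_1_iff)
  ultimately show ?thesis by (simp add: norm_exp_eq_Re)
qed

text \<open>The power (n-1)/2 of |z| in the prefactor is replaced by the cruder natural power
  n.\<close>

lemma norm_pref_ge:
  assumes "norm (exp (- z)) \<le> 1"
  shows "norm (exp (mu * exp z)) * norm (exp (- z)) ^ n \<le> norm (pref z)"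
proof -
  have "norm (exp (- z)) ^ n = exp (- real n * Re z)" by (simp add: norm_exp_eq_Re flip: exp_of_nat_mult)
  moreover have "(real n - 1) / 2 * Re z \<le> real n * Re z" using assms by (intro mult_right_mono) (auto simp: norm_exp_neg_le_1_iff)
  then have "exp (- real n * Re z) \<le> exp (- (real n - 1) / 2 * Re z)" by (simp add: algebra_simps)
  ultimately show ?thesis unfolding norm_pref by (simp add: mult_left_mono)
qed

lemma U_deriv_pref:
  assumes "\<And>z. (g has_field_derivative g' z) (at z)"
  shows "U_deriv (\<lambda>z. pref z * g z) =
    (\<lambda>z. pref z * (mu * g z - (of_nat n - 1) / 2 * exp (- z) * g z + exp (- z) * g' z))"
proof -
  have "((\<lambda>z. exp (mu * exp z) * exp (- a * z)) has_field_derivative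
      exp (mu * exp z) * exp (- a * z) * (mu * exp z - a)) (at z)" for a z
    by (auto intro!: derivative_eq_intros simp: algebra_simps)
  then have "(pref has_field_derivative pref z * (mu * exp z - (of_nat n - 1) / 2)) (at z)" for z
    unfolding pref_def[abs_def] by blast
  then have "((\<lambda>z. pref z * g z) has_field_derivative
      pref z * (mu * exp z - (of_nat n - 1) / 2) * g z + g' z * pref z) (at z)" for z
    by (intro DERIV_mult assms)
  from U_derivI[OF this] show ?thesis
    by (simp add: fun_eq_iff exp_minus field_simps)
qed

definition evp :: "complex poly \<Rightarrow> ucover \<Rightarrow> complex" where
  "evp p z = pref z * poly p (exp (- z))"

text \<open>\<open>formal_deriv\<close> on polynomials, so that truncations can be treated both as
  functions and as formal series; \<open>pop\<close> does the same for
  \<open>formal_op\<close>.\<close>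

definition pder :: "complex poly \<Rightarrow> complex poly" where
  "pder p = [:mu:] * p + [:0, - (of_nat n - 1) / 2:] * p - [:0, 0, 1:] * pderiv p"

definition pop :: "complex poly \<Rightarrow> complex poly" where
  "pop p = (\<Sum>j\<le>n. [:bessel_V n j lam:] * monom 1 (n - j) * (pder ^^ j) p) - [:mu ^ n:] * p"

lemma holomorphic_evp: "evp p holomorphic_on S"
  unfolding evp_def[abs_def] by (intro holomorphic_intros holomorphic_pref poly_holomorphic_on)

lemma evp_diff: "evp (p - q) z = evp p z - evp q z"
  by (simp add: evp_def algebra_simps)

lemma U_deriv_evp: "U_deriv (evp p) = evp (pder p)"
proof -
  have "((\<lambda>z. poly p (exp (- z))) has_field_derivative poly (pderiv p) (exp (- z)) * (- exp (- z))) (at z)" for z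
    by (rule DERIV_chain2[OF poly_DERIV]) (auto intro!: derivative_eq_intros)
  from U_deriv_pref[OF this] show ?thesis
    unfolding evp_def[abs_def]
    by (simp add: pder_def fun_eq_iff algebra_simps add_divide_distrib diff_divide_distrib)
qed

lemma U_deriv_funpow_evp: "(U_deriv ^^ j) (evp p) = evp ((pder ^^ j) p)"
  by (induction j) (auto simp: U_deriv_evp)

lemma fps_of_poly_pder: "fps_of_poly (pder p) = formal_deriv n xi (fps_of_poly p)"
  by (simp add: pder_def formal_deriv_def fps_of_poly_simps fps_of_poly_pCons mu_def power2_eq_square mult_ac)

lemma fps_of_poly_pder_funpow: "fps_of_poly ((pder ^^ j) p) = (formal_deriv n xi ^^ j) (fps_of_poly p)"
  by (induction j) (auto simp: fps_of_poly_pder)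

lemma fps_of_poly_pop: "fps_of_poly (pop p) = formal_op n lam xi (fps_of_poly p)"
  by (simp add: pop_def formal_op_def fps_of_poly_diff fps_of_poly_sum fps_of_poly_mult fps_of_poly_const fps_of_poly_smult
      fps_of_poly_monom' fps_of_poly_pder_funpow mu_def mult.assoc)

lemma bessel_op_evp: "bessel_op n lam xi (evp p) z = evp (pop p) z"
  unfolding bessel_op_def U_deriv_funpow_evp
  by (simp add: evp_def pop_def poly_sum poly_monom sum_distrib_left mu_def algebra_simps)

lemma norm_evp_le:
  assumes "\<And>i. i < K \<Longrightarrow> coeff p i = 0"
  obtains C where "C \<ge> 0"
    "\<And>z. norm (exp (- z)) \<le> 1 \<Longrightarrow> norm (evp p z * exp (- mu * exp z)) \<le> C * norm (exp (- z)) ^ K"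
proof -
  obtain C where C: "C \<ge> 0" "\<And>X. norm X \<le> 1 \<Longrightarrow> norm (poly p X) \<le> C * norm X ^ K"
    using norm_poly_le_low_order[OF assms] by metis
  show ?thesis
  proof (rule that[OF C(1)])
    fix z :: complex assume z: "norm (exp (- z)) \<le> 1"
    have "norm (evp p z * exp (- mu * exp z)) = norm (pref z * exp (- mu * exp z)) * norm (poly p (exp (- z)))"
      unfolding evp_def norm_mult by simp
    also have "\<dots> \<le> 1 * (C * norm (exp (- z)) ^ K)"
      using norm_pref_le[OF z] C(2)[OF z] by (intro mult_mono) auto
    finally show "norm (evp p z * exp (- mu * exp z)) \<le> C * norm (exp (- z)) ^ K" by simp
  qed
qed

lemma energy_le_of_deriv_bounds:
  assumes "\<And>j. j < n \<Longrightarrow> norm ((U_deriv ^^ j) f z * exp (- mu * exp z)) \<le> K"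
  shows "energy f z \<le> real n * K\<^sup>2"
proof -
  have "norm (mode k f z * exp (- mu * exp z)) \<le> K" for k
  proof -
    have "norm (mode k f z * exp (- mu * exp z)) =
        norm (\<Sum>j<n. inverse (mus k) ^ j * ((U_deriv ^^ j) f z * exp (- mu * exp z))) / real n"
      by (simp add: mode_def sum_distrib_right norm_mult norm_divide mult.assoc flip: norm_mult)
    also have "\<dots> \<le> (\<Sum>j<n. 1 * K) / real n"
    proof (intro divide_right_mono sum_norm_le)
      fix j assume j: "j \<in> {..<n}"
      have "norm (inverse (mus k) ^ j) \<le> 1"
        using n by (simp add: norm_power norm_inverse norm_mus power_le_one inverse_le_1_iff)
      then show "norm (inverse (mus k) ^ j * ((U_deriv ^^ j) f z * exp (- mu * exp z))) \<le> 1 * K"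
        using assms[of j] j unfolding norm_mult[of "inverse (mus k) ^ j"] by (intro mult_mono) auto
    qed simp
    also have "\<dots> = K" using n by simp
    finally show ?thesis .
  qed
  then have "energy f z \<le> (\<Sum>k<n. K\<^sup>2)"
    unfolding energy_def by (intro sum_mono power_mono) auto
  then show ?thesis by simp
qed

text \<open>Formal differentiation does not lower the order in 1/z, so all derivatives inherit the
  order K; the energy is quadratic, hence \<open>2 * K\<close>.\<close>

lemma energy_evp_le:
  assumes "\<And>i. i < K \<Longrightarrow> coeff p i = 0"
  obtains C where "C \<ge> 0"
    "\<And>z. norm (exp (- z)) \<le> 1 \<Longrightarrow> energy (evp p) z \<le> C * norm (exp (- z)) ^ (2 * K)"
proof -
  have "\<exists>C\<ge>0. \<forall>z. norm (exp (- z)) \<le> 1 \<longrightarrow>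
      norm ((U_deriv ^^ j) (evp p) z * exp (- mu * exp z)) \<le> C * norm (exp (- z)) ^ K" for j
  proof -
    have "coeff ((pder ^^ j) p) i = 0" if "i < K" for i
      using formal_deriv_funpow_low[of K "fps_of_poly p" j n xi] assms that
      by (simp add: fps_of_poly_pder_funpow[symmetric])
    then show ?thesis unfolding U_deriv_funpow_evp by (metis norm_evp_le)
  qed
  then obtain c where c: "\<And>j. c j \<ge> 0" "\<And>j z. norm (exp (- z)) \<le> 1 \<Longrightarrow>
      norm ((U_deriv ^^ j) (evp p) z * exp (- mu * exp z)) \<le> c j * norm (exp (- z)) ^ K" by metis
  define C where "C = (\<Sum>j<n. c j)"
  have "energy (evp p) z \<le> real n * C\<^sup>2 * norm (exp (- z)) ^ (2 * K)" if z: "norm (exp (- z)) \<le> 1" for z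
  proof -
    have "energy (evp p) z \<le> real n * (C * norm (exp (- z)) ^ K)\<^sup>2"
    proof (rule energy_le_of_deriv_bounds)
      fix j assume "j < n"
      then have "c j \<le> C" unfolding C_def using c(1) by (intro member_le_sum) auto
      then show "norm ((U_deriv ^^ j) (evp p) z * exp (- mu * exp z)) \<le> C * norm (exp (- z)) ^ K"
        using c(2)[OF z, of j] by (meson mult_right_mono norm_ge_zero order_trans zero_le_power)
    qed
    then show ?thesis by (simp add: power_mult_distrib power_mult[symmetric] mult.commute[of K] mult.assoc)
  qed
  then show ?thesis by (intro that[of "real n * C\<^sup>2"]) auto
qed

definition trunc :: "nat \<Rightarrow> ucover \<Rightarrow> complex" where
  "trunc M = evp (truncate_fps M (formal_J n s lam xi))"

lemma holomorphic_trunc: "trunc M holomorphic_on S"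
  unfolding trunc_def by (rule holomorphic_evp)

text \<open>The operator annihilates the whole formal series, so on a truncation it gives minus its
  value on the tail, which begins at order M.\<close>

lemma bessel_op_trunc_le:
  obtains C where "\<And>z. norm (exp (- z)) \<le> 1 \<Longrightarrow>
      norm (bessel_op n lam xi (trunc M) z * exp (- mu * exp z)) \<le> C * norm (exp (- z)) ^ M"
proof -
  let ?b = "formal_J n s lam xi"
  have "coeff (pop (truncate_fps M ?b)) i = 0" if "i < M" for i
  proof -
    have "0 = formal_op n lam xi (fps_cutoff M ?b + (?b - fps_cutoff M ?b))"
      using formal_op_formal_J[OF _ sum_lam root] n by simp
    then have "0 = formal_op n lam xi (fps_cutoff M ?b) + formal_op n lam xi (?b - fps_cutoff M ?b)"
      unfolding formal_op_add .
    moreover have "fps_nth (formal_op n lam xi (?b - fps_cutoff M ?b)) i = 0"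
      using that n sum_lam by (intro formal_op_low(1)[where k = M]) auto
    ultimately have "fps_nth (formal_op n lam xi (fps_cutoff M ?b)) i = 0"
      by (metis add.right_neutral fps_add_nth fps_zero_nth)
    then show ?thesis by (simp flip: fps_of_poly_nth add: fps_of_poly_pop)
  qed
  from norm_evp_le[OF this] show ?thesis
    using that unfolding trunc_def bessel_op_evp by metis
qed

lemma energy_trunc_diff_le:
  assumes "K \<le> M" "K \<le> M'"
  obtains C where "C \<ge> 0" "\<And>z. norm (exp (- z)) \<le> 1 \<Longrightarrow>
      energy (\<lambda>z. trunc M z - trunc M' z) z \<le> C * norm (exp (- z)) ^ (2 * K)"
proof -
  let ?b = "formal_J n s lam xi"
  have "coeff (truncate_fps M ?b - truncate_fps M' ?b) i = 0" if "i < K" for i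
    using that assms by (simp add: coeff_truncate_fps)
  from energy_evp_le[OF this] show ?thesis
    using that unfolding trunc_def evp_diff[abs_def] by metis
qed

section \<open>Expansions expressed by the energy\<close>

definition solution :: "(ucover \<Rightarrow> complex) \<Rightarrow> bool" where
  "solution J \<longleftrightarrow> J holomorphic_on UNIV \<and> (\<forall>z. bessel_op n lam xi J z = 0)"

text \<open>The expansion to all orders in the form that can be transported along rays: uniform on S
  and with control of the derivatives up to order n-1.\<close>

definition asym :: "(ucover \<Rightarrow> complex) \<Rightarrow> ucover set \<Rightarrow> bool" where
  "asym J S \<longleftrightarrow> (\<forall>M. \<exists>C R. \<forall>z\<in>S. R \<le> norm (exp z) \<longrightarrow>
     energy (\<lambda>z. J z - trunc M z) z \<le> C * norm (exp (- z)) ^ M)"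

lemma norm_exp_uminus: "norm (exp (- z :: complex)) = 1 / norm (exp z)"
  by (simp add: exp_minus norm_inverse divide_inverse)

lemma norm_exp_uminus_le_1: "1 \<le> norm (exp (z :: complex)) \<Longrightarrow> norm (exp (- z)) \<le> 1"
  by (simp add: norm_exp_eq_Re)

lemma energy_trunc_change:
  assumes J: "J holomorphic_on UNIV"
  shows "energy (\<lambda>z. J z - trunc M z) z \<le>
    2 * energy (\<lambda>z. J z - trunc M' z) z + 2 * energy (\<lambda>z. trunc M z - trunc M' z) z"
proof -
  have "energy (\<lambda>z. J z - trunc M z) z = energy (\<lambda>z. (J z - trunc M' z) - (trunc M z - trunc M' z)) z"
    by simp
  also have "\<dots> \<le> 2 * energy (\<lambda>z. J z - trunc M' z) z + 2 * energy (\<lambda>z. trunc M z - trunc M' z) z"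
    by (intro energy_diff holomorphic_intros holomorphic_trunc J)
  finally show ?thesis .
qed

text \<open>A slightly weaker bound for late truncations is enough, because the terms between two
  truncations are small enough to be given away.\<close>

lemma asymI:
  assumes J: "J holomorphic_on UNIV"
    and bound: "\<And>M. M \<ge> M0 \<Longrightarrow> \<exists>C R. \<forall>z\<in>S. R \<le> norm (exp z) \<longrightarrow>
      energy (\<lambda>z. J z - trunc M z) z \<le> C * norm (exp (- z)) ^ (M - 1)"
  shows "asym J S"
  unfolding asym_def
proof
  fix M
  \<comment> \<open>\<open>M + 1\<close> compensates the exponent \<open>M - 1\<close> in the
    hypothesis.\<close>
  define M' where "M' = max M0 (M + 1)"
  have M': "M \<le> M" "M \<le> M'" by (auto simp: M'_def)
  obtain C R where C: "\<And>z. z \<in> S \<Longrightarrow> R \<le> norm (exp z) \<Longrightarrow>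
      energy (\<lambda>z. J z - trunc M' z) z \<le> C * norm (exp (- z)) ^ (M' - 1)"
    using bound[of M'] by (auto simp: M'_def)
  obtain C' where C': "C' \<ge> 0" "\<And>z. norm (exp (- z)) \<le> 1 \<Longrightarrow>
      energy (\<lambda>z. trunc M z - trunc M' z) z \<le> C' * norm (exp (- z)) ^ (2 * M)"
    using energy_trunc_diff_le[of M M M'] M' by blast
  show "\<exists>C R. \<forall>z\<in>S. R \<le> norm (exp z) \<longrightarrow> energy (\<lambda>z. J z - trunc M z) z \<le> C * norm (exp (- z)) ^ M"
  proof (rule exI[of _ "2 * \<bar>C\<bar> + 2 * C'"], rule exI[of _ "max 1 R"], intro ballI impI)
    fix z assume z: "z \<in> S" "max 1 R \<le> norm (exp z)"
    define x where "x = norm (exp (- z))"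
    have x: "0 \<le> x" "x \<le> 1" using norm_exp_uminus_le_1[of z] z(2) unfolding x_def by auto
    have "energy (\<lambda>z. J z - trunc M' z) z \<le> C * x ^ (M' - 1)"
      using C z by (simp add: x_def)
    also have "\<dots> \<le> \<bar>C\<bar> * x ^ M"
      using x by (intro mult_mono power_decreasing) (auto simp: M'_def)
    finally have 1: "energy (\<lambda>z. J z - trunc M' z) z \<le> \<bar>C\<bar> * x ^ M" .
    have "energy (\<lambda>z. trunc M z - trunc M' z) z \<le> C' * x ^ (2 * M)"
      using C'(2)[of z] x by (simp add: x_def)
    also have "\<dots> \<le> C' * x ^ M"
      using x C'(1) by (intro mult_left_mono power_decreasing) auto
    finally show "energy (\<lambda>z. J z - trunc M z) z \<le> (2 * \<bar>C\<bar> + 2 * C') * norm (exp (- z)) ^ M"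
      using 1 energy_trunc_change[OF J, of M z M'] by (simp add: x_def[symmetric] distrib_right)
  qed
qed

text \<open>The far end of the path tends to infinity, possibly with varying directions. Its
  contribution disappears in the limit, and only the residual of the truncation remains.\<close>

lemma energy_limit_bound:
  fixes d :: "real \<Rightarrow> complex" and t :: "real \<Rightarrow> real"
  assumes J: "solution J" and c: "0 \<le> c" "c < 1" and M: "M \<ge> rate c + 2"
    and op: "\<And>z. norm (exp (- z)) \<le> 1 \<Longrightarrow>
      norm (bessel_op n lam xi (trunc M) z * exp (- mu * exp z)) \<le> C * norm (exp (- z)) ^ M"
    and path: "\<forall>\<^sub>F y in at_top. admissible c z (d y) \<and> dominated (d y) \<and> 0 \<le> t y"
    and lim: "((\<lambda>y. energy (\<lambda>z. J z - trunc M z) (ray z (d y) (of_real (t y))) * (norm (exp z) + t y) ^ rate c) \<longlongrightarrow> 0) at_top"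
  shows "energy (\<lambda>z. J z - trunc M z) z \<le> C\<^sup>2 / aperture c ^ M * norm (exp (- z)) ^ (M - 1)"
proof -
  define r where "r = norm (exp z)"
  have r: "r > 0" by (simp add: r_def)
  define B where "B = C\<^sup>2 / aperture c ^ M"
  let ?E = "\<lambda>z. J z - trunc M z"
  have "energy ?E z * r ^ rate c \<le> 0 + B / r ^ (M - rate c - 1)"
  proof (rule tendsto_lowerbound)
    show "((\<lambda>y. energy ?E (ray z (d y) (of_real (t y))) * (r + t y) ^ rate c + B / r ^ (M - rate c - 1))
        \<longlongrightarrow> 0 + B / r ^ (M - rate c - 1)) at_top"
      using lim unfolding r_def by (intro tendsto_intros)
    show "\<forall>\<^sub>F y in at_top. energy ?E z * r ^ rate c \<le>
        energy ?E (ray z (d y) (of_real (t y))) * (r + t y) ^ rate c + B / r ^ (M - rate c - 1)"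
      using path
    proof eventually_elim
      case (elim y)
      show ?case unfolding r_def B_def
      proof (rule energy_apriori[OF _ _ M c])
        show "norm (bessel_op n lam xi ?E z * exp (- mu * exp z)) \<le> C * norm (exp (- z)) ^ M"
          if "norm (exp (- z)) \<le> 1" for z
          using op[OF that] J by (simp add: bessel_op_diff holomorphic_trunc solution_def)
        show "?E holomorphic_on UNIV"
          using J by (intro holomorphic_intros holomorphic_trunc) (simp add: solution_def)
      qed (use elim in auto)
    qed
  qed simp
  then have "energy ?E z \<le> B / (r ^ rate c * r ^ (M - rate c - 1))"
    using r by (simp add: field_simps)
  also have "r ^ rate c * r ^ (M - rate c - 1) = r ^ (M - 1)"
    using M by (simp flip: power_add)
  finally show ?thesis
    unfolding norm_exp_uminus by (simp add: r_def B_def power_divide)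
qed

text \<open>The resulting constant depends on c and M but not on the path, so the bound is uniform
  over the starting points although the paths vary with them.\<close>

lemma asym_extend:
  assumes J: "solution J" and S: "asym J S" and c: "0 \<le> c" "c < 1"
    and path: "\<And>z. z \<in> S' \<Longrightarrow> aperture c * norm (exp z) \<ge> 1 \<Longrightarrow>
      \<exists>(d :: real \<Rightarrow> complex) t. filterlim t at_top at_top \<and>
        (\<forall>\<^sub>F y in at_top. admissible c z (d y) \<and> dominated (d y) \<and> ray z (d y) (of_real (t y)) \<in> S)"
  shows "asym J S'"
proof (rule asymI[where ?M0.0 = "rate c + 2"])
  show "J holomorphic_on UNIV" using J by (simp add: solution_def)
  fix M assume M: "rate c + 2 \<le> M"
  obtain C where C: "\<And>z. norm (exp (- z)) \<le> 1 \<Longrightarrow>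
      norm (bessel_op n lam xi (trunc M) z * exp (- mu * exp z)) \<le> C * norm (exp (- z)) ^ M"
    using bessel_op_trunc_le by metis
  obtain D R where D: "\<And>z. z \<in> S \<Longrightarrow> R \<le> norm (exp z) \<Longrightarrow>
      energy (\<lambda>z. J z - trunc M z) z \<le> D * norm (exp (- z)) ^ M"
    using S unfolding asym_def by metis
  note ap = aperture_pos[OF c(2)]
  have "energy (\<lambda>z. J z - trunc M z) z \<le> C\<^sup>2 / aperture c ^ M * norm (exp (- z)) ^ (M - 1)"
    if z: "z \<in> S'" "1 / aperture c \<le> norm (exp z)" for z
  proof -
    have "aperture c * norm (exp z) \<ge> 1" using z(2) ap by (simp add: field_simps)
    then obtain d :: "real \<Rightarrow> complex" and t where t: "filterlim t at_top at_top" and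
      ev: "\<forall>\<^sub>F y in at_top. admissible c z (d y) \<and> dominated (d y) \<and> ray z (d y) (of_real (t y)) \<in> S"
      using path[OF z(1)] by blast
    define r where "r = norm (exp z)"
    have r: "r > 0" by (simp add: r_def)
    have rt: "filterlim (\<lambda>y. r + t y) at_top at_top"
      by (rule filterlim_tendsto_add_at_top[OF tendsto_const t])
    have ev2: "\<forall>\<^sub>F y in at_top. max 1 (R / aperture c) \<le> r + t y" "\<forall>\<^sub>F y in at_top. 0 \<le> t y"
      using rt t unfolding filterlim_at_top by blast+
    have lim: "((\<lambda>y. \<bar>D\<bar> / aperture c ^ M / (r + t y)) \<longlongrightarrow> 0) at_top"
      by (intro tendsto_divide_0[OF tendsto_const] filterlim_at_top_imp_at_infinity rt)
    show ?thesis
    proof (rule energy_limit_bound[OF J c M C])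
      show "\<forall>\<^sub>F y in at_top. admissible c z (d y) \<and> dominated (d y) \<and> 0 \<le> t y"
        using ev ev2(2) by eventually_elim auto
      show "((\<lambda>y. energy (\<lambda>z. J z - trunc M z) (ray z (d y) (of_real (t y))) * (norm (exp z) + t y) ^ rate c) \<longlongrightarrow> 0) at_top"
      proof (rule tendsto_sandwich[OF _ _ tendsto_const lim])
        show "\<forall>\<^sub>F y in at_top. 0 \<le> energy (\<lambda>z. J z - trunc M z) (ray z (d y) (of_real (t y))) * (norm (exp z) + t y) ^ rate c"
          using ev2 by eventually_elim (auto intro!: mult_nonneg_nonneg energy_nonneg)
        show "\<forall>\<^sub>F y in at_top. energy (\<lambda>z. J z - trunc M z) (ray z (d y) (of_real (t y))) * (norm (exp z) + t y) ^ rate c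
            \<le> \<bar>D\<bar> / aperture c ^ M / (r + t y)"
          using ev ev2
        proof eventually_elim
          case (elim y)
          let ?z = "ray z (d y) (of_real (t y))"
          define u where "u = r + t y"
          have u: "u \<ge> 1" "R \<le> aperture c * u" using elim ap by (auto simp: u_def divide_le_eq mult.commute)
          have a: "aperture c * u \<le> norm (exp ?z)"
            using admissible_ray[of c z "d y" "t y"] elim c by (simp add: u_def r_def)
          have au: "aperture c * u > 0" using ap u by simp
          have x: "norm (exp (- ?z)) \<le> 1 / (aperture c * u)"
            unfolding norm_exp_uminus by (rule divide_left_mono[OF a _ mult_pos_pos[OF _ au]]) auto
          have "energy (\<lambda>z. J z - trunc M z) ?z \<le> D * norm (exp (- ?z)) ^ M"
            using elim u a by (intro D) auto
          also have "\<dots> \<le> \<bar>D\<bar> * (1 / (aperture c * u)) ^ M"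
            using x by (intro mult_mono power_mono) auto
          also have "\<dots> = \<bar>D\<bar> / aperture c ^ M / u ^ M" by (simp add: power_divide power_mult_distrib)
          finally have "energy (\<lambda>z. J z - trunc M z) ?z * u ^ rate c \<le> \<bar>D\<bar> / aperture c ^ M / u ^ M * u ^ rate c"
            using u by (intro mult_right_mono) auto
          also have "u ^ M = u ^ (M - rate c) * u ^ rate c" using M by (simp flip: power_add)
          then have "\<bar>D\<bar> / aperture c ^ M / u ^ M * u ^ rate c = \<bar>D\<bar> / aperture c ^ M / u ^ (M - rate c)"
            using u by simp
          \<comment> \<open>As \<open>M - rate c\<close> is at least 1, the decay known on S beats
            the loss of the power \<open>rate c\<close>.\<close>
          also have "\<dots> \<le> \<bar>D\<bar> / aperture c ^ M / u ^ 1"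
            using u M ap by (intro divide_left_mono power_increasing) auto
          finally show ?case by (simp add: u_def r_def)
        qed
      qed
    qed
  qed
  then show "\<exists>C R. \<forall>z\<in>S'. R \<le> norm (exp z) \<longrightarrow>
      energy (\<lambda>z. J z - trunc M z) z \<le> C * norm (exp (- z)) ^ (M - 1)" by blast
qed

text \<open>J is built from the single truncation M1. For any other order M the inward estimate is
  applied to \<open>J - trunc M\<close>; near infinity \<open>trunc M\<close> may be exchanged for
  \<open>trunc M1\<close>, since their difference decays fast enough to beat the loss
  \<open>u ^ rate 0\<close>.\<close>

lemma asym_axis_exists: "\<exists>J. solution J \<and> asym J {z. Im z = alpha}"
proof -
  define M1 where "M1 = rate 0 + 3"
  have M1: "rate 0 + 2 \<le> M1" by (simp add: M1_def)
  obtain C where C: "\<And>z. norm (exp (- z)) \<le> 1 \<Longrightarrow>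
      norm (bessel_op n lam xi (trunc M1) z * exp (- mu * exp z)) \<le> C * norm (exp (- z)) ^ M1"
    using bessel_op_trunc_le by metis
  define B where "B = 2 * (C\<^sup>2 / aperture 0 ^ M1)"
  obtain J where J: "J holomorphic_on UNIV" "\<And>z. bessel_op n lam xi J z = 0"
    and JB: "\<And>r. r \<ge> 2 \<Longrightarrow> energy (\<lambda>z. J z - trunc M1 z) (pt r) \<le> B / r ^ (M1 - 1)"
    using solution_exists[OF holomorphic_trunc C M1] unfolding B_def by blast
  have sol: "solution J" using J by (simp add: solution_def)
  have B: "B \<ge> 0" using aperture_pos[of 0] by (simp add: B_def)
  have "asym J {z. Im z = alpha}"
  proof (rule asymI[where ?M0.0 = "rate 0 + 2"])
    fix M assume M: "rate 0 + 2 \<le> M"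
    obtain K where K: "\<And>z. norm (exp (- z)) \<le> 1 \<Longrightarrow>
        norm (bessel_op n lam xi (trunc M) z * exp (- mu * exp z)) \<le> K * norm (exp (- z)) ^ M"
      using bessel_op_trunc_le by metis
    obtain C' where C': "C' \<ge> 0" "\<And>z. norm (exp (- z)) \<le> 1 \<Longrightarrow>
        energy (\<lambda>z. trunc M z - trunc M1 z) z \<le> C' * norm (exp (- z)) ^ (2 * (rate 0 + 2))"
      using energy_trunc_diff_le[of "rate 0 + 2" M M1] M M1 by blast
    have far: "energy (\<lambda>z. J z - trunc M z) (pt u) * u ^ rate 0 \<le> (2 * B + 2 * C') / u" if u: "u \<ge> 2" for u
    proof -
      have x: "norm (exp (- pt u)) = 1 / u" unfolding norm_exp_uminus using norm_exp_pt[of u] u by simp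
      have "energy (\<lambda>z. J z - trunc M1 z) (pt u) \<le> B / u ^ (M1 - 1)" by (rule JB[OF u])
      also have "\<dots> \<le> B / u ^ (rate 0 + 1)"
        using u B by (intro divide_left_mono power_increasing) (auto simp: M1_def)
      finally have 1: "energy (\<lambda>z. J z - trunc M1 z) (pt u) \<le> B / u ^ (rate 0 + 1)" .
      have "energy (\<lambda>z. trunc M z - trunc M1 z) (pt u) \<le> C' * norm (exp (- pt u)) ^ (2 * (rate 0 + 2))"
        using u by (intro C') (simp add: x)
      also have "\<dots> = C' / u ^ (2 * (rate 0 + 2))"
        unfolding x by (simp add: power_divide)
      also have "\<dots> \<le> C' / u ^ (rate 0 + 1)"
        using u C' by (intro divide_left_mono power_increasing) auto
      finally have "energy (\<lambda>z. J z - trunc M z) (pt u) \<le> 2 * (B / u ^ (rate 0 + 1)) + 2 * (C' / u ^ (rate 0 + 1))"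
        using 1 energy_trunc_change[OF J(1), of M "pt u" M1] by linarith
      also have "\<dots> = (2 * B + 2 * C') / u / u ^ rate 0"
        by (simp add: add_divide_distrib mult.commute)
      finally have "energy (\<lambda>z. J z - trunc M z) (pt u) \<le> (2 * B + 2 * C') / u / u ^ rate 0" .
      moreover have "u ^ rate 0 > 0" using u by simp
      ultimately show ?thesis by (simp only: pos_le_divide_eq)
    qed
    have "energy (\<lambda>z. J z - trunc M z) z \<le> K\<^sup>2 / aperture 0 ^ M * norm (exp (- z)) ^ (M - 1)"
      if z: "Im z = alpha" "2 \<le> norm (exp z)" for z
    proof -
      define r where "r = norm (exp z)"
      have r: "r \<ge> 2" using z(2) by (simp add: r_def)
      have pt: "z = pt r" using z by (simp add: pt_def r_def complex_eq_iff norm_exp_eq_Re)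
      show ?thesis
      proof (rule energy_limit_bound[where c = 0 and d = "\<lambda>_. cis alpha" and t = "\<lambda>y. y", OF sol _ _ M K])
        show "\<forall>\<^sub>F y in at_top. admissible 0 z (cis alpha) \<and> dominated (cis alpha) \<and> 0 \<le> (y :: real)"
          using admissible_pt[OF r] dominated_alpha eventually_ge_at_top[of 0] by (simp add: pt)
        have ev: "\<forall>\<^sub>F y in at_top. 0 \<le> (y :: real)" by (rule eventually_ge_at_top)
        have lim: "((\<lambda>y. (2 * B + 2 * C') / (r + y)) \<longlongrightarrow> 0) at_top"
          by (intro tendsto_divide_0[OF tendsto_const] filterlim_at_top_imp_at_infinity
            filterlim_tendsto_add_at_top[OF tendsto_const] filterlim_ident)
        show "((\<lambda>y. energy (\<lambda>z. J z - trunc M z) (ray z (cis alpha) (of_real y)) * (norm (exp z) + y) ^ rate 0) \<longlongrightarrow> 0) at_top"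
        proof (rule tendsto_sandwich[OF _ _ tendsto_const lim])
          show "\<forall>\<^sub>F y in at_top. 0 \<le> energy (\<lambda>z. J z - trunc M z) (ray z (cis alpha) (of_real y)) * (norm (exp z) + y) ^ rate 0"
            using ev by eventually_elim (auto intro!: mult_nonneg_nonneg energy_nonneg)
          show "\<forall>\<^sub>F y in at_top. energy (\<lambda>z. J z - trunc M z) (ray z (cis alpha) (of_real y)) * (norm (exp z) + y) ^ rate 0
              \<le> (2 * B + 2 * C') / (r + y)"
            using ev
          proof eventually_elim
            case (elim y)
            then show ?case
              using far[of "r + y"] ray_pt[of r y] norm_exp_pt[of r] r by (simp add: pt)
          qed
        qed
      qed auto
    qed
    then show "\<exists>C R. \<forall>z\<in>{z. Im z = alpha}. R \<le> norm (exp z) \<longrightarrow>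
        energy (\<lambda>z. J z - trunc M z) z \<le> C * norm (exp (- z)) ^ (M - 1)" by blast
  qed (rule J)
  with sol show ?thesis by blast
qed

end

section \<open>Sectors and expansions\<close>

context bessel_data
begin

text \<open>c is chosen as the midpoint of cos delta and 1: below 1, so that the aperture is
  positive, and above cos delta, so that a direction can still be perturbed.\<close>

lemma aperture_angle:
  fixes \<delta> :: real
  assumes "0 < \<delta>" "\<delta> < pi"
  shows "0 \<le> (1 + cos \<delta>) / 2" "(1 + cos \<delta>) / 2 < 1" "cos \<delta> < (1 + cos \<delta>) / 2"
proof -
  have "cos \<delta> < cos 0" using assms by (intro cos_monotone_0_pi) auto
  then show "(1 + cos \<delta>) / 2 < 1" "cos \<delta> < (1 + cos \<delta>) / 2" by auto
  have "0 \<le> (1 + x) / 2" if "- 1 \<le> x" for x :: real using that by simp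
  from this[OF cos_ge_minus_one] show "0 \<le> (1 + cos \<delta>) / 2" .
qed

lemma Re_cnj_exp_cis: "Re (cnj (exp z) * cis \<beta>) = norm (exp z) * cos (Im z - \<beta>)"
  by (simp add: norm_exp_eq_Re Re_exp Im_exp cos_diff algebra_simps)

lemma cos_ge_of_abs_le:
  assumes "0 < \<delta>" "\<bar>x\<bar> \<le> pi - \<delta>"
  shows "cos x \<ge> - cos \<delta>"
proof -
  have "cos (pi - \<delta>) \<le> cos \<bar>x\<bar>"
    using assms by (intro cos_monotone_0_pi_le) auto
  then show ?thesis by simp
qed

text \<open>The segments from a fixed point to the far points of the axis have directions tending to that
  of the axis, and the strict inequalities survive.\<close>

lemma asym_strip:
  assumes J: "solution J" "asym J {z. Im z = alpha}" and \<delta>: "0 < \<delta>" "\<delta> < pi"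
  shows "asym J {z. \<bar>Im z - alpha\<bar> \<le> pi - \<delta>}"
proof (rule asym_extend[OF J aperture_angle(1,2)[OF \<delta>]])
  fix z assume z: "z \<in> {z. \<bar>Im z - alpha\<bar> \<le> pi - \<delta>}"
    and ap: "1 \<le> aperture ((1 + cos \<delta>) / 2) * norm (exp z)"
  define c where "c = (1 + cos \<delta>) / 2"
  define v where "v y = of_real y * cis alpha - exp z" for y :: real
  define t where "t y = norm (v y)" for y
  define d where "d y = v y / of_real (t y)" for y
  have "filterlim (\<lambda>y :: real. of_real y * cis alpha) at_infinity at_top"
    unfolding filterlim_at_infinity_conv_norm_at_top by (simp add: norm_mult filterlim_abs_real)
  then have "filterlim v at_infinity at_top"
    unfolding v_def diff_conv_add_uminus
    by (subst add.commute, intro tendsto_add_filterlim_at_infinity[OF tendsto_const])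
  then have t: "filterlim t at_top at_top"
    unfolding t_def using filterlim_at_infinity_imp_norm_at_top by blast
  have t_pos: "\<forall>\<^sub>F y in at_top. t y > 0"
    using t by (simp add: filterlim_at_top_dense)
  have lim1: "((\<lambda>y. exp z / of_real y) \<longlongrightarrow> 0) at_top"
    by (intro tendsto_divide_0[OF tendsto_const] filterlim_of_real_at_infinity)
  have "((\<lambda>y. cis alpha - exp z / of_real y) \<longlongrightarrow> cis alpha - 0) at_top"
    by (intro tendsto_intros lim1)
  then have lim2: "((\<lambda>y. sgn (cis alpha - exp z / of_real y)) \<longlongrightarrow> sgn (cis alpha)) at_top"
    by (intro tendsto_sgn) auto
  have "\<forall>\<^sub>F y in at_top. sgn (cis alpha - exp z / of_real y) = d y"
    using eventually_gt_at_top[of 0]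
  proof eventually_elim
    case (elim y)
    then have "v y = of_real y * (cis alpha - exp z / of_real y)" by (simp add: v_def field_simps)
    then have "sgn (v y) = sgn (of_real y) * sgn (cis alpha - exp z / of_real y)" by (simp add: sgn_mult)
    then show ?case using elim by (simp add: d_def t_def sgn_eq sgn_of_real)
  qed
  with lim2 have d: "(d \<longlongrightarrow> cis alpha) at_top"
    using Lim_transform_eventually by (fastforce simp: sgn_eq)
  have cond1: "\<forall>\<^sub>F y in at_top. - c * norm (exp z) < Re (cnj (exp z) * d y)"
  proof (rule order_tendstoD(1))
    show "((\<lambda>y. Re (cnj (exp z) * d y)) \<longlongrightarrow> Re (cnj (exp z) * cis alpha)) at_top"
      by (intro tendsto_intros d)
    have "- c < cos (Im z - alpha)"
      using cos_ge_of_abs_le[OF \<delta>(1) z[unfolded mem_Collect_eq]] aperture_angle(3)[OF \<delta>] unfolding c_def by linarith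
    then have "- c * norm (exp z) < cos (Im z - alpha) * norm (exp z)"
      by (intro mult_strict_right_mono) auto
    then show "- c * norm (exp z) < Re (cnj (exp z) * cis alpha)"
      unfolding Re_cnj_exp_cis by (simp only: mult.commute)
  qed
  have "\<forall>\<^sub>F y in at_top. Re ((mus k - mu) * d y) \<ge> 0" if "k < n" for k
  proof (cases "k = 0")
    case True
    then show ?thesis by (simp add: mus_def)
  next
    case False
    have "((\<lambda>y. Re ((mus k - mu) * d y)) \<longlongrightarrow> Re ((mus k - mu) * cis alpha)) at_top"
      by (intro tendsto_intros d)
    from order_tendstoD(1)[OF this Re_mus_diff_pos[OF that False]] show ?thesis
      by eventually_elim simp
  qed
  then have "\<forall>\<^sub>F y in at_top. \<forall>k\<in>{..<n}. Re ((mus k - mu) * d y) \<ge> 0"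
    by (intro eventually_ball_finite) auto
  then have cond2: "\<forall>\<^sub>F y in at_top. dominated (d y)"
    unfolding dominated_def Ball_def lessThan_iff .
  have "\<forall>\<^sub>F y in at_top. admissible c z (d y) \<and> dominated (d y) \<and> ray z (d y) (of_real (t y)) \<in> {z. Im z = alpha}"
    using cond1 cond2 t_pos eventually_gt_at_top[of 0]
  proof eventually_elim
    case (elim y)
    have adm: "admissible c z (d y)"
      using elim ap by (simp add: admissible_def d_def t_def norm_divide c_def)
    let ?w = "ray z (d y) (of_real (t y))"
    have "exp ?w = of_real y * cis alpha"
      using admissible_ray(3)[OF adm aperture_angle(1,2)[OF \<delta>, folded c_def], of "t y"] elim
      by (simp add: d_def v_def)
    then have "exp ?w = exp (pt y)" using exp_pt elim by simp
    then obtain m :: int where m: "?w = pt y + of_int (2 * m) * of_real pi * \<i>" by (auto simp: exp_eq)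
    \<comment> \<open>The endpoint lies over \<open>pt y\<close>. It is on the right sheet because
      the path turns by at most pi and starts less than pi away from the axis, so a discrepancy of 2
      pi is impossible.\<close>
    have "\<bar>Im (Ln (1 + of_real (t y) * d y * exp (- z)))\<bar> \<le> pi"
      using mpi_less_Im_Ln[of "1 + of_real (t y) * d y * exp (- z)"] Im_Ln_le_pi[of "1 + of_real (t y) * d y * exp (- z)"]
        admissible_ray(4)[OF adm aperture_angle(1,2)[OF \<delta>, folded c_def], of "t y"] elim
      by (cases "1 + of_real (t y) * d y * exp (- z) = 0") auto
    then have "\<bar>Im ?w - alpha\<bar> < 2 * pi"
      using z \<delta> by (simp add: ray_def)
    moreover have "Im ?w - alpha = 2 * pi * of_int m" unfolding m by (simp add: pt_def)
    ultimately have "\<bar>2 * pi * real_of_int m\<bar> < 2 * pi * 1" by simp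
    then have "\<bar>real_of_int m\<bar> < 1" by (simp add: abs_mult)
    then have "m = 0" by linarith
    then have "Im ?w = alpha" using m by (simp add: pt_def)
    with adm elim show ?case by simp
  qed
  with t show "\<exists>(d :: real \<Rightarrow> complex) t. filterlim t at_top at_top \<and>
      (\<forall>\<^sub>F y in at_top. admissible ((1 + cos \<delta>) / 2) z (d y) \<and> dominated (d y)
        \<and> ray z (d y) (of_real (t y)) \<in> {z. Im z = alpha})"
    unfolding c_def by blast
qed

text \<open>A ray turns towards its own direction alpha + phi and so ends up in the strip, because
  |phi| <= pi/n <= pi/2 < 3 pi/4. The direction is kept fixed, so dominance with ties suffices and
  the extreme values of phi are allowed.\<close>

lemma asym_rotate:
  assumes J: "solution J" "asym J {z. \<bar>Im z - alpha\<bar> \<le> 3 * pi / 4}"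
    and \<delta>: "0 < \<delta>" "\<delta> < pi" and \<phi>: "\<bar>\<phi>\<bar> \<le> pi / real n"
  shows "asym J {z. \<bar>Im z - (alpha + \<phi>)\<bar> \<le> pi - \<delta>}"
proof (rule asym_extend[OF J aperture_angle(1,2)[OF \<delta>]])
  fix z assume z: "z \<in> {z. \<bar>Im z - (alpha + \<phi>)\<bar> \<le> pi - \<delta>}"
    and ap: "1 \<le> aperture ((1 + cos \<delta>) / 2) * norm (exp z)"
  define c where "c = (1 + cos \<delta>) / 2"
  define d where "d = cis (alpha + \<phi>)"
  have "- c \<le> cos (Im z - (alpha + \<phi>))"
    using cos_ge_of_abs_le[OF \<delta>(1) z[unfolded mem_Collect_eq]] aperture_angle(3)[OF \<delta>] unfolding c_def by linarith
  then have "- c * norm (exp z) \<le> cos (Im z - (alpha + \<phi>)) * norm (exp z)"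
    by (intro mult_right_mono) auto
  then have adm: "admissible c z d"
    using ap unfolding admissible_def d_def Re_cnj_exp_cis by (simp add: c_def mult.commute)
  have dom: "dominated d" unfolding d_def by (rule dominated_cis[OF \<phi>])
  define u where "u = d * exp (- z)"
  \<comment> \<open>The angle from z to the direction of the ray. Dividing by y inside the logarithm
    will show that the ray turns by this angle in the limit.\<close>
  define \<beta> where "\<beta> = alpha + \<phi> - Im z"
  have \<beta>: "- pi < \<beta>" "\<beta> < pi" using z \<delta> by (auto simp: \<beta>_def abs_le_iff)
  have u: "u = of_real (exp (- Re z)) * cis \<beta>"
    unfolding u_def d_def \<beta>_def exp_eq_polar[of "- z"] by (simp add: cis_mult mult_ac exp_of_real)
  have u_cut: "u \<notin> \<real>\<^sub>\<le>\<^sub>0"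
  proof
    assume "u \<in> \<real>\<^sub>\<le>\<^sub>0"
    then have "Re u \<le> 0" "Im u = 0" by (auto simp: complex_nonpos_Reals_iff)
    then have "cos \<beta> \<le> 0" "sin \<beta> = 0" unfolding u by (auto simp: mult_le_0_iff)
    then have "\<beta> = 0" using \<beta> sin_eq_0_pi by blast
    with \<open>cos \<beta> \<le> 0\<close> show False by simp
  qed
  have Ln_u: "Im (Ln u) = \<beta>"
  proof -
    have "u = exp (Complex (- Re z) \<beta>)" unfolding u by (simp add: exp_eq_polar exp_of_real)
    then have "Ln u = Complex (- Re z) \<beta>" using \<beta> by (simp add: Ln_exp)
    then show ?thesis by simp
  qed
  have "((\<lambda>y :: real. of_real (inverse y) + u) \<longlongrightarrow> of_real 0 + u) at_top"
    by (intro tendsto_intros tendsto_inverse_0_at_top filterlim_ident)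
  then have "((\<lambda>y :: real. of_real (inverse y) + u) \<longlongrightarrow> u) at_top" by simp
  then have "((\<lambda>y :: real. Im (Ln (of_real (inverse y) + u))) \<longlongrightarrow> Im (Ln u)) at_top"
    using u_cut by (intro tendsto_intros) auto
  then have "((\<lambda>y :: real. Im z + Im (Ln (of_real (inverse y) + u)) - alpha) \<longlongrightarrow> Im z + \<beta> - alpha) at_top"
    unfolding Ln_u by (intro tendsto_intros)
  then have lim: "((\<lambda>y :: real. Im z + Im (Ln (of_real (inverse y) + u)) - alpha) \<longlongrightarrow> \<phi>) at_top"
    by (simp add: \<beta>_def)
  have "pi / real n \<le> pi / 2" using n by (intro divide_left_mono) auto
  then have \<phi>_bounds: "\<phi> < 3 * pi / 4" "- (3 * pi / 4) < \<phi>" using \<phi> pi_gt_zero by linarith+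
  have "\<forall>\<^sub>F y :: real in at_top. admissible c z d \<and> dominated d \<and> ray z d (of_real y) \<in> {z. \<bar>Im z - alpha\<bar> \<le> 3 * pi / 4}"
    using order_tendstoD(1)[OF lim \<phi>_bounds(2)] order_tendstoD(2)[OF lim \<phi>_bounds(1)] eventually_gt_at_top[of 0]
  proof eventually_elim
    case (elim y)
    have "1 + of_real y * u \<noteq> 0"
      using admissible_ray(4)[OF adm aperture_angle(1,2)[OF \<delta>, folded c_def], of y] elim
      by (auto simp: u_def mult.assoc)
    moreover have "of_real y * (of_real (inverse y) + u) = 1 + of_real y * u"
      using elim by (simp add: distrib_left)
    ultimately have nz: "of_real (inverse y) + u \<noteq> 0" by auto
    have "Ln (1 + of_real y * u) = Ln (of_real y * (of_real (inverse y) + u))"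
      using elim by (simp add: distrib_left)
    also have "\<dots> = of_real (ln y) + Ln (of_real (inverse y) + u)"
      using elim nz by (simp add: Ln_times_of_real Ln_of_real)
    finally have "Im (ray z d (of_real y)) = Im z + Im (Ln (of_real (inverse y) + u))"
      by (simp add: ray_def u_def mult.assoc)
    then have "\<bar>Im (ray z d (of_real y)) - alpha\<bar> \<le> 3 * pi / 4" using elim by linarith
    then show ?case using adm dom by simp
  qed
  then show "\<exists>(d :: real \<Rightarrow> complex) t. filterlim t at_top at_top \<and>
      (\<forall>\<^sub>F y in at_top. admissible ((1 + cos \<delta>) / 2) z (d y) \<and> dominated (d y)
        \<and> ray z (d y) (of_real (t y)) \<in> {z. \<bar>Im z - alpha\<bar> \<le> 3 * pi / 4})"
    unfolding c_def by (intro exI[of _ "\<lambda>_. d"] exI[of _ "\<lambda>y. y"]) (simp add: filterlim_ident)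
qed

lemma asym_union:
  assumes "asym J S" "asym J S'" "T \<subseteq> S \<union> S'"
  shows "asym J T"
  unfolding asym_def
proof
  fix M
  obtain C R where C: "\<And>z. z \<in> S \<Longrightarrow> R \<le> norm (exp z) \<Longrightarrow>
      energy (\<lambda>z. J z - trunc M z) z \<le> C * norm (exp (- z)) ^ M"
    using assms(1) unfolding asym_def by metis
  obtain C' R' where C': "\<And>z. z \<in> S' \<Longrightarrow> R' \<le> norm (exp z) \<Longrightarrow>
      energy (\<lambda>z. J z - trunc M z) z \<le> C' * norm (exp (- z)) ^ M"
    using assms(2) unfolding asym_def by metis
  have "energy (\<lambda>z. J z - trunc M z) z \<le> max C C' * norm (exp (- z)) ^ M"
    if z: "z \<in> T" "max R R' \<le> norm (exp z)" for z
  proof -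
    have "energy (\<lambda>z. J z - trunc M z) z \<le> C * norm (exp (- z)) ^ M
        \<or> energy (\<lambda>z. J z - trunc M z) z \<le> C' * norm (exp (- z)) ^ M"
      using C[of z] C'[of z] assms(3) z by auto
    moreover have "C * norm (exp (- z)) ^ M \<le> max C C' * norm (exp (- z)) ^ M"
      "C' * norm (exp (- z)) ^ M \<le> max C C' * norm (exp (- z)) ^ M"
      by (intro mult_right_mono; simp)+
    ultimately show ?thesis by linarith
  qed
  then show "\<exists>C R. \<forall>z\<in>T. R \<le> norm (exp z) \<longrightarrow>
      energy (\<lambda>z. J z - trunc M z) z \<le> C * norm (exp (- z)) ^ M" by blast
qed

text \<open>The regions around alpha + pi/n and alpha - pi/n, each of half-opening pi - theta, cover
  the sector. They leave no gap since pi/n <= pi/2 < pi - theta.\<close>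

lemma asym_sector_exists:
  assumes \<theta>: "0 < \<theta>" "\<theta> < pi / 2"
  shows "\<exists>J. solution J \<and> asym J (sector_at xi (pi + pi / real n - \<theta>))"
proof -
  obtain J where J: "solution J" "asym J {z. Im z = alpha}" using asym_axis_exists by blast
  have "asym J {z. \<bar>Im z - alpha\<bar> \<le> pi - pi / 4}"
    using J by (intro asym_strip) auto
  then have strip: "asym J {z. \<bar>Im z - alpha\<bar> \<le> 3 * pi / 4}" by simp
  have "pi / real n \<le> pi / 2" using n by (intro divide_left_mono) auto
  moreover have "pi / real n > 0" using n by simp
  ultimately have "sector_at xi (pi + pi / real n - \<theta>) \<subseteq>
      {z. \<bar>Im z - (alpha + pi / real n)\<bar> \<le> pi - \<theta>} \<union> {z. \<bar>Im z - (alpha + - (pi / real n))\<bar> \<le> pi - \<theta>}"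
    using \<theta> by (auto simp: sector_at_def U_arg_def alpha_def abs_le_iff abs_less_iff)
  moreover have "asym J {z. \<bar>Im z - (alpha + pi / real n)\<bar> \<le> pi - \<theta>}"
    "asym J {z. \<bar>Im z - (alpha + - (pi / real n))\<bar> \<le> pi - \<theta>}"
    using \<theta> pi_gt_zero by (intro asym_rotate J strip; simp)+
  ultimately show ?thesis using J(1) asym_union by blast
qed

section \<open>Energy bounds and asymptotic expansions\<close>

definition expansion_bound :: "complex fps \<Rightarrow> (ucover \<Rightarrow> complex) \<Rightarrow> real \<Rightarrow> real \<Rightarrow> nat \<Rightarrow> real \<Rightarrow> real \<Rightarrow> bool" where
  "expansion_bound b f a e M C R \<longleftrightarrow> (\<forall>z. a \<le> Im z \<and> Im z \<le> e \<and> R \<le> norm (exp z) \<longrightarrow>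
     norm (f z - evp (truncate_fps M b) z) \<le> C * norm (pref z) * norm (exp (- z)) ^ M)"

lemma poly_truncate_fps:
  fixes b :: "complex fps"
  shows "poly (truncate_fps M b) x = (\<Sum>m<M. fps_nth b m * x ^ m)"
proof -
  have "truncate_fps M b = (\<Sum>m<M. monom (fps_nth b m) m)"
    by (rule poly_eqI) (auto simp: coeff_truncate_fps coeff_sum sum.delta' if_distrib cong: if_cong)
  then show ?thesis by (simp add: poly_sum poly_monom)
qed

text \<open>The error function E may be taken as the remainder divided by the prefactor, which has
  no zeros.\<close>

lemma has_expansion_on_iff:
  "has_expansion_on n xi f b S \<longleftrightarrow>
    (\<forall>M a e. {z. a \<le> Im z \<and> Im z \<le> e} \<subseteq> S \<longrightarrow> (\<exists>C R. expansion_bound b f a e M C R))"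
proof -
  have pref: "exp (\<i> * of_nat n * U_proj xi * U_proj z) * U_powr z (- (of_nat n - 1) / 2) = pref z" for z
    by (simp only: pref_def mu_def U_proj_def U_powr_def minus_divide_left)
  have sum: "(\<Sum>m<M. fps_nth b m * U_powr z (- of_nat m)) = poly (truncate_fps M b) (exp (- z))" for M z
    unfolding poly_truncate_fps U_powr_def by (simp flip: exp_of_nat_mult)
  have pow: "norm (exp z) powr (- real M) = norm (exp (- z)) ^ M" for M and z :: complex
    by (simp add: norm_exp_eq_Re powr_def flip: exp_of_nat_mult)
  have abs: "U_abs z = norm (exp z)" for z by (simp add: U_abs_def norm_exp_eq_Re)
  have swap: "(\<exists>E C R. P E C R) \<longleftrightarrow> (\<exists>C R E. P E C R)" for P :: "(ucover \<Rightarrow> complex) \<Rightarrow> real \<Rightarrow> real \<Rightarrow> bool"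
    by blast
  have iff: "(\<exists>E. \<forall>z. a \<le> Im z \<and> Im z \<le> e \<and> norm (exp z) \<ge> R \<longrightarrow>
         f z = pref z * (poly (truncate_fps M b) (exp (- z)) + E z) \<and> norm (E z) \<le> C * norm (exp (- z)) ^ M)
      \<longleftrightarrow> expansion_bound b f a e M C R" for M a e C R
  proof
    assume "\<exists>E. \<forall>z. a \<le> Im z \<and> Im z \<le> e \<and> norm (exp z) \<ge> R \<longrightarrow>
         f z = pref z * (poly (truncate_fps M b) (exp (- z)) + E z) \<and> norm (E z) \<le> C * norm (exp (- z)) ^ M"
    then obtain E where E: "\<And>z. a \<le> Im z \<Longrightarrow> Im z \<le> e \<Longrightarrow> R \<le> norm (exp z) \<Longrightarrow>
         f z = pref z * (poly (truncate_fps M b) (exp (- z)) + E z) \<and> norm (E z) \<le> C * norm (exp (- z)) ^ M" by metis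
    show "expansion_bound b f a e M C R" unfolding expansion_bound_def
    proof (intro allI impI)
      fix z assume z: "a \<le> Im z \<and> Im z \<le> e \<and> R \<le> norm (exp z)"
      have "f z - evp (truncate_fps M b) z = pref z * E z"
        using E[of z] z by (simp add: evp_def distrib_left)
      moreover have "norm (pref z) * norm (E z) \<le> norm (pref z) * (C * norm (exp (- z)) ^ M)"
        using E[of z] z by (intro mult_left_mono) auto
      ultimately show "norm (f z - evp (truncate_fps M b) z) \<le> C * norm (pref z) * norm (exp (- z)) ^ M"
        by (simp add: norm_mult mult_ac)
    qed
  next
    assume *: "expansion_bound b f a e M C R"
    show "\<exists>E. \<forall>z. a \<le> Im z \<and> Im z \<le> e \<and> norm (exp z) \<ge> R \<longrightarrow>
         f z = pref z * (poly (truncate_fps M b) (exp (- z)) + E z) \<and> norm (E z) \<le> C * norm (exp (- z)) ^ M"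
    proof (intro exI[of _ "\<lambda>z. (f z - evp (truncate_fps M b) z) / pref z"] allI impI conjI)
      fix z assume z: "a \<le> Im z \<and> Im z \<le> e \<and> R \<le> norm (exp z)"
      show "f z = pref z * (poly (truncate_fps M b) (exp (- z)) + (f z - evp (truncate_fps M b) z) / pref z)"
        by (simp add: evp_def field_simps)
      have "norm (f z - evp (truncate_fps M b) z) \<le> C * norm (pref z) * norm (exp (- z)) ^ M"
        using * z unfolding expansion_bound_def by blast
      then show "norm ((f z - evp (truncate_fps M b) z) / pref z) \<le> C * norm (exp (- z)) ^ M"
        by (simp add: norm_divide divide_le_eq mult_ac)
    qed
  qed
  show ?thesis
    unfolding has_expansion_on_def pref sum pow abs U_arg_def iff[symmetric] by (simp only: swap)
qed

lemma asym_imp_has_expansion: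
  assumes J: "solution J" "asym J S"
  shows "has_expansion_on n xi J (formal_J n s lam xi) S"
  unfolding has_expansion_on_iff
proof (intro allI impI)
  fix M a e assume sub: "{z. a \<le> Im z \<and> Im z \<le> e} \<subseteq> S"
  let ?b = "formal_J n s lam xi"
  \<comment> \<open>The factor 2 is due to the energy being quadratic; the summand n pays for
    replacing exp (mu z) by the prefactor with \<open>norm_pref_ge\<close>.\<close>
  define M' where "M' = 2 * (M + n)"
  obtain C R where C: "\<And>z. z \<in> S \<Longrightarrow> R \<le> norm (exp z) \<Longrightarrow>
      energy (\<lambda>z. J z - trunc M' z) z \<le> C * norm (exp (- z)) ^ M'"
    using J(2) unfolding asym_def by metis
  have "coeff (truncate_fps M' ?b - truncate_fps M ?b) i = 0" if "i < M" for i
    using that by (simp add: coeff_truncate_fps M'_def)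
  then obtain D where D: "D \<ge> 0" "\<And>X. norm X \<le> 1 \<Longrightarrow>
      norm (poly (truncate_fps M' ?b - truncate_fps M ?b) X) \<le> D * norm X ^ M"
    using norm_poly_le_low_order by metis
  define K where "K = sqrt (real n * \<bar>C\<bar>)"
  have "expansion_bound ?b J a e M (K + D) (max 1 R)"
    unfolding expansion_bound_def
  proof (intro allI impI)
    fix z assume z: "a \<le> Im z \<and> Im z \<le> e \<and> max 1 R \<le> norm (exp z)"
    define x where "x = norm (exp (- z))"
    have x: "0 \<le> x" "x \<le> 1" using norm_exp_uminus_le_1[of z] z unfolding x_def by auto
    have E: "norm (exp (mu * exp z)) * norm (exp (- mu * exp z)) = 1"
      by (simp add: exp_minus flip: norm_mult)
    have "norm ((J z - trunc M' z) * exp (- mu * exp z)) \<le> sqrt (real n * energy (\<lambda>z. J z - trunc M' z) z)"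
      using norm_deriv_le_energy[of 0 "\<lambda>z. J z - trunc M' z" z] n by simp
    also have "\<dots> \<le> sqrt (real n * (\<bar>C\<bar> * x ^ M'))"
    proof (intro real_sqrt_le_mono mult_left_mono)
      have "energy (\<lambda>z. J z - trunc M' z) z \<le> C * x ^ M'"
        using C[of z] z sub by (auto simp: x_def)
      also have "\<dots> \<le> \<bar>C\<bar> * x ^ M'" using x by (intro mult_right_mono) auto
      finally show "energy (\<lambda>z. J z - trunc M' z) z \<le> \<bar>C\<bar> * x ^ M'" .
    qed simp
    also have "\<dots> = K * x ^ (M + n)"
    proof -
      have "x ^ M' = (x ^ (M + n))\<^sup>2" by (simp add: M'_def power_mult[symmetric] mult.commute)
      then show ?thesis using x by (simp add: K_def real_sqrt_mult)
    qed
    finally have "norm (J z - trunc M' z) * norm (exp (- mu * exp z)) \<le> K * x ^ (M + n)"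
      by (simp add: norm_mult)
    then have "norm (J z - trunc M' z) * norm (exp (- mu * exp z)) * norm (exp (mu * exp z))
        \<le> K * x ^ (M + n) * norm (exp (mu * exp z))"
      by (rule mult_right_mono) simp
    then have "norm (J z - trunc M' z) * (norm (exp (mu * exp z)) * norm (exp (- mu * exp z)))
        \<le> K * x ^ M * (norm (exp (mu * exp z)) * x ^ n)"
      by (simp only: power_add mult_ac)
    then have "norm (J z - trunc M' z) \<le> K * x ^ M * (norm (exp (mu * exp z)) * x ^ n)"
      unfolding E by simp
    also have "\<dots> \<le> K * x ^ M * norm (pref z)"
      using norm_pref_ge[of z] x by (intro mult_left_mono) (auto simp: x_def K_def)
    finally have 1: "norm (J z - trunc M' z) \<le> K * x ^ M * norm (pref z)" .
    have "trunc M' z - evp (truncate_fps M ?b) z = pref z * poly (truncate_fps M' ?b - truncate_fps M ?b) (exp (- z))"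
      by (simp add: trunc_def evp_def algebra_simps)
    then have 2: "norm (trunc M' z - evp (truncate_fps M ?b) z) \<le> norm (pref z) * (D * x ^ M)"
      using D(2)[of "exp (- z)"] x by (simp add: norm_mult x_def mult_left_mono)
    have "norm (J z - evp (truncate_fps M ?b) z) \<le> norm (J z - trunc M' z) + norm (trunc M' z - evp (truncate_fps M ?b) z)"
      using norm_triangle_ineq[of "J z - trunc M' z" "trunc M' z - evp (truncate_fps M ?b) z"] by simp
    also have "\<dots> \<le> (K + D) * norm (pref z) * x ^ M"
      using 1 2 by (simp add: algebra_simps)
    finally show "norm (J z - evp (truncate_fps M ?b) z) \<le> (K + D) * norm (pref z) * norm (exp (- z)) ^ M"
      by (simp add: x_def)
  qed
  then show "\<exists>C R. expansion_bound ?b J a e M C R" by blast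
qed

text \<open>The relative error g is differentiated in the logarithmic coordinate, where discs of
  fixed radius correspond to regions of size proportional to |z|. Cauchy's estimate needs a slightly
  larger closed subsector, which exists because the sector is open.\<close>

lemma has_expansion_on_U_deriv:
  assumes f: "f holomorphic_on UNIV" and ex: "has_expansion_on n xi f b (sector_at xi h)"
  shows "has_expansion_on n xi (U_deriv f) (formal_deriv n xi b) (sector_at xi h)"
  unfolding has_expansion_on_iff
proof (intro allI impI)
  fix M a e assume sub: "{z. a \<le> Im z \<and> Im z \<le> e} \<subseteq> sector_at xi h"
  show "\<exists>C R. expansion_bound (formal_deriv n xi b) (U_deriv f) a e M C R"
  proof (cases "a \<le> e")
    case False
    then show ?thesis by (auto simp: expansion_bound_def)
  next
    case True
    have "Complex 0 a \<in> sector_at xi h" "Complex 0 e \<in> sector_at xi h"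
      using True by (intro subsetD[OF sub]; simp)+
    then have ae: "alpha - h < a" "e < alpha + h"
      by (auto simp: sector_at_def U_arg_def alpha_def abs_less_iff)
    define \<epsilon> where "\<epsilon> = min (a - (alpha - h)) (alpha + h - e) / 2"
    have \<epsilon>: "\<epsilon> > 0" "alpha - h < a - \<epsilon>" "e + \<epsilon> < alpha + h"
      using ae by (auto simp: \<epsilon>_def min_def field_simps)
    have "{z. a - \<epsilon> \<le> Im z \<and> Im z \<le> e + \<epsilon>} \<subseteq> sector_at xi h"
      using \<epsilon> by (auto simp: sector_at_def U_arg_def alpha_def abs_less_iff)
    then obtain C R where CR: "expansion_bound b f (a - \<epsilon>) (e + \<epsilon>) M C R"
      using ex unfolding has_expansion_on_iff by blast
    define T where "T = truncate_fps M b"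
    define g where "g z = (f z - evp T z) / pref z" for z
    have g_holo: "g holomorphic_on UNIV"
      unfolding g_def[abs_def] by (intro holomorphic_intros f holomorphic_evp holomorphic_pref) auto
    have g_bound: "norm (g z) \<le> \<bar>C\<bar> * norm (exp (- z)) ^ M"
      if "a - \<epsilon> \<le> Im z" "Im z \<le> e + \<epsilon>" "R \<le> norm (exp z)" for z
    proof -
      have "norm (f z - evp T z) \<le> C * norm (pref z) * norm (exp (- z)) ^ M"
        using CR that unfolding expansion_bound_def T_def by blast
      also have "\<dots> \<le> \<bar>C\<bar> * norm (pref z) * norm (exp (- z)) ^ M"
        by (intro mult_right_mono) auto
      finally show ?thesis by (simp add: g_def norm_divide divide_le_eq mult_ac)
    qed
    have g': "(g has_field_derivative deriv g z) (at z)" for z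
      using holomorphic_derivI[OF g_holo open_UNIV] by simp
    \<comment> \<open>On the circle of radius epsilon about z, |w| is at least |z| exp (- epsilon):
      this gives the power of \<open>exp \<epsilon>\<close> here and the larger threshold for |z|
      below. The division is the one in Cauchy's estimate.\<close>
    define C1 where "C1 = \<bar>C\<bar> * exp \<epsilon> ^ M / \<epsilon>"
    have g'_bound: "norm (deriv g z) \<le> C1 * norm (exp (- z)) ^ M"
      if z: "a \<le> Im z" "Im z \<le> e" "\<bar>R\<bar> * exp \<epsilon> \<le> norm (exp z)" for z
    proof -
      have "norm ((deriv ^^ 1) g z) \<le> fact 1 * (\<bar>C\<bar> * (exp \<epsilon> * norm (exp (- z))) ^ M) / \<epsilon> ^ 1"
      proof (rule Cauchy_inequality)
        show "g holomorphic_on ball z \<epsilon>" "continuous_on (cball z \<epsilon>) g"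
          using g_holo by (auto intro: holomorphic_on_subset holomorphic_on_imp_continuous_on)
        fix w assume w: "norm (z - w) = \<epsilon>"
        have "\<bar>Re (z - w)\<bar> \<le> \<epsilon>" "\<bar>Im (z - w)\<bar> \<le> \<epsilon>"
          using abs_Re_le_cmod[of "z - w"] abs_Im_le_cmod[of "z - w"] w by auto
        then have w': "Re w \<ge> Re z - \<epsilon>" "a - \<epsilon> \<le> Im w" "Im w \<le> e + \<epsilon>"
          using z by (auto simp: abs_le_iff)
        have "\<bar>R\<bar> * exp \<epsilon> \<le> exp (Re z)" using z(3) by (simp add: norm_exp_eq_Re)
        also have "exp (Re z) \<le> exp (Re w + \<epsilon>)" using w' by simp
        also have "\<dots> = exp (Re w) * exp \<epsilon>" by (rule exp_add)
        finally have "\<bar>R\<bar> \<le> exp (Re w)" by simp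
        then have "R \<le> norm (exp w)" by (simp add: norm_exp_eq_Re)
        then have "norm (g w) \<le> \<bar>C\<bar> * norm (exp (- w)) ^ M" using g_bound w' by simp
        also have "norm (exp (- w)) \<le> exp \<epsilon> * norm (exp (- z))"
          using w' by (simp add: norm_exp_eq_Re flip: exp_add)
        then have "\<bar>C\<bar> * norm (exp (- w)) ^ M \<le> \<bar>C\<bar> * (exp \<epsilon> * norm (exp (- z))) ^ M"
          by (intro mult_left_mono power_mono) auto
        finally show "norm (g w) \<le> \<bar>C\<bar> * (exp \<epsilon> * norm (exp (- z))) ^ M" .
      qed (use \<epsilon> in auto)
      then show ?thesis by (simp add: C1_def power_mult_distrib)
    qed
    have f_eq: "f = (\<lambda>z. pref z * (poly T (exp (- z)) + g z))"
      by (auto simp: g_def evp_def field_simps)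
    have T': "((\<lambda>z. poly T (exp (- z))) has_field_derivative poly (pderiv T) (exp (- z)) * (- exp (- z))) (at z)" for z
      by (rule DERIV_chain2[OF poly_DERIV]) (auto intro!: derivative_eq_intros)
    have "U_deriv f z = pref z * (mu * (poly T (exp (- z)) + g z) - (of_nat n - 1) / 2 * exp (- z) * (poly T (exp (- z)) + g z)
        + exp (- z) * (poly (pderiv T) (exp (- z)) * (- exp (- z)) + deriv g z))" for z
      unfolding f_eq U_deriv_pref[OF DERIV_add[OF T' g']] by (simp add: f_eq[symmetric])
    moreover have "U_deriv (evp T) z = pref z * (mu * poly T (exp (- z)) - (of_nat n - 1) / 2 * exp (- z) * poly T (exp (- z))
        + exp (- z) * (poly (pderiv T) (exp (- z)) * (- exp (- z))))" for z
      unfolding evp_def[abs_def] U_deriv_pref[OF T'] ..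
    ultimately have D: "U_deriv f z - evp (pder T) z =
        pref z * (mu * g z - (of_nat n - 1) / 2 * exp (- z) * g z + exp (- z) * deriv g z)" for z
      by (simp add: U_deriv_evp[symmetric] ring_distribs)
    \<comment> \<open>Below order M truncation commutes with formal differentiation, since the i-th
      coefficient of a derivative involves only the coefficients i and i - 1.\<close>
    have "coeff (pder T - truncate_fps M (formal_deriv n xi b)) i = 0" if "i < M" for i
    proof -
      have "coeff (pder T) i = fps_nth (formal_deriv n xi (fps_cutoff M b)) i"
        by (simp add: T_def fps_of_poly_pder flip: fps_of_poly_nth)
      also have "\<dots> = fps_nth (formal_deriv n xi b) i"
        using that by (simp add: formal_deriv_nth)
      finally show ?thesis using that by (simp add: coeff_truncate_fps)
    qed
    then obtain K where K: "K \<ge> 0" "\<And>X. norm X \<le> 1 \<Longrightarrow>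
        norm (poly (pder T - truncate_fps M (formal_deriv n xi b)) X) \<le> K * norm X ^ M"
      using norm_poly_le_low_order by metis
    have "expansion_bound (formal_deriv n xi b) (U_deriv f) a e M (K + (real n * \<bar>C\<bar> + real n * \<bar>C\<bar> + C1)) (max 1 (\<bar>R\<bar> * exp \<epsilon>))"
      unfolding expansion_bound_def
    proof (intro allI impI)
      fix z assume z: "a \<le> Im z \<and> Im z \<le> e \<and> max 1 (\<bar>R\<bar> * exp \<epsilon>) \<le> norm (exp z)"
      define x where "x = norm (exp (- z))"
      have x: "0 \<le> x" "x \<le> 1" using norm_exp_uminus_le_1[of z] z unfolding x_def by auto
      have "\<bar>R\<bar> * 1 \<le> \<bar>R\<bar> * exp \<epsilon>" using \<epsilon> by (intro mult_left_mono) auto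
      then have "R \<le> norm (exp z)" using z by linarith
      then have gb: "norm (g z) \<le> \<bar>C\<bar> * x ^ M"
        using g_bound[of z] z \<epsilon> by (simp add: x_def)
      have g'b: "norm (deriv g z) \<le> C1 * x ^ M"
        using g'_bound[of z] z by (simp add: x_def)
      have "norm ((of_nat n - 1) / 2 :: complex) \<le> real n"
      proof -
        have "(of_nat n - 1) / 2 = (of_real ((real n - 1) / 2) :: complex)" by simp
        then show ?thesis using n by (simp only: norm_of_real) simp
      qed
      then have 1: "norm ((of_nat n - 1) / 2 * exp (- z) * g z) \<le> real n * 1 * (\<bar>C\<bar> * x ^ M)"
        unfolding norm_mult using gb x by (intro mult_mono) (auto simp: x_def)
      have 2: "norm (exp (- z) * deriv g z) \<le> 1 * (C1 * x ^ M)"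
        unfolding norm_mult using g'b x by (intro mult_mono) (auto simp: x_def)
      have 3: "norm (mu * g z) \<le> real n * (\<bar>C\<bar> * x ^ M)"
        unfolding norm_mult norm_mu using gb by (intro mult_left_mono) auto
      have "norm (mu * g z - (of_nat n - 1) / 2 * exp (- z) * g z + exp (- z) * deriv g z)
          \<le> norm (mu * g z) + norm ((of_nat n - 1) / 2 * exp (- z) * g z) + norm (exp (- z) * deriv g z)"
        by (intro order_trans[OF norm_triangle_ineq] add_right_mono norm_triangle_ineq4)
      also have "\<dots> \<le> (real n * \<bar>C\<bar> + real n * \<bar>C\<bar> + C1) * x ^ M"
        using 1 2 3 by (simp add: algebra_simps)
      finally have 4: "norm (U_deriv f z - evp (pder T) z) \<le> norm (pref z) * ((real n * \<bar>C\<bar> + real n * \<bar>C\<bar> + C1) * x ^ M)"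
        unfolding D norm_mult by (rule mult_left_mono) simp
      have 5: "norm (evp (pder T) z - evp (truncate_fps M (formal_deriv n xi b)) z) \<le> norm (pref z) * (K * x ^ M)"
        unfolding evp_diff[symmetric] unfolding evp_def norm_mult
        using K(2)[of "exp (- z)"] x by (intro mult_left_mono) (auto simp: x_def)
      have "norm (U_deriv f z - evp (truncate_fps M (formal_deriv n xi b)) z) \<le>
          norm (U_deriv f z - evp (pder T) z) + norm (evp (pder T) z - evp (truncate_fps M (formal_deriv n xi b)) z)"
        using norm_triangle_ineq[of "U_deriv f z - evp (pder T) z" "evp (pder T) z - evp (truncate_fps M (formal_deriv n xi b)) z"]
        by simp
      also have "\<dots> \<le> (K + (real n * \<bar>C\<bar> + real n * \<bar>C\<bar> + C1)) * norm (pref z) * x ^ M"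
        using 4 5 by (simp add: algebra_simps)
      finally show "norm (U_deriv f z - evp (truncate_fps M (formal_deriv n xi b)) z)
          \<le> (K + (real n * \<bar>C\<bar> + real n * \<bar>C\<bar> + C1)) * norm (pref z) * norm (exp (- z)) ^ M"
        by (simp add: x_def)
    qed
    then show ?thesis by blast
  qed
qed

lemma has_expansion_on_U_deriv_funpow:
  assumes "f holomorphic_on UNIV" "has_expansion_on n xi f b (sector_at xi h)"
  shows "has_expansion_on n xi ((U_deriv ^^ j) f) ((formal_deriv n xi ^^ j) b) (sector_at xi h)"
  using assms by (induction j) (auto intro!: has_expansion_on_U_deriv holomorphic_U_deriv_funpow)

lemma has_expansion_on_mono:
  "has_expansion_on n xi f b S \<Longrightarrow> T \<subseteq> S \<Longrightarrow> has_expansion_on n xi f b T"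
  unfolding has_expansion_on_iff by blast

text \<open>Only the axis matters, and every sector of positive opening contains it. There the
  common truncations cancel, so the difference and its derivatives are small relative to exp (mu z)
  to the order that \<open>solution_zero\<close> requires.\<close>

lemma expansion_unique:
  assumes f: "solution f" "has_expansion_on n xi f b (sector_at xi h)"
    and g: "solution g" "has_expansion_on n xi g b (sector_at xi h)" and h: "h > 0"
  shows "f = g"
proof -
  define M where "M = rate 0 + 1"
  have holo: "f holomorphic_on UNIV" "g holomorphic_on UNIV" using f g by (auto simp: solution_def)
  have axis: "{z. alpha \<le> Im z \<and> Im z \<le> alpha} \<subseteq> sector_at xi h"
    using h by (auto simp: sector_at_def U_arg_def alpha_def)
  have "\<exists>C R. \<forall>z. Im z = alpha \<and> R \<le> norm (exp z) \<longrightarrow>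
      norm ((U_deriv ^^ j) (\<lambda>z. f z - g z) z * exp (- mu * exp z)) \<le> C * norm (exp (- z)) ^ M" for j
  proof -
    let ?b = "truncate_fps M ((formal_deriv n xi ^^ j) b)"
    obtain C R where C: "expansion_bound ((formal_deriv n xi ^^ j) b) ((U_deriv ^^ j) f) alpha alpha M C R"
      using has_expansion_on_U_deriv_funpow[OF holo(1) f(2), of j] axis unfolding has_expansion_on_iff by blast
    obtain C' R' where C': "expansion_bound ((formal_deriv n xi ^^ j) b) ((U_deriv ^^ j) g) alpha alpha M C' R'"
      using has_expansion_on_U_deriv_funpow[OF holo(2) g(2), of j] axis unfolding has_expansion_on_iff by blast
    have "norm ((U_deriv ^^ j) (\<lambda>z. f z - g z) z * exp (- mu * exp z)) \<le> (\<bar>C\<bar> + \<bar>C'\<bar>) * norm (exp (- z)) ^ M"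
      if z: "Im z = alpha" "max 1 (max R R') \<le> norm (exp z)" for z
    proof -
      define x where "x = norm (exp (- z)) ^ M"
      have x: "x \<ge> 0" by (simp add: x_def)
      have 1: "norm ((U_deriv ^^ j) f z - evp ?b z) \<le> C * norm (pref z) * x"
        using C z unfolding expansion_bound_def x_def by simp
      have 2: "norm ((U_deriv ^^ j) g z - evp ?b z) \<le> C' * norm (pref z) * x"
        using C' z unfolding expansion_bound_def x_def by simp
      have "norm ((U_deriv ^^ j) f z - (U_deriv ^^ j) g z) \<le>
          norm ((U_deriv ^^ j) f z - evp ?b z) + norm ((U_deriv ^^ j) g z - evp ?b z)"
        using norm_triangle_ineq4[of "(U_deriv ^^ j) f z - evp ?b z" "(U_deriv ^^ j) g z - evp ?b z"] by simp
      also have "\<dots> \<le> (C + C') * x * norm (pref z)" using 1 2 by (simp add: algebra_simps)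
      also have "\<dots> \<le> (\<bar>C\<bar> + \<bar>C'\<bar>) * x * norm (pref z)" using x by (intro mult_right_mono) auto
      finally have "norm ((U_deriv ^^ j) f z - (U_deriv ^^ j) g z) * norm (exp (- mu * exp z))
          \<le> (\<bar>C\<bar> + \<bar>C'\<bar>) * x * norm (pref z) * norm (exp (- mu * exp z))"
        by (rule mult_right_mono) simp
      also have "\<dots> = (\<bar>C\<bar> + \<bar>C'\<bar>) * x * norm (pref z * exp (- mu * exp z))"
        by (simp add: norm_mult)
      also have "\<dots> \<le> (\<bar>C\<bar> + \<bar>C'\<bar>) * x * 1"
        using norm_pref_le[of z] norm_exp_uminus_le_1[of z] z x by (intro mult_left_mono) auto
      finally show ?thesis
        by (simp add: U_deriv_funpow_diff holo norm_mult x_def)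
    qed
    then show ?thesis by blast
  qed
  then obtain C R where C: "\<And>j z. Im z = alpha \<Longrightarrow> R j \<le> norm (exp z) \<Longrightarrow>
      norm ((U_deriv ^^ j) (\<lambda>z. f z - g z) z * exp (- mu * exp z)) \<le> C j * norm (exp (- z)) ^ M" by metis
  define K where "K = (\<Sum>j<n. \<bar>C j\<bar>)"
  define Q where "Q = (\<Sum>j<n. \<bar>R j\<bar>)"
  have "energy (\<lambda>z. f z - g z) (pt r) \<le> (real n * K\<^sup>2) / r ^ (rate 0 + 1)" if r: "r \<ge> max 1 Q" for r
  proof -
    have r1: "r \<ge> 1" using r by simp
    have "energy (\<lambda>z. f z - g z) (pt r) \<le> real n * (K * (1 / r) ^ M)\<^sup>2"
    proof (rule energy_le_of_deriv_bounds)
      fix j assume j: "j < n"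
      have "\<bar>R j\<bar> \<le> Q" unfolding Q_def using j by (intro member_le_sum) auto
      then have "norm ((U_deriv ^^ j) (\<lambda>z. f z - g z) (pt r) * exp (- mu * exp (pt r))) \<le> C j * norm (exp (- pt r)) ^ M"
        using r norm_exp_pt[of r] by (intro C) (auto simp: pt_def)
      also have "\<dots> = C j * (1 / r) ^ M"
        using r1 norm_exp_pt[of r] by (simp add: norm_exp_uminus)
      also have "C j \<le> K" unfolding K_def
        using j member_le_sum[of j "{..<n}" "\<lambda>j. \<bar>C j\<bar>"] by auto
      then have "C j * (1 / r) ^ M \<le> K * (1 / r) ^ M" using r1 by (intro mult_right_mono) auto
      finally show "norm ((U_deriv ^^ j) (\<lambda>z. f z - g z) (pt r) * exp (- mu * exp (pt r))) \<le> K * (1 / r) ^ M" .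
    qed
    also have "\<dots> = real n * K\<^sup>2 / r ^ (2 * M)"
      by (simp add: power_mult_distrib power_divide power_mult[symmetric] mult.commute)
    also have "\<dots> \<le> real n * K\<^sup>2 / r ^ M"
      using r1 by (intro divide_left_mono power_increasing) auto
    finally show ?thesis by (simp add: M_def)
  qed
  then have energy: "\<And>r. max 1 Q \<le> r \<Longrightarrow> energy (\<lambda>z. f z - g z) (pt r) \<le> (real n * K\<^sup>2) / r ^ (rate 0 + 1)" .
  have "f z - g z = 0" for z
  proof (rule solution_zero[where f = "\<lambda>z. f z - g z", OF _ _ energy])
    show "(\<lambda>z. f z - g z) holomorphic_on UNIV" by (intro holomorphic_intros holo)
    show "bessel_op n lam xi (\<lambda>z. f z - g z) z = 0" for z
      using f(1) g(1) by (simp add: bessel_op_diff holo solution_def)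
  qed
  then show ?thesis by auto
qed

end

theorem proposition11p18:
  fixes n :: nat and lam :: "nat \<Rightarrow> complex" and s :: complex and xi :: ucover
    and \<theta> :: real
  assumes "n \<ge> 2"
    and "(\<Sum>l=1..n. lam l) = 0"
    and "s \<in> {1, -1}"
    and "U_proj xi ^ n = s"
    and "0 < \<theta>" and "\<theta> < pi / 2"
  defines "S' \<equiv> sector_at xi (pi + pi / real n - \<theta>)"
  shows "bessel_solution n s lam (bessel_J n s lam xi)
       \<and> has_expansion_on n xi (bessel_J n s lam xi) (formal_J n s lam xi) S'
       \<and> (\<forall>w. bessel_solution n s lam w \<and> has_expansion_on n xi w (formal_J n s lam xi) S'
              \<longrightarrow> w = bessel_J n s lam xi)
       \<and> (\<forall>j. has_expansion_on n xi ((U_deriv ^^ j) (bessel_J n s lam xi))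
                ((formal_deriv n xi ^^ j) (formal_J n s lam xi)) S')"
proof -
  interpret bessel_data n lam s xi
    using assms by unfold_locales auto
  have sol: "bessel_solution n s lam w \<longleftrightarrow> solution w" for w
    by (simp add: bessel_solution_iff[OF root] solution_def)
  have sub: "sector_at xi (pi / real n) \<subseteq> S'"
    using assms(5,6) pi_gt_zero by (auto simp: S'_def sector_at_def)
  have pos: "pi / real n > 0" using n by simp
  then have pos': "pi + pi / real n - \<theta> > 0" using assms(6) pi_gt_zero by linarith
  obtain J where J: "solution J" "asym J S'"
    using asym_sector_exists[OF assms(5,6)] unfolding S'_def by blast
  have ex: "has_expansion_on n xi J (formal_J n s lam xi) S'"
    using asym_imp_has_expansion[OF J] .
  \<comment> \<open>The expansion on the wide sector restricts to the narrow one, where uniqueness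
    already holds; so the solution found is the one described by \<open>bessel_J\<close>.\<close>
  have J_eq: "bessel_J n s lam xi = J"
    unfolding bessel_J_def sol
    using J(1) has_expansion_on_mono[OF ex sub] expansion_unique[OF _ _ _ _ pos]
    by (intro the_equality) blast+
  have unique: "w = J" if "solution w" "has_expansion_on n xi w (formal_J n s lam xi) S'" for w
    using expansion_unique[OF that(1) that(2)[unfolded S'_def] J(1) ex[unfolded S'_def] pos'] .
  have "has_expansion_on n xi ((U_deriv ^^ j) J) ((formal_deriv n xi ^^ j) (formal_J n s lam xi)) S'" for j
    using J(1) ex unfolding S'_def by (intro has_expansion_on_U_deriv_funpow) (auto simp: solution_def)
  then show ?thesis
    unfolding J_eq sol using J(1) ex unique by blast
qed

end
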